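(* Let $n\ge 3$ and let $(M_j,g_j)$, $j=1,2$, be two open, smooth, globally hyperbolic Lorentzian manifolds of dimension $n$ and signature type $(1,n-1)$. Let $\mu_{g_j}=\mu_j:[-1,1]\to M_j$ be a time-like geodesic, $p_j^\pm=\mu_{j}(s_\pm)$, and let $U_j=U_{g_j}\subset M_j$ be the open relatively compact neighborhood of $\mu_j([s_-,s_+])$ defined in the context. Let $V_j$ be open, relatively compact subsets of $I^-(p_j^+)\setminus J^-(p_j^-)$. Assume there is a diffeomorphism $\Phi:U_1\to U_2$ with $\Phi(\mu_1(s))=\mu_2(s)$ for $s\in[s_-,s_+]$ whose power set extension defines a bijection from $\{\mathcal P_{U_1}(q): q\in V_1\}$ onto $\{\mathcal P_{U_2}(q): q\in V_2\}$, and let $\Psi:V_1\to V_2$ be a diffeomorphism such that $\Psi^*g_2$ is conformal to $g_1$. Moreover, assume that $\Psi$ and $\Phi$ agree on $U_1\cap V_1$ (so that $\Psi$ is regarded as a map on $U_1\cup V_1$ with $\Psi|_{U_1}=\Phi$), that $\Phi=\Psi|_{U_1}:(U_1,g_1)\to(U_2,g_2)$ is an isometry, and that for $j=1,2$ there are sets $W_j\subset M_j$ such that the Ricci curvature of $g_j$ is zero in $W_j$, $V_j\subset W_j\cup U_j$, and $\Psi(U_1\setminus W_1)=U_2\setminus W_2$. Finally assume that any point $x\in V_1\cap W_1$ can be connected to some point $y\in U_1\cap W_1$ by a light-like geodesic $\gamma_{x,\xi}([0,l])\subset V_1\cap W_1$. Then the metric $\Psi^*g_2$ is isometric to $g_1$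 in $V_1$.
   Context: Conventions. A Lorentzian manifold $(M,g)$ with signature $(-,+,\dots,+)$ is assumed to have a causal structure (time orientation given by a globally defined smooth time-like vector field). It is globally hyperbolic if there are no closed causal paths and, for all $q^-<q^+$, the set $J(q^-,q^+)=J^+(q^-)\cap J^-(q^+)$ is compact. Write $x\ll y$ if $x\ne y$ and there is a future-directed time-like path from $x$ to $y$; $x<y$ if $x\neq y$ and there is a future-directed causal path from $x$ to $y$; $x\le y$ if $x<y$ or $x=y$. $I^+(p)=\{x: p\ll x\}$, $J^+(p)=\{x:p\le x\}$, and $I^-(p),J^-(p)$ are the analogous pasts. $L^+_xM\subset T_xM$ is the set of future-pointing light-like vectors and $\gamma_{x,\xi}(t)=\exp_x(t\xi)$. $g^+$ is the Riemannian metric associated to $g$ which in local coordinates has the same eigenvectors as $g$ and as eigenvalues the absolute values of the eigenvalues of $g$. The power set extension of a map $\Phi$ is $B\mapsto\{\Phi(b):b\in B\}$. Observers and the set $U_g$. Let $\mu_g:[-1,1]\to M$ be a future-directed time-like geodesic, and $-1<s_{-2}<s_{-1}<s_{+1}<s_{+2}<s_{+3}<s_{+4}<1$, $s_\pm=s_{\pm1}$, $p^\pm=\mu_g(s_\pm)$. Put $z_0=\mu_g(s_{-2})$, $\eta_0=\dot\mu_g(s_{-2})$, and let $\mathcal U_{z_0,\eta_0}(h)\subset TM$ be the $h$-neighborhood of $(z_0,\eta_0)$ in the Sasaki metric of $(TM,g^+)$. For $(z,\eta)\in\mathcal U_{z_0,\eta_0}(2\hat h)$ let $\mu_{g,z,\eta}:[-1,1]\to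 M$ be the geodesic with $\mu_{g,z,\eta}(s_{-2})=z$, $\dot\mu_{g,z,\eta}(s_{-2})=\eta$; the parameter $\hat h>0$ is fixed so small that all these geodesics are well defined and time-like and satisfy $\mu_{g,z,\eta}(s_{-2})\in I^-(\mu_g(s_{-1}))$, $\mu_{g,z,\eta}(s_{+2})\in I^+(\mu_g(s_{+1}))$, $\mu_{g,z,\eta}(s_{+4})\in I^+(\mu_g(s_{+3}))$. Define $$U_g=\bigcup_{(z,\eta)\in\mathcal U_{z_0,\eta_0}(\hat h)}\mu_{g,z,\eta}((-1,1)).$$ Light-observation points. For $q\in M$ and $U\subset M$, $\mathcal P_U(q)=\{\gamma_{q,\eta}(r)\in U:\ r\ge 0,\ \eta\in L_q^+M\}$. *)

theory Defs
  imports "HOL-Analysis.Analysis"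
begin

section \<open>Smooth maps between open subsets of Euclidean spaces\<close>

primrec Ck_on :: "nat \<Rightarrow> ('a::real_normed_vector \<Rightarrow> 'b::real_normed_vector) \<Rightarrow> 'a set \<Rightarrow> bool" where
  "Ck_on 0 f S \<longleftrightarrow> continuous_on S f"
| "Ck_on (Suc k) f S \<longleftrightarrow> (\<forall>x\<in>S. f differentiable (at x)) \<and>
     (\<forall>v. Ck_on k (\<lambda>x. frechet_derivative f (at x) v) S)"

definition smooth_on :: "('a::real_normed_vector \<Rightarrow> 'b::real_normed_vector) \<Rightarrow> 'a set \<Rightarrow> bool" where
  "smooth_on f S \<longleftrightarrow> (\<forall>k. Ck_on k f S)"

definition pderiv_on :: "'n::finite \<Rightarrow> (real^'n \<Rightarrow> real) \<Rightarrow> real^'n \<Rightarrow> real" where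
  "pderiv_on i f u = frechet_derivative f (at u) (axis i 1)"


section \<open>Smooth manifolds and tangent vectors\<close>

type_synonym ('m, 'n) chart = "'m set \<times> ('m \<Rightarrow> real^'n)"

abbreviation cdom :: "('m, 'n) chart \<Rightarrow> 'm set" where "cdom c \<equiv> fst c"
abbreviation cmap :: "('m, 'n) chart \<Rightarrow> 'm \<Rightarrow> real^'n" where "cmap c \<equiv> snd c"
abbreviation cimg :: "('m, 'n) chart \<Rightarrow> (real^'n) set" where "cimg c \<equiv> cmap c ` cdom c"

definition cinv :: "('m, 'n) chart \<Rightarrow> real^'n \<Rightarrow> 'm" where
  "cinv c = inv_into (cdom c) (cmap c)"

text \<open>The manifold is the whole type \<open>'m\<close>; its dimension is \<open>CARD('n)\<close>. An atlas need not be
  maximal.\<close>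

definition smooth_atlas ::
    "('m::{t2_space, second_countable_topology}, 'n::finite) chart set \<Rightarrow> bool" where
  "smooth_atlas A \<longleftrightarrow>
     (\<Union>c\<in>A. cdom c) = UNIV \<and>
     (\<forall>c\<in>A. open (cdom c) \<and> open (cimg c) \<and> homeomorphism (cdom c) (cimg c) (cmap c) (cinv c)) \<and>
     (\<forall>c\<in>A. \<forall>d\<in>A. smooth_on (cmap d \<circ> cinv c) (cmap c ` (cdom c \<inter> cdom d)))"

definition chart_at :: "('m, 'n) chart set \<Rightarrow> 'm \<Rightarrow> ('m, 'n) chart" where
  "chart_at A x = (SOME c. c \<in> A \<and> x \<in> cdom c)"

text \<open>A tangent vector at \<open>x\<close> is the family of its coordinate representations in the charts around
  \<open>x\<close>, related by the Jacobians of the transition maps; the entries at all other charts are \<open>0\<close>, so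
  that equality of tangent vectors is equality of functions.\<close>

type_synonym ('m, 'n) tvec = "('m, 'n) chart \<Rightarrow> real^'n"

definition tangent_space :: "('m, 'n::finite) chart set \<Rightarrow> 'm \<Rightarrow> ('m, 'n) tvec set" where
  "tangent_space A x = {v.
     (\<forall>c\<in>A. \<forall>d\<in>A. x \<in> cdom c \<longrightarrow> x \<in> cdom d \<longrightarrow>
        v d = frechet_derivative (cmap d \<circ> cinv c) (at (cmap c x)) (v c)) \<and>
     (\<forall>c. c \<notin> A \<or> x \<notin> cdom c \<longrightarrow> v c = 0)}"

abbreviation zero_tvec :: "('m, 'n::finite) tvec" where "zero_tvec \<equiv> (\<lambda>c. 0)"

text \<open>The tangent vector at \<open>x\<close> with components \<open>a\<close> in the local coordinates \<open>c\<close>, where \<open>c\<close> may be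
  any chart compatible with \<open>A\<close>.\<close>

definition tvec_of ::
    "('m, 'n::finite) chart set \<Rightarrow> ('m, 'n) chart \<Rightarrow> 'm \<Rightarrow> real^'n \<Rightarrow> ('m, 'n) tvec" where
  "tvec_of A c x a = (\<lambda>d. if d \<in> A \<and> x \<in> cdom d
     then frechet_derivative (cmap d \<circ> cinv c) (at (cmap c x)) a else 0)"

definition smooth_map ::
    "('m::topological_space, 'n::finite) chart set \<Rightarrow> ('k::topological_space, 'n) chart set \<Rightarrow>
     'm set \<Rightarrow> ('m \<Rightarrow> 'k) \<Rightarrow> bool" where
  "smooth_map A B U f \<longleftrightarrow> continuous_on U f \<and>
     (\<forall>c\<in>A. \<forall>d\<in>B. smooth_on (cmap d \<circ> f \<circ> cinv c) (cmap c ` (U \<inter> cdom c \<inter> f -` cdom d)))"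

definition smooth_fun :: "('m, 'n::finite) chart set \<Rightarrow> 'm set \<Rightarrow> ('m \<Rightarrow> real) \<Rightarrow> bool" where
  "smooth_fun A U f \<longleftrightarrow> (\<forall>c\<in>A. smooth_on (f \<circ> cinv c) (cmap c ` (U \<inter> cdom c)))"

definition diffeomorphism ::
    "('m::topological_space, 'n::finite) chart set \<Rightarrow> ('k::topological_space, 'n) chart set \<Rightarrow>
     'm set \<Rightarrow> 'k set \<Rightarrow> ('m \<Rightarrow> 'k) \<Rightarrow> bool" where
  "diffeomorphism A B U V f \<longleftrightarrow>
     bij_betw f U V \<and> smooth_map A B U f \<and> smooth_map B A V (inv_into U f)"

definition differential ::
    "('m, 'n::finite) chart set \<Rightarrow> ('k, 'n) chart set \<Rightarrow> ('m \<Rightarrow> 'k) \<Rightarrow> 'm \<Rightarrow>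
     ('m, 'n) tvec \<Rightarrow> ('k, 'n) tvec" where
  "differential A B f x v = (let c = chart_at A x in
     (\<lambda>d. if d \<in> B \<and> f x \<in> cdom d
        then frechet_derivative (cmap d \<circ> f \<circ> cinv c) (at (cmap c x)) (v c) else 0))"


section \<open>Metrics, connections and curvature\<close>

type_synonym ('m, 'n) metric = "'m \<Rightarrow> ('m, 'n) tvec \<Rightarrow> ('m, 'n) tvec \<Rightarrow> real"

definition metric_matrix ::
    "('m, 'n::finite) chart set \<Rightarrow> ('m, 'n) metric \<Rightarrow> ('m, 'n) chart \<Rightarrow> real^'n \<Rightarrow> real^'n^'n" where
  "metric_matrix A g c u = (\<chi> i j. g (cinv c u)
     (tvec_of A c (cinv c u) (axis i 1)) (tvec_of A c (cinv c u) (axis j 1)))"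

text \<open>A smooth symmetric covariant 2-tensor field. The last clause says that each \<open>g x\<close> is bilinear
  on the tangent space.\<close>

definition smooth_sym_tensor ::
    "('m, 'n::finite) chart set \<Rightarrow> ('m, 'n) metric \<Rightarrow> bool" where
  "smooth_sym_tensor A g \<longleftrightarrow>
     (\<forall>c\<in>A. smooth_on (metric_matrix A g c) (cimg c)) \<and>
     (\<forall>x. \<forall>v\<in>tangent_space A x. \<forall>w\<in>tangent_space A x. g x v w = g x w v) \<and>
     (\<forall>x. \<forall>v\<in>tangent_space A x. \<forall>w\<in>tangent_space A x. \<forall>c\<in>A. x \<in> cdom c \<longrightarrow>
        g x v w = v c \<bullet> (metric_matrix A g c (cmap c x) *v w c))"

definition riemannian_metric ::
    "('m, 'n::finite) chart set \<Rightarrow> ('m, 'n) metric \<Rightarrow> bool" where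
  "riemannian_metric A h \<longleftrightarrow> smooth_sym_tensor A h \<and>
     (\<forall>x. \<forall>v\<in>tangent_space A x. v \<noteq> zero_tvec \<longrightarrow> h x v v > 0)"

text \<open>Congruent to \<open>diag(-1, 1, \<dots>, 1)\<close> up to the order of the basis.\<close>

definition lorentz_signature :: "real^'n::finite^'n \<Rightarrow> bool" where
  "lorentz_signature G \<longleftrightarrow> (\<exists>(P :: real^'n^'n) k. invertible P \<and>
     transpose P ** G ** P = (\<chi> i j. if i = j then (if i = k then - 1 else 1) else 0))"

definition lorentzian_metric ::
    "('m, 'n::finite) chart set \<Rightarrow> ('m, 'n) metric \<Rightarrow> bool" where
  "lorentzian_metric A g \<longleftrightarrow> smooth_sym_tensor A g \<and>
     (\<forall>c\<in>A. \<forall>x\<in>cdom c. lorentz_signature (metric_matrix A g c (cmap c x)))"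

text \<open>Christoffel symbols of the second kind: \<open>christoffel A g c k i j u\<close> is
  \<open>\<Gamma>\<^sup>k\<^sub>i\<^sub>j\<close> at the coordinate point \<open>u\<close>.\<close>

definition christoffel ::
    "('m, 'n::finite) chart set \<Rightarrow> ('m, 'n) metric \<Rightarrow> ('m, 'n) chart \<Rightarrow>
     'n \<Rightarrow> 'n \<Rightarrow> 'n \<Rightarrow> real^'n \<Rightarrow> real" where
  "christoffel A g c k i j u = (let G = metric_matrix A g c in
     (\<Sum>l\<in>UNIV. matrix_inv (G u) $ k $ l *
        (pderiv_on i (\<lambda>w. G w $ j $ l) u + pderiv_on j (\<lambda>w. G w $ i $ l) u
         - pderiv_on l (\<lambda>w. G w $ i $ j) u)) / 2)"

definition christoffel_form ::
    "('m, 'n::finite) chart set \<Rightarrow> ('m, 'n) metric \<Rightarrow> ('m, 'n) chart \<Rightarrow> real^'n \<Rightarrow>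
     real^'n \<Rightarrow> real^'n \<Rightarrow> real^'n" where
  "christoffel_form A g c u a b =
     (\<chi> k. \<Sum>i\<in>UNIV. \<Sum>j\<in>UNIV. christoffel A g c k i j u * a $ i * b $ j)"

definition ricci ::
    "('m, 'n::finite) chart set \<Rightarrow> ('m, 'n) metric \<Rightarrow> ('m, 'n) chart \<Rightarrow>
     'n \<Rightarrow> 'n \<Rightarrow> real^'n \<Rightarrow> real" where
  "ricci A g c i j u = (let \<Gamma> = christoffel A g c in
     (\<Sum>k\<in>UNIV. pderiv_on k (\<Gamma> k i j) u) - (\<Sum>k\<in>UNIV. pderiv_on j (\<Gamma> k i k) u)
     + (\<Sum>k\<in>UNIV. \<Sum>l\<in>UNIV. \<Gamma> k k l u * \<Gamma> l i j u)
     - (\<Sum>k\<in>UNIV. \<Sum>l\<in>UNIV. \<Gamma> k j l u * \<Gamma> l i k u))"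

definition ricci_zero_on ::
    "('m, 'n::finite) chart set \<Rightarrow> ('m, 'n) metric \<Rightarrow> 'm set \<Rightarrow> bool" where
  "ricci_zero_on A g W \<longleftrightarrow>
     (\<forall>c\<in>A. \<forall>x\<in>W \<inter> cdom c. \<forall>i j. ricci A g c i j (cmap c x) = 0)"

definition pullback_metric ::
    "('m, 'n::finite) chart set \<Rightarrow> ('k, 'n) chart set \<Rightarrow> ('m \<Rightarrow> 'k) \<Rightarrow> ('k, 'n) metric \<Rightarrow>
     ('m, 'n) metric" where
  "pullback_metric A B f g = (\<lambda>x v w. g (f x) (differential A B f x v) (differential A B f x w))"

definition conformal_on ::
    "('m, 'n::finite) chart set \<Rightarrow> 'm set \<Rightarrow> ('m, 'n) metric \<Rightarrow> ('m, 'n) metric \<Rightarrow> bool" where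
  "conformal_on A V g g' \<longleftrightarrow> (\<exists>\<sigma>. smooth_fun A V \<sigma> \<and> (\<forall>x\<in>V. \<sigma> x > 0 \<and>
     (\<forall>v\<in>tangent_space A x. \<forall>w\<in>tangent_space A x. g x v w = \<sigma> x * g' x v w)))"

definition isometry ::
    "('m::topological_space, 'n::finite) chart set \<Rightarrow> 'm set \<Rightarrow> ('m, 'n) metric \<Rightarrow>
     ('k::topological_space, 'n) chart set \<Rightarrow> 'k set \<Rightarrow> ('k, 'n) metric \<Rightarrow> ('m \<Rightarrow> 'k) \<Rightarrow> bool" where
  "isometry A U g B V h f \<longleftrightarrow> diffeomorphism A B U V f \<and>
     (\<forall>x\<in>U. \<forall>v\<in>tangent_space A x. \<forall>w\<in>tangent_space A x. pullback_metric A B f h x v w = g x v w)"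


section \<open>Curves, geodesics and the Sasaki metric\<close>

text \<open>\<open>V\<close> is the velocity field of the \<open>C\<^sup>1\<close> curve \<open>\<gamma>\<close> on the interval \<open>I\<close>; derivatives at end
  points of \<open>I\<close> are one-sided.\<close>

definition C1_curve ::
    "('m::topological_space, 'n::finite) chart set \<Rightarrow> real set \<Rightarrow> (real \<Rightarrow> 'm) \<Rightarrow>
     (real \<Rightarrow> ('m, 'n) tvec) \<Rightarrow> bool" where
  "C1_curve A I \<gamma> V \<longleftrightarrow> continuous_on I \<gamma> \<and>
     (\<forall>t\<in>I. V t \<in> tangent_space A (\<gamma> t) \<and>
       (\<forall>c\<in>A. \<gamma> t \<in> cdom c \<longrightarrow>
          ((\<lambda>s. cmap c (\<gamma> s)) has_vector_derivative V t c) (at t within I) \<and>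
          continuous (at t within I) (\<lambda>s. V s c)))"

text \<open>\<open>D\<close> is the covariant derivative, with respect to the Levi-Civita connection of \<open>g\<close>, of the
  vector field \<open>W\<close> along the curve \<open>\<gamma>\<close> with velocity \<open>V\<close>: in coordinates
  \<open>D = W' + \<Gamma>(V, W)\<close>.\<close>

definition covariant_derivative_along ::
    "('m::topological_space, 'n::finite) chart set \<Rightarrow> ('m, 'n) metric \<Rightarrow> real set \<Rightarrow> (real \<Rightarrow> 'm) \<Rightarrow>
     (real \<Rightarrow> ('m, 'n) tvec) \<Rightarrow> (real \<Rightarrow> ('m, 'n) tvec) \<Rightarrow> (real \<Rightarrow> ('m, 'n) tvec) \<Rightarrow> bool" where
  "covariant_derivative_along A g I \<gamma> V W D \<longleftrightarrow>
     (\<forall>t\<in>I. W t \<in> tangent_space A (\<gamma> t) \<and> D t \<in> tangent_space A (\<gamma> t) \<and>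
       (\<forall>c\<in>A. \<gamma> t \<in> cdom c \<longrightarrow>
          ((\<lambda>s. W s c) has_vector_derivative
             D t c - christoffel_form A g c (cmap c (\<gamma> t)) (V t c) (W t c)) (at t within I)))"

definition geodesic ::
    "('m::topological_space, 'n::finite) chart set \<Rightarrow> ('m, 'n) metric \<Rightarrow> real set \<Rightarrow> (real \<Rightarrow> 'm) \<Rightarrow>
     (real \<Rightarrow> ('m, 'n) tvec) \<Rightarrow> bool" where
  "geodesic A g I \<gamma> V \<longleftrightarrow>
     C1_curve A I \<gamma> V \<and> covariant_derivative_along A g I \<gamma> V V (\<lambda>_. zero_tvec)"

text \<open>A \<open>C\<^sup>1\<close> curve \<open>t \<mapsto> (\<alpha> t, W t)\<close> in the tangent bundle has the Sasaki speed
  \<open>sqrt (h(\<alpha>', \<alpha>') + h(D\<^sub>t W, D\<^sub>t W))\<close>. Allowing only \<open>C\<^sup>1\<close> curves does not change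
  the infimum of the lengths: their velocity may vanish, so a piecewise \<open>C\<^sup>1\<close> curve can be
  reparametrized to a \<open>C\<^sup>1\<close> curve of the same length.\<close>

definition sasaki_curve ::
    "('m::topological_space, 'n::finite) chart set \<Rightarrow> ('m, 'n) metric \<Rightarrow>
     'm \<times> ('m, 'n) tvec \<Rightarrow> 'm \<times> ('m, 'n) tvec \<Rightarrow> real \<Rightarrow> bool" where
  "sasaki_curve A h p q len \<longleftrightarrow> (\<exists>\<alpha> V W D.
     C1_curve A {0..1} \<alpha> V \<and> covariant_derivative_along A h {0..1} \<alpha> V W D \<and>
     (\<forall>t\<in>{0..1}. \<forall>c\<in>A. \<alpha> t \<in> cdom c \<longrightarrow> continuous (at t within {0..1}) (\<lambda>s. D s c)) \<and>
     (\<alpha> 0, W 0) = p \<and> (\<alpha> 1, W 1) = q \<and>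
     ((\<lambda>t. sqrt (h (\<alpha> t) (V t) (V t) + h (\<alpha> t) (D t) (D t))) has_integral len) {0..1})"

definition sasaki_nbhd ::
    "('m::topological_space, 'n::finite) chart set \<Rightarrow> ('m, 'n) metric \<Rightarrow>
     'm \<times> ('m, 'n) tvec \<Rightarrow> real \<Rightarrow> ('m \<times> ('m, 'n) tvec) set" where
  "sasaki_nbhd A h p r = {q. \<exists>len<r. sasaki_curve A h p q len}"


section \<open>Lorentzian manifolds and causality\<close>

record ('m, 'n) lorentz =
  atlas :: "('m, 'n) chart set"
  metric :: "('m, 'n) metric"
  timefield :: "'m \<Rightarrow> ('m, 'n) tvec"

definition lorentzian_manifold ::
    "('m::{t2_space, second_countable_topology}, 'n::finite) lorentz \<Rightarrow> bool" where
  "lorentzian_manifold M \<longleftrightarrow> smooth_atlas (atlas M) \<and> lorentzian_metric (atlas M) (metric M) \<and>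
     (\<forall>x. timefield M x \<in> tangent_space (atlas M) x \<and>
          metric M x (timefield M x) (timefield M x) < 0) \<and>
     (\<forall>c\<in>atlas M. smooth_on (\<lambda>u. timefield M (cinv c u) c) (cimg c))"

definition future_timelike :: "('m, 'n::finite) lorentz \<Rightarrow> 'm \<Rightarrow> ('m, 'n) tvec \<Rightarrow> bool" where
  "future_timelike M x v \<longleftrightarrow> v \<in> tangent_space (atlas M) x \<and>
     metric M x v v < 0 \<and> metric M x v (timefield M x) < 0"

definition future_causal :: "('m, 'n::finite) lorentz \<Rightarrow> 'm \<Rightarrow> ('m, 'n) tvec \<Rightarrow> bool" where
  "future_causal M x v \<longleftrightarrow> v \<in> tangent_space (atlas M) x \<and> v \<noteq> zero_tvec \<and>
     metric M x v v \<le> 0 \<and> metric M x v (timefield M x) < 0"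

definition lightlike :: "('m, 'n::finite) lorentz \<Rightarrow> 'm \<Rightarrow> ('m, 'n) tvec \<Rightarrow> bool" where
  "lightlike M x v \<longleftrightarrow> v \<in> tangent_space (atlas M) x \<and> v \<noteq> zero_tvec \<and> metric M x v v = 0"

definition future_lightlike :: "('m, 'n::finite) lorentz \<Rightarrow> 'm \<Rightarrow> ('m, 'n) tvec \<Rightarrow> bool" where
  "future_lightlike M x v \<longleftrightarrow> lightlike M x v \<and> metric M x v (timefield M x) < 0"

definition timelike_segment ::
    "('m::topological_space, 'n::finite) lorentz \<Rightarrow> 'm \<Rightarrow> 'm \<Rightarrow> bool" where
  "timelike_segment M x y \<longleftrightarrow> (\<exists>\<gamma> V. C1_curve (atlas M) {0..1} \<gamma> V \<and> \<gamma> 0 = x \<and> \<gamma> 1 = y \<and>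
     (\<forall>t\<in>{0..1}. future_timelike M (\<gamma> t) (V t)))"

definition causal_segment ::
    "('m::topological_space, 'n::finite) lorentz \<Rightarrow> 'm \<Rightarrow> 'm \<Rightarrow> bool" where
  "causal_segment M x y \<longleftrightarrow> (\<exists>\<gamma> V. C1_curve (atlas M) {0..1} \<gamma> V \<and> \<gamma> 0 = x \<and> \<gamma> 1 = y \<and>
     (\<forall>t\<in>{0..1}. future_causal M (\<gamma> t) (V t)))"

text \<open>Paths are piecewise \<open>C\<^sup>1\<close>, i.e. finite concatenations of \<open>C\<^sup>1\<close> segments.\<close>

definition timelike_path ::
    "('m::topological_space, 'n::finite) lorentz \<Rightarrow> 'm \<Rightarrow> 'm \<Rightarrow> bool" where
  "timelike_path M = (timelike_segment M)\<^sup>+\<^sup>+"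

definition causal_path ::
    "('m::topological_space, 'n::finite) lorentz \<Rightarrow> 'm \<Rightarrow> 'm \<Rightarrow> bool" where
  "causal_path M = (causal_segment M)\<^sup>+\<^sup>+"

definition chron_less :: "('m::topological_space, 'n::finite) lorentz \<Rightarrow> 'm \<Rightarrow> 'm \<Rightarrow> bool" where
  "chron_less M x y \<longleftrightarrow> x \<noteq> y \<and> timelike_path M x y"

definition causal_less :: "('m::topological_space, 'n::finite) lorentz \<Rightarrow> 'm \<Rightarrow> 'm \<Rightarrow> bool" where
  "causal_less M x y \<longleftrightarrow> x \<noteq> y \<and> causal_path M x y"

definition causal_le :: "('m::topological_space, 'n::finite) lorentz \<Rightarrow> 'm \<Rightarrow> 'm \<Rightarrow> bool" where
  "causal_le M x y \<longleftrightarrow> causal_less M x y \<or> x = y"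

definition I_future :: "('m::topological_space, 'n::finite) lorentz \<Rightarrow> 'm \<Rightarrow> 'm set" where
  "I_future M p = {x. chron_less M p x}"

definition I_past :: "('m::topological_space, 'n::finite) lorentz \<Rightarrow> 'm \<Rightarrow> 'm set" where
  "I_past M p = {x. chron_less M x p}"

definition J_future :: "('m::topological_space, 'n::finite) lorentz \<Rightarrow> 'm \<Rightarrow> 'm set" where
  "J_future M p = {x. causal_le M p x}"

definition J_past :: "('m::topological_space, 'n::finite) lorentz \<Rightarrow> 'm \<Rightarrow> 'm set" where
  "J_past M p = {x. causal_le M x p}"

definition globally_hyperbolic ::
    "('m::{t2_space, second_countable_topology}, 'n::finite) lorentz \<Rightarrow> bool" where
  "globally_hyperbolic M \<longleftrightarrow> lorentzian_manifold M \<and> (\<forall>x. \<not> causal_path M x x) \<and>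
     (\<forall>p q. causal_less M p q \<longrightarrow> compact (J_future M p \<inter> J_past M q))"


section \<open>Observers and light observation points\<close>

text \<open>Being the matrix absolute value of \<open>g\<close> depends on the coordinates, so \<open>g\<^sup>+\<close> is not determined
  by \<open>g\<close> alone. A Riemannian metric is associated to \<open>g\<close> here if around each point there are local
  coordinates \<open>\<kappa>\<close> in which, at that point, its matrix has the eigenvectors of the matrix of \<open>g\<close>
  with the absolute values of the eigenvalues (this determines the matrix, since a symmetric matrix
  has a basis of eigenvectors). Results are stated for every choice of such a metric.\<close>

definition associated_riemannian ::
    "('m::topological_space, 'n::finite) lorentz \<Rightarrow> ('m, 'n) metric \<Rightarrow> bool" where
  "associated_riemannian M gp \<longleftrightarrow> riemannian_metric (atlas M) gp \<and>
     (\<forall>x. \<exists>\<kappa>. x \<in> cdom \<kappa> \<and> open (cdom \<kappa>) \<and> open (cimg \<kappa>) \<and>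
        homeomorphism (cdom \<kappa>) (cimg \<kappa>) (cmap \<kappa>) (cinv \<kappa>) \<and>
        (\<forall>c\<in>atlas M. smooth_on (cmap c \<circ> cinv \<kappa>) (cmap \<kappa> ` (cdom \<kappa> \<inter> cdom c)) \<and>
                     smooth_on (cmap \<kappa> \<circ> cinv c) (cmap c ` (cdom \<kappa> \<inter> cdom c))) \<and>
        (\<forall>v l. metric_matrix (atlas M) (metric M) \<kappa> (cmap \<kappa> x) *v v = l *\<^sub>R v \<longrightarrow>
               metric_matrix (atlas M) gp \<kappa> (cmap \<kappa> x) *v v = \<bar>l\<bar> *\<^sub>R v))"

text \<open>Parameter values \<open>s\<^sub>-\<^sub>2 < s\<^sub>-\<^sub>1 < s\<^sub>+\<^sub>1 < \<dots> < s\<^sub>+\<^sub>4\<close>; the value \<open>s 0\<close> is not used.\<close>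

definition observer_times :: "(int \<Rightarrow> real) \<Rightarrow> bool" where
  "observer_times s \<longleftrightarrow> - 1 < s (- 2) \<and> s (- 2) < s (- 1) \<and> s (- 1) < s 1 \<and> s 1 < s 2 \<and>
     s 2 < s 3 \<and> s 3 < s 4 \<and> s 4 < 1"

definition timelike_geodesic ::
    "('m::topological_space, 'n::finite) lorentz \<Rightarrow> (real \<Rightarrow> 'm) \<Rightarrow> (real \<Rightarrow> ('m, 'n) tvec) \<Rightarrow> bool" where
  "timelike_geodesic M \<mu> V \<longleftrightarrow> geodesic (atlas M) (metric M) {- 1..1} \<mu> V \<and>
     (\<forall>t\<in>{- 1..1}. metric M (\<mu> t) (V t) (V t) < 0)"

definition future_timelike_geodesic ::
    "('m::topological_space, 'n::finite) lorentz \<Rightarrow> (real \<Rightarrow> 'm) \<Rightarrow> (real \<Rightarrow> ('m, 'n) tvec) \<Rightarrow> bool" where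
  "future_timelike_geodesic M \<mu> V \<longleftrightarrow> geodesic (atlas M) (metric M) {- 1..1} \<mu> V \<and>
     (\<forall>t\<in>{- 1..1}. future_timelike M (\<mu> t) (V t))"

definition observer ::
    "('m::topological_space, 'n::finite) lorentz \<Rightarrow> (int \<Rightarrow> real) \<Rightarrow> 'm \<Rightarrow> ('m, 'n) tvec \<Rightarrow>
     (real \<Rightarrow> 'm) \<Rightarrow> (real \<Rightarrow> ('m, 'n) tvec) \<Rightarrow> bool" where
  "observer M s z \<eta> \<gamma> V \<longleftrightarrow> geodesic (atlas M) (metric M) {- 1..1} \<gamma> V \<and>
     \<gamma> (s (- 2)) = z \<and> V (s (- 2)) = \<eta>"

text \<open>The conditions on the radius \<open>h\<close>. Geodesics are determined by their initial data, so the
  universal quantifier below concerns the one geodesic whose existence is required before it.\<close>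

definition admissible_radius ::
    "('m::topological_space, 'n::finite) lorentz \<Rightarrow> ('m, 'n) metric \<Rightarrow> (int \<Rightarrow> real) \<Rightarrow>
     (real \<Rightarrow> 'm) \<Rightarrow> (real \<Rightarrow> ('m, 'n) tvec) \<Rightarrow> real \<Rightarrow> bool" where
  "admissible_radius M gp s \<mu> V\<mu> h \<longleftrightarrow> 0 < h \<and>
     (\<forall>(z, \<eta>) \<in> sasaki_nbhd (atlas M) gp (\<mu> (s (- 2)), V\<mu> (s (- 2))) (2 * h).
        (\<exists>\<gamma> V. observer M s z \<eta> \<gamma> V) \<and>
        (\<forall>\<gamma> V. observer M s z \<eta> \<gamma> V \<longrightarrow> timelike_geodesic M \<gamma> V \<and>
           \<gamma> (s (- 2)) \<in> I_past M (\<mu> (s (- 1))) \<and>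
           \<gamma> (s 2) \<in> I_future M (\<mu> (s 1)) \<and>
           \<gamma> (s 4) \<in> I_future M (\<mu> (s 3))))"

definition observation_region ::
    "('m::topological_space, 'n::finite) lorentz \<Rightarrow> ('m, 'n) metric \<Rightarrow> (int \<Rightarrow> real) \<Rightarrow>
     (real \<Rightarrow> 'm) \<Rightarrow> (real \<Rightarrow> ('m, 'n) tvec) \<Rightarrow> real \<Rightarrow> 'm set" where
  "observation_region M gp s \<mu> V\<mu> h =
     {x. \<exists>(z, \<eta>) \<in> sasaki_nbhd (atlas M) gp (\<mu> (s (- 2)), V\<mu> (s (- 2))) h.
           \<exists>\<gamma> V. observer M s z \<eta> \<gamma> V \<and> x \<in> \<gamma> ` {- 1<..<1}}"

definition light_observation_points ::
    "('m::topological_space, 'n::finite) lorentz \<Rightarrow> 'm set \<Rightarrow> 'm \<Rightarrow> 'm set" where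
  "light_observation_points M U q = {y \<in> U. \<exists>r\<ge>0. \<exists>\<gamma> V.
     geodesic (atlas M) (metric M) {0..r} \<gamma> V \<and> \<gamma> 0 = q \<and> future_lightlike M q (V 0) \<and> \<gamma> r = y}"

end

theory Submission
  imports Defs
begin

text \<open>Write \<open>\<Psi>\<^sup>*g2 = \<sigma> g1\<close> on \<open>V1\<close>; then \<open>\<sigma> = 1\<close> on \<open>U1 \<inter> V1\<close>. For a null vector \<open>v\<close> and \<open>\<sigma> = e\<^sup>2\<^sup>\<omega>\<close> the
  conformal transformation of the Ricci tensor reads
  \<open>Ric(\<sigma> g)(v, v) = Ric(g)(v, v) - (n - 2) (Hess \<omega>(v, v) - d\<omega>(v)\<^sup>2)\<close>. Hence along a null geodesic on
  which both Ricci tensors vanish \<open>\<sigma>\<close> to the power \<open>- 1/2\<close> has vanishing second derivative, and since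
  it equals \<open>1\<close> near the end in \<open>U1\<close>, it is \<open>1\<close> along the whole geodesic.

  That \<open>\<Psi>\<close> maps \<open>V1 \<inter> W1\<close> into \<open>W2\<close> is where the light observation sets enter. A point of
  \<open>\<Psi>(V1 \<inter> W1)\<close> outside \<open>W2\<close> is \<open>\<Phi> z\<close> for some \<open>z \<in> U1 - W1\<close>, and causality forces \<open>z \<in> V1\<close>, where
  \<open>\<Phi>\<close> and \<open>\<Psi>\<close> agree. The causality argument needs that the isometry \<open>\<Phi>\<close> preserves the time
  orientation, which follows from the connectedness of \<open>U1\<close>.\<close>

section \<open>Higher derivatives and curvature of connections\<close>

text \<open>For a general vector \<open>v\<close> the conformal formula for the Ricci tensor also
  contains the Laplacian of \<omega> and the square of its gradient, both multiplied by
  \<open>g(v, v)\<close>. Null directions remove them, and what remains along a light ray is the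
  ordinary equation \<omega>'' = (\<omega>')^2, which exp(-\<omega>) linearizes. The factor n - 2 is
  where the dimension bound enters. The computational obstacle is that curvature is given by index
  formulas in charts, while the charts of the two manifolds are unrelated. The Ricci tensor is
  therefore rewritten as the trace of the curvature of a vector valued bilinear form; its behaviour
  under diffeomorphisms and under conformal change then follows from transformation laws for that
  form. On the causal side the time orientation is known to be preserved only along the observer. It
  spreads over \<open>U1\<close> because a Sasaki ball contains all initial pieces of the curves
  that define it, which makes \<open>U1\<close> connected.\<close>

abbreviation fd :: "('a::real_normed_vector \<Rightarrow> 'b::real_normed_vector) \<Rightarrow> 'a \<Rightarrow> 'a \<Rightarrow> 'b" where
  "fd f x \<equiv> frechet_derivative f (at x)"

lemma smooth_on_continuous: "smooth_on f S \<Longrightarrow> continuous_on S f"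
  by (metis smooth_on_def Ck_on.simps(1))

lemma smooth_on_differentiable: "smooth_on f S \<Longrightarrow> x \<in> S \<Longrightarrow> f differentiable (at x)"
  by (metis smooth_on_def Ck_on.simps(2))

lemma smooth_on_has_derivative:
  "smooth_on f S \<Longrightarrow> x \<in> S \<Longrightarrow> (f has_derivative fd f x) (at x)"
  using smooth_on_differentiable frechet_derivative_works by blast

lemma smooth_on_fd: "smooth_on f S \<Longrightarrow> smooth_on (\<lambda>x. fd f x v) S"
  unfolding smooth_on_def by (metis Ck_on.simps(2))

lemma smooth_on_subset: "smooth_on f S \<Longrightarrow> T \<subseteq> S \<Longrightarrow> smooth_on f T"
proof -
  have "Ck_on k f S \<Longrightarrow> T \<subseteq> S \<Longrightarrow> Ck_on k f T" for k
    by (induction k arbitrary: f) (auto intro: continuous_on_subset)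
  then show "smooth_on f S \<Longrightarrow> T \<subseteq> S \<Longrightarrow> smooth_on f T" unfolding smooth_on_def by blast
qed

lemma fd_eq: "(f has_derivative f') (at x) \<Longrightarrow> fd f x = f'"
  using frechet_derivative_at by metis

lemma fd_cong_open:
  assumes "open S" "x \<in> S" "\<And>p. p \<in> S \<Longrightarrow> f p = g p"
  shows "fd f x = fd g x"
proof -
  have "(f has_derivative h) (at x) \<longleftrightarrow> (g has_derivative h) (at x)" for h
    using assms by (metis has_derivative_transform_within_open)
  then show ?thesis by (simp add: frechet_derivative_def)
qed

text \<open>The mean value theorem is applied twice: to the difference of \<open>f\<close> along two
  opposite edges of the parallelogram, then to the directional derivative \<open>f1 p a\<close>
  across it. Only derivatives of directional derivatives occur, which is the kind of second
  derivative that \<open>Ck_on\<close> supplies.\<close>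

lemma mixed_difference:
  fixes f :: "'a::real_normed_vector \<Rightarrow> real"
  assumes h: "h > 0" and S: "\<And>s t. 0 \<le> s \<Longrightarrow> s \<le> h \<Longrightarrow> 0 \<le> t \<Longrightarrow> t \<le> h \<Longrightarrow> u + s *\<^sub>R a + t *\<^sub>R b \<in> S"
    and f1: "\<And>p. p \<in> S \<Longrightarrow> (f has_derivative f1 p) (at p)"
    and f2: "\<And>p. p \<in> S \<Longrightarrow> ((\<lambda>p. f1 p a) has_derivative f2 p) (at p)"
  shows "\<exists>s t. 0 < s \<and> s < h \<and> 0 < t \<and> t < h \<and>
    f (u + h *\<^sub>R a + h *\<^sub>R b) - f (u + h *\<^sub>R a) - f (u + h *\<^sub>R b) + f u = h * h * f2 (u + s *\<^sub>R a + t *\<^sub>R b) b"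
proof -
  have lin1: "f1 p (k *\<^sub>R c) = k * f1 p c" if "p \<in> S" for p k c
    using f1[OF that] by (metis has_derivative_linear linear_scale real_scaleR_def)
  have lin2: "f2 p (k *\<^sub>R c) = k * f2 p c" if "p \<in> S" for p k c
    using f2[OF that] by (metis has_derivative_linear linear_scale real_scaleR_def)
  have d1: "((\<lambda>s. f (u + s *\<^sub>R a + t *\<^sub>R b)) has_real_derivative f1 (u + s *\<^sub>R a + t *\<^sub>R b) a) (at s)"
    if "0 \<le> s" "s \<le> h" "0 \<le> t" "t \<le> h" for s t
  proof -
    have "((\<lambda>s. u + s *\<^sub>R a + t *\<^sub>R b) has_derivative (\<lambda>k. k *\<^sub>R a)) (at s)"
      by (auto intro!: derivative_eq_intros)
    from has_derivative_compose[OF this f1[OF S]] that show ?thesis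
      by (simp add: has_field_derivative_def lin1 S mult_commute_abs)
  qed
  have d2: "((\<lambda>t. f1 (u + s *\<^sub>R a + t *\<^sub>R b) a) has_real_derivative f2 (u + s *\<^sub>R a + t *\<^sub>R b) b) (at t)"
    if "0 \<le> s" "s \<le> h" "0 \<le> t" "t \<le> h" for s t
  proof -
    have "((\<lambda>t. u + s *\<^sub>R a + t *\<^sub>R b) has_derivative (\<lambda>k. k *\<^sub>R b)) (at t)"
      by (auto intro!: derivative_eq_intros)
    from has_derivative_compose[OF this f2[OF S]] that show ?thesis
      by (simp add: has_field_derivative_def lin2 S mult_commute_abs)
  qed
  have "\<exists>s>0. s < h \<and> (f (u + h *\<^sub>R a + h *\<^sub>R b) - f (u + h *\<^sub>R a + 0 *\<^sub>R b)) - (f (u + 0 *\<^sub>R a + h *\<^sub>R b) - f (u + 0 *\<^sub>R a + 0 *\<^sub>R b))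
     = (h - 0) * (f1 (u + s *\<^sub>R a + h *\<^sub>R b) a - f1 (u + s *\<^sub>R a + 0 *\<^sub>R b) a)"
    by (rule MVT2[OF h]) (use h in \<open>auto intro!: DERIV_diff d1 simp del: scaleR_zero_left\<close>)
  then obtain s where s: "0 < s" "s < h"
    and es: "f (u + h *\<^sub>R a + h *\<^sub>R b) - f (u + h *\<^sub>R a) - f (u + h *\<^sub>R b) + f u =
       h * (f1 (u + s *\<^sub>R a + h *\<^sub>R b) a - f1 (u + s *\<^sub>R a + 0 *\<^sub>R b) a)" by auto
  have "\<exists>t>0. t < h \<and> f1 (u + s *\<^sub>R a + h *\<^sub>R b) a - f1 (u + s *\<^sub>R a + 0 *\<^sub>R b) a
     = (h - 0) * f2 (u + s *\<^sub>R a + t *\<^sub>R b) b"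
    by (rule MVT2[OF h]) (use s in \<open>auto intro!: d2\<close>)
  with s es show ?thesis by (metis diff_zero mult.assoc)
qed

text \<open>Schwarz's theorem: the second difference over one small parallelogram is
  \<open>h * h\<close> times either mixed derivative, each at some interior point, so continuity
  leaves no room for a gap between the two values at \<open>u\<close>.\<close>

lemma mixed_partials_commute_real:
  fixes f :: "'a::real_normed_vector \<Rightarrow> real"
  assumes S: "open S" "u \<in> S"
    and f1: "\<And>p. p \<in> S \<Longrightarrow> (f has_derivative f1 p) (at p)"
    and fa: "\<And>p. p \<in> S \<Longrightarrow> ((\<lambda>p. f1 p a) has_derivative fa p) (at p)"
    and fb: "\<And>p. p \<in> S \<Longrightarrow> ((\<lambda>p. f1 p b) has_derivative fb p) (at p)"
    and ca: "continuous_on S (\<lambda>p. fa p b)" and cb: "continuous_on S (\<lambda>p. fb p a)"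
  shows "fa u b = fb u a"
proof (rule ccontr)
  assume ne: "fa u b \<noteq> fb u a"
  \<comment> \<open>Half the gap: two numbers that are closer than \<open>e\<close> to
    \<open>fa u b\<close> and to \<open>fb u a\<close> respectively cannot coincide.\<close>
  define e where "e = \<bar>fa u b - fb u a\<bar> / 2"
  have e: "e > 0" using ne by (simp add: e_def)
  have "\<forall>\<^sub>F p in nhds u. p \<in> S \<and> dist (fa p b) (fa u b) < e \<and> dist (fb p a) (fb u a) < e"
  proof (intro eventually_conj)
    have "((\<lambda>p. fa p b) \<longlongrightarrow> fa u b) (nhds u)" "((\<lambda>p. fb p a) \<longlongrightarrow> fb u a) (nhds u)"
      using S ca cb unfolding continuous_on_eq_continuous_at[OF S(1)] isCont_def
        tendsto_at_iff_tendsto_nhds[of "\<lambda>p. fa p b" u, symmetric]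
        tendsto_at_iff_tendsto_nhds[of "\<lambda>p. fb p a" u, symmetric] by auto
    then show "\<forall>\<^sub>F p in nhds u. dist (fa p b) (fa u b) < e" "\<forall>\<^sub>F p in nhds u. dist (fb p a) (fb u a) < e"
      using e by (auto intro: tendstoD)
  qed (use S in \<open>auto simp: eventually_nhds_in_open\<close>)
  then obtain r where r: "r > 0"
    and near: "\<And>p. dist p u < r \<Longrightarrow> p \<in> S \<and> dist (fa p b) (fa u b) < e \<and> dist (fb p a) (fb u a) < e"
    by (auto simp: eventually_nhds_metric)
  \<comment> \<open>With this size both parallelograms lie in the ball of radius \<open>r\<close>;
    the \<open>+ 1\<close> keeps the denominator positive even if both directions vanish.\<close>
  define h where "h = r / (norm a + norm b + 1)"
  have h: "h > 0" using r by (simp add: h_def add_nonneg_pos)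
  have small: "dist (u + s *\<^sub>R a + t *\<^sub>R b) u < r" if "0 \<le> s" "s \<le> h" "0 \<le> t" "t \<le> h" for s t
  proof -
    have "norm (s *\<^sub>R a + t *\<^sub>R b) \<le> s * norm a + t * norm b"
      using that by (metis abs_of_nonneg norm_scaleR norm_triangle_ineq)
    also have "\<dots> \<le> h * norm a + h * norm b"
      using that by (intro add_mono mult_right_mono) auto
    also have "\<dots> < h * (norm a + norm b + 1)" using h by (simp add: algebra_simps)
    also have "\<dots> = r" by (simp add: h_def add_nonneg_eq_0_iff)
    finally show ?thesis by (simp add: dist_norm add.assoc)
  qed
  let ?F = "f (u + h *\<^sub>R a + h *\<^sub>R b) - f (u + h *\<^sub>R a) - f (u + h *\<^sub>R b) + f u"
  obtain s t where 1: "0 < s" "s < h" "0 < t" "t < h" "?F = h * h * fa (u + s *\<^sub>R a + t *\<^sub>R b) b"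
    using mixed_difference[OF h, of u a b S f f1 fa] small near f1 fa by blast
  have small': "dist (u + s *\<^sub>R b + t *\<^sub>R a) u < r" if "0 \<le> s" "s \<le> h" "0 \<le> t" "t \<le> h" for s t
    using small[of t s] that by (simp add: algebra_simps)
  obtain s' t' where 2: "0 < s'" "s' < h" "0 < t'" "t' < h"
    "f (u + h *\<^sub>R b + h *\<^sub>R a) - f (u + h *\<^sub>R b) - f (u + h *\<^sub>R a) + f u = h * h * fb (u + s' *\<^sub>R b + t' *\<^sub>R a) a"
    using mixed_difference[OF h, of u b a S f f1 fb] small' near f1 fb by blast
  have "f (u + h *\<^sub>R b + h *\<^sub>R a) - f (u + h *\<^sub>R b) - f (u + h *\<^sub>R a) + f u = ?F"
    by (simp add: algebra_simps)
  then have "fa (u + s *\<^sub>R a + t *\<^sub>R b) b = fb (u + s' *\<^sub>R b + t' *\<^sub>R a) a"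
    using 1 2 h by simp
  moreover have "dist (fa (u + s *\<^sub>R a + t *\<^sub>R b) b) (fa u b) < e" using near small 1 by simp
  moreover have "dist (fb (u + s' *\<^sub>R b + t' *\<^sub>R a) a) (fb u a) < e" using near small' 2 by simp
  moreover have "\<bar>fa u b - fb u a\<bar> = 2 * e" by (simp add: e_def)
  ultimately show False unfolding dist_real_def by linarith
qed

text \<open>The mean value theorem is real valued, so the symmetry is obtained for the inner product
  with each basis vector.\<close>

lemma smooth_mixed_derivatives_commute:
  fixes f :: "'a::real_normed_vector \<Rightarrow> 'b::euclidean_space"
  assumes S: "open S" "u \<in> S" and f: "smooth_on f S"
  shows "fd (\<lambda>p. fd f p a) u b = fd (\<lambda>p. fd f p b) u a"
proof (rule euclidean_eqI)
  fix k :: 'b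
  note sm = smooth_on_fd[OF f]
  have d: "((\<lambda>p. g p \<bullet> k) has_derivative (\<lambda>v. fd g p v \<bullet> k)) (at p)"
    if "smooth_on g S" "p \<in> S" for p and g :: "'a \<Rightarrow> 'b"
    using smooth_on_has_derivative[OF that] by (rule has_derivative_inner_left)
  show "fd (\<lambda>p. fd f p a) u b \<bullet> k = fd (\<lambda>p. fd f p b) u a \<bullet> k"
    by (rule mixed_partials_commute_real[where f = "\<lambda>p. f p \<bullet> k" and ?f1.0 = "\<lambda>p v. fd f p v \<bullet> k", OF S])
      (auto intro!: d f sm continuous_intros smooth_on_continuous[OF smooth_on_fd[OF sm]])
qed

section \<open>Linear maps depending on a parameter, and the curvature of a connection form\<close>

lemma linear_euclidean_sum:
  fixes F :: "'e::euclidean_space \<Rightarrow> 'b::real_normed_vector"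
  assumes "linear F" shows "F w = (\<Sum>i\<in>Basis. (w \<bullet> i) *\<^sub>R F i)"
proof -
  have "F w = F (\<Sum>i\<in>Basis. (w \<bullet> i) *\<^sub>R i)" by (simp add: euclidean_representation)
  also have "\<dots> = (\<Sum>i\<in>Basis. (w \<bullet> i) *\<^sub>R F i)"
    using assms by (simp add: linear_sum linear_scale)
  finally show ?thesis .
qed

text \<open>Product rule for a moving linear map applied to a moving vector. The map is
  differentiable only for each fixed argument, so the vector is expanded in the basis instead of
  treating \<open>F\<close> as operator valued. This makes expressions such as
  \<open>fd f p (w p)\<close> differentiable.\<close>

lemma has_derivative_linear_field:
  fixes F :: "'p::real_normed_vector \<Rightarrow> 'e::euclidean_space \<Rightarrow> 'b::real_normed_vector"
  assumes S: "open S" "u \<in> S" and lin: "\<And>p. p \<in> S \<Longrightarrow> linear (F p)"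
    and F': "\<And>c. ((\<lambda>p. F p c) has_derivative F' c) (at u)" and w: "(w has_derivative w') (at u)"
  shows "((\<lambda>p. F p (w p)) has_derivative (\<lambda>a. F' (w u) a + F u (w' a))) (at u)"
proof -
  have "((\<lambda>p. \<Sum>i\<in>Basis. (c \<bullet> i) *\<^sub>R F p i) has_derivative (\<lambda>a. \<Sum>i\<in>Basis. (c \<bullet> i) *\<^sub>R F' i a)) (at u)" for c
    by (auto intro!: derivative_eq_intros F' simp: fun_eq_iff)
  then have "((\<lambda>p. F p c) has_derivative (\<lambda>a. \<Sum>i\<in>Basis. (c \<bullet> i) *\<^sub>R F' i a)) (at u)" for c
    by (rule has_derivative_transform_within_open[OF _ S]) (simp add: linear_euclidean_sum[OF lin, symmetric])
  then have F'c: "F' c = (\<lambda>a. \<Sum>i\<in>Basis. (c \<bullet> i) *\<^sub>R F' i a)" for c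
    using F' has_derivative_unique by blast
  have "((\<lambda>p. \<Sum>i\<in>Basis. (w p \<bullet> i) *\<^sub>R F p i) has_derivative
      (\<lambda>a. \<Sum>i\<in>Basis. (w u \<bullet> i) *\<^sub>R F' i a + (w' a \<bullet> i) *\<^sub>R F u i)) (at u)"
    by (intro has_derivative_sum has_derivative_scaleR F' has_derivative_inner_left w)
  moreover have "(\<lambda>a. \<Sum>i\<in>Basis. (w u \<bullet> i) *\<^sub>R F' i a + (w' a \<bullet> i) *\<^sub>R F u i) = (\<lambda>a. F' (w u) a + F u (w' a))"
    by (simp add: F'c[of "w u"] sum.distrib linear_euclidean_sum[OF lin[OF S(2)], symmetric])
  ultimately have "((\<lambda>p. \<Sum>i\<in>Basis. (w p \<bullet> i) *\<^sub>R F p i) has_derivative (\<lambda>a. F' (w u) a + F u (w' a))) (at u)"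
    by simp
  then show ?thesis
    by (rule has_derivative_transform_within_open[OF _ S]) (simp add: linear_euclidean_sum[OF lin, symmetric])
qed

lemma tendsto_linear_field:
  fixes F :: "'p \<Rightarrow> 'e::euclidean_space \<Rightarrow> 'b::real_normed_vector"
  assumes ev: "\<forall>\<^sub>F p in net. linear (F p)" and l: "linear L"
    and F': "\<And>c. ((\<lambda>p. F p c) \<longlongrightarrow> L c) net" and w: "(w \<longlongrightarrow> z) net"
  shows "((\<lambda>p. F p (w p)) \<longlongrightarrow> L z) net"
proof -
  have "((\<lambda>p. \<Sum>i\<in>Basis. (w p \<bullet> i) *\<^sub>R F p i) \<longlongrightarrow> (\<Sum>i\<in>Basis. (z \<bullet> i) *\<^sub>R L i)) net"
    by (intro tendsto_intros F' w)
  moreover have "\<forall>\<^sub>F p in net. (\<Sum>i\<in>Basis. (w p \<bullet> i) *\<^sub>R F p i) = F p (w p)"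
    using ev by eventually_elim (simp add: linear_euclidean_sum[symmetric])
  ultimately have "((\<lambda>p. F p (w p)) \<longlongrightarrow> (\<Sum>i\<in>Basis. (z \<bullet> i) *\<^sub>R L i)) net"
    by (rule Lim_transform_eventually)
  then show ?thesis by (simp add: linear_euclidean_sum[OF l, of z])
qed

text \<open>Riemann curvature \<open>R(a, b)c\<close> of the connection with coordinate form
  \<Gamma>, for constant coordinate fields. Indices are avoided until the comparison with
  \<open>ricci\<close>.\<close>

definition curv :: "('e::real_normed_vector \<Rightarrow> 'e \<Rightarrow> 'e \<Rightarrow> 'e) \<Rightarrow> 'e \<Rightarrow> 'e \<Rightarrow> 'e \<Rightarrow> 'e \<Rightarrow> 'e" where
  "curv \<Gamma> u a b c = fd (\<lambda>p. \<Gamma> p b c) u a - fd (\<lambda>p. \<Gamma> p a c) u b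
     + \<Gamma> u a (\<Gamma> u b c) - \<Gamma> u b (\<Gamma> u a c)"

text \<open>The hypothesis \<open>eq\<close> is the transformation law of a connection.
  Differentiating it once more and skew-symmetrizing in \<open>a\<close> and \<open>b\<close>
  cancels every second and third derivative of \<open>f\<close>, because these are symmetric; what
  is left says that curvature is a tensor.\<close>

lemma curv_transform:
  fixes \<Gamma> \<Gamma>' :: "'e::euclidean_space \<Rightarrow> 'e \<Rightarrow> 'e \<Rightarrow> 'e"
  assumes S: "open S" "u \<in> S" and f: "smooth_on f S"
    and lin: "\<And>p. p \<in> S \<Longrightarrow> bilinear (\<Gamma> p)" "\<And>p. p \<in> S \<Longrightarrow> bilinear (\<Gamma>' (f p))"
    and dG: "\<And>b c. (\<lambda>p. \<Gamma> p b c) differentiable (at u)"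
    and dG': "\<And>b c. (\<lambda>q. \<Gamma>' q b c) differentiable (at (f u))"
    and eq: "\<And>p b c. p \<in> S \<Longrightarrow>
      fd f p (\<Gamma> p b c) = \<Gamma>' (f p) (fd f p b) (fd f p c) + fd (\<lambda>q. fd f q c) p b"
  shows "fd f u (curv \<Gamma> u a b c) = curv \<Gamma>' (f u) (fd f u a) (fd f u b) (fd f u c)"
proof -
  let ?L = "fd f u" and ?D2 = "\<lambda>a w. fd (\<lambda>q. fd f q w) u a"
  let ?D3 = "\<lambda>a b c. fd (\<lambda>p. fd (\<lambda>q. fd f q c) p b) u a"
  note sm = smooth_on_fd[OF f]
  have linL: "linear (fd f p)" if "p \<in> S" for p
    using smooth_on_has_derivative[OF f that] has_derivative_linear by blast
  have G'l: "linear (\<Gamma>' (f p) x)" "linear (\<lambda>x. \<Gamma>' (f p) x y)" if "p \<in> S" for p x y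
    using lin(2)[OF that] by (auto simp: bilinear_def)
  have L: "((\<lambda>q. fd f q w) has_derivative (\<lambda>a. ?D2 a w)) (at u)" for w
    using smooth_on_has_derivative[OF sm S(2)] .
  \<comment> \<open>Both sides of \<open>eq\<close> are differentiated at \<open>u\<close> in
    direction \<open>a\<close>.\<close>
  have key: "?D2 a (\<Gamma> u b c) + ?L (fd (\<lambda>p. \<Gamma> p b c) u a) =
     fd (\<lambda>q. \<Gamma>' q (?L b) (?L c)) (f u) (?L a) + \<Gamma>' (f u) (?L b) (?D2 a c) + \<Gamma>' (f u) (?D2 a b) (?L c)
       + ?D3 a b c" for a b c
  proof -
    have 1: "((\<lambda>p. fd f p (\<Gamma> p b c)) has_derivative
       (\<lambda>a. ?D2 a (\<Gamma> u b c) + ?L (fd (\<lambda>p. \<Gamma> p b c) u a))) (at u)"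
      by (rule has_derivative_linear_field[OF S linL L]) (use dG frechet_derivative_works in blast)+
    have G1: "((\<lambda>p. \<Gamma>' (f p) x y) has_derivative (\<lambda>a. fd (\<lambda>q. \<Gamma>' q x y) (f u) (?L a))) (at u)" for x y
      using has_derivative_compose[OF smooth_on_has_derivative[OF f S(2)], of "\<lambda>q. \<Gamma>' q x y"]
        dG' frechet_derivative_works by blast
    have G2: "((\<lambda>p. \<Gamma>' (f p) x (fd f p c)) has_derivative
       (\<lambda>a. fd (\<lambda>q. \<Gamma>' q x (?L c)) (f u) (?L a) + \<Gamma>' (f u) x (?D2 a c))) (at u)" for x
      by (rule has_derivative_linear_field[OF S G'l(1) G1 L])
    have G3: "((\<lambda>p. \<Gamma>' (f p) (fd f p b) (fd f p c)) has_derivative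
       (\<lambda>a. (fd (\<lambda>q. \<Gamma>' q (?L b) (?L c)) (f u) (?L a) + \<Gamma>' (f u) (?L b) (?D2 a c)) + \<Gamma>' (f u) (?D2 a b) (?L c))) (at u)"
      by (rule has_derivative_linear_field[where F = "\<lambda>p x. \<Gamma>' (f p) x (fd f p c)", OF S _ G2 L]) (rule G'l)
    have 2: "((\<lambda>p. \<Gamma>' (f p) (fd f p b) (fd f p c) + fd (\<lambda>q. fd f q c) p b) has_derivative
       (\<lambda>a. (fd (\<lambda>q. \<Gamma>' q (?L b) (?L c)) (f u) (?L a) + \<Gamma>' (f u) (?L b) (?D2 a c)) + \<Gamma>' (f u) (?D2 a b) (?L c) + ?D3 a b c)) (at u)"
      by (rule has_derivative_add[OF G3 smooth_on_has_derivative[OF smooth_on_fd[OF sm] S(2)]])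
    then have "((\<lambda>p. fd f p (\<Gamma> p b c)) has_derivative
       (\<lambda>a. (fd (\<lambda>q. \<Gamma>' q (?L b) (?L c)) (f u) (?L a) + \<Gamma>' (f u) (?L b) (?D2 a c)) + \<Gamma>' (f u) (?D2 a b) (?L c) + ?D3 a b c)) (at u)"
      by (rule has_derivative_transform_within_open[OF _ S]) (simp add: eq)
    from has_derivative_unique[OF 1 this] show ?thesis by meson
  qed
  have D2: "?D2 a w = ?L (\<Gamma> u a w) - \<Gamma>' (f u) (?L a) (?L w)" for a w
    using eq[OF S(2), of a w] by simp
  have sym2: "?D2 a b = ?D2 b a" by (rule smooth_mixed_derivatives_commute[OF S f])
  have sym3: "?D3 a b c = ?D3 b a c" by (rule smooth_mixed_derivatives_commute[OF S sm])
  have Gd: "\<Gamma>' (f u) x (y - z) = \<Gamma>' (f u) x y - \<Gamma>' (f u) x z" for x y z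
    using G'l(1)[OF S(2)] by (simp add: linear_diff)
  \<comment> \<open>After elimination of \<open>?D2 a (\<Gamma> u b c)\<close> one half of the
    curvature stands on each side. The other terms on the right are, taken together, unchanged when
    \<open>a\<close> and \<open>b\<close> are exchanged.\<close>
  have k: "?L (fd (\<lambda>p. \<Gamma> p b c) u a) + ?L (\<Gamma> u a (\<Gamma> u b c)) =
     fd (\<lambda>q. \<Gamma>' q (?L b) (?L c)) (f u) (?L a) + \<Gamma>' (f u) (?L a) (\<Gamma>' (f u) (?L b) (?L c))
     + \<Gamma>' (f u) (?L a) (?D2 b c) + \<Gamma>' (f u) (?L b) (?D2 a c) + \<Gamma>' (f u) (?D2 a b) (?L c) + ?D3 a b c" for a b c
    using key[where a=a and b=b and c=c] D2[where a=a and w="\<Gamma> u b c"]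
    by (simp add: D2[where a=b and w=c] Gd algebra_simps)
  show ?thesis
    unfolding curv_def using k[where a=a and b=b and c=c] k[where a=b and b=a and c=c] sym2 sym3
    by (simp add: linear_diff[OF linL[OF S(2)]] linear_add[OF linL[OF S(2)]] algebra_simps)
qed

section \<open>Traces and the Ricci form\<close>

definition tr :: "(real^'n \<Rightarrow> real^'n::finite) \<Rightarrow> real" where
  "tr F = (\<Sum>i\<in>UNIV. F (axis i 1) $ i)"

lemma tr_add: "tr (\<lambda>a. F a + H a) = tr F + tr H"
  by (simp add: tr_def sum.distrib)

lemma tr_diff: "tr (\<lambda>a. F a - H a) = tr F - tr H"
  by (simp add: tr_def sum_subtractf)

lemma tr_scaleR: "tr (\<lambda>a. k *\<^sub>R F a) = k * tr F"
  by (simp add: tr_def sum_distrib_left)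

lemma tr_id: "tr (\<lambda>a::real^'n. a) = real CARD('n::finite)"
  by (simp add: tr_def)

lemma linear_sum_axis:
  fixes k :: "real^'n::finite \<Rightarrow> 'b::real_vector"
  assumes "linear k" shows "k q = (\<Sum>i\<in>UNIV. (q $ i) *\<^sub>R k (axis i 1))"
proof -
  have "q = (\<Sum>i\<in>UNIV. (q $ i) *\<^sub>R axis i 1)"
    using basis_expansion[of q] by (simp add: scalar_mult_eq_scaleR)
  then have "k q = k (\<Sum>i\<in>UNIV. (q $ i) *\<^sub>R axis i 1)" by simp
  then show ?thesis using assms by (simp add: linear_sum linear_scale)
qed

lemma tr_rank1:
  assumes "linear k" shows "tr (\<lambda>a. k a *\<^sub>R q) = k q"
  using linear_sum_axis[OF assms, of q] by (simp add: tr_def mult.commute)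

lemma tr_eq_trace: "tr F = trace (matrix F)"
  by (simp add: tr_def trace_def matrix_def)

lemma tr_conjugate:
  fixes F F' L :: "real^'n \<Rightarrow> real^'n::finite"
  assumes lin: "linear L" "linear F" "linear F'" and inj: "inj L"
    and eq: "\<And>a. L (F a) = F' (L a)"
  shows "tr F = tr F'"
proof -
  obtain K where K: "linear K" "\<And>x. K (L x) = x" "\<And>x. L (K x) = x"
    using linear_injective_isomorphism[OF lin(1) inj] by auto
  have "F = K \<circ> (F' \<circ> L)" by (auto simp: eq[symmetric] K)
  then have "matrix F = matrix K ** (matrix F' ** matrix L)"
    using lin K by (metis matrix_compose linear_compose)
  then have "trace (matrix F) = trace ((matrix F' ** matrix L) ** matrix K)"
    by (simp add: trace_mul_sym[of "matrix K"])
  also have "(matrix F' ** matrix L) ** matrix K = matrix (F' \<circ> (L \<circ> K))"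
    using lin K by (simp add: matrix_compose linear_compose matrix_mul_assoc)
  also have "F' \<circ> (L \<circ> K) = F'" using K by auto
  finally show ?thesis by (simp add: tr_eq_trace)
qed

text \<open>The Ricci tensor as a quadratic form: light rays only need its values on the diagonal.
  \<open>ricci_contract\<close> identifies it with the coordinate expression.\<close>

definition ric :: "(real^'n \<Rightarrow> real^'n \<Rightarrow> real^'n \<Rightarrow> real^'n::finite) \<Rightarrow> real^'n \<Rightarrow> real^'n \<Rightarrow> real" where
  "ric \<Gamma> u v = tr (\<lambda>a. curv \<Gamma> u a v v)"

text \<open>Conjugation invariance of the trace requires a linear map. The traced slot also sits
  inside a differentiated function, where additivity and homogeneity come from uniqueness of
  derivatives.\<close>

lemma curv_linear:
  fixes \<Gamma> :: "'e::euclidean_space \<Rightarrow> 'e \<Rightarrow> 'e \<Rightarrow> 'e"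
  assumes S: "open S" "u \<in> S" and lin: "\<And>p. p \<in> S \<Longrightarrow> bilinear (\<Gamma> p)"
    and dG: "\<And>b c. (\<lambda>p. \<Gamma> p b c) differentiable (at u)"
  shows "linear (\<lambda>a. curv \<Gamma> u a b c)"
proof -
  have d: "((\<lambda>p. \<Gamma> p b c) has_derivative fd (\<lambda>p. \<Gamma> p b c) u) (at u)" for b c
    using dG frechet_derivative_works by blast
  have l: "linear (fd (\<lambda>p. \<Gamma> p b c) u)" for b c using d has_derivative_linear by blast
  have l1: "linear (\<Gamma> u x)" "linear (\<lambda>x. \<Gamma> u x y)" for x y
    using lin[OF S(2)] by (auto simp: bilinear_def)
  have add: "fd (\<lambda>p. \<Gamma> p (x + y) c) u = (\<lambda>b. fd (\<lambda>p. \<Gamma> p x c) u b + fd (\<lambda>p. \<Gamma> p y c) u b)" for x y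
  proof (rule fd_eq)
    have "((\<lambda>p. \<Gamma> p x c + \<Gamma> p y c) has_derivative (\<lambda>b. fd (\<lambda>p. \<Gamma> p x c) u b + fd (\<lambda>p. \<Gamma> p y c) u b)) (at u)"
      by (intro has_derivative_add d)
    then show "((\<lambda>p. \<Gamma> p (x + y) c) has_derivative (\<lambda>b. fd (\<lambda>p. \<Gamma> p x c) u b + fd (\<lambda>p. \<Gamma> p y c) u b)) (at u)"
      by (rule has_derivative_transform_within_open[OF _ S]) (simp add: bilinear_ladd[OF lin])
  qed
  have scale: "fd (\<lambda>p. \<Gamma> p (r *\<^sub>R x) c) u = (\<lambda>b. r *\<^sub>R fd (\<lambda>p. \<Gamma> p x c) u b)" for r x
  proof (rule fd_eq)
    have "((\<lambda>p. r *\<^sub>R \<Gamma> p x c) has_derivative (\<lambda>b. r *\<^sub>R fd (\<lambda>p. \<Gamma> p x c) u b)) (at u)"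
      by (intro has_derivative_scaleR_right d)
    then show "((\<lambda>p. \<Gamma> p (r *\<^sub>R x) c) has_derivative (\<lambda>b. r *\<^sub>R fd (\<lambda>p. \<Gamma> p x c) u b)) (at u)"
      by (rule has_derivative_transform_within_open[OF _ S]) (simp add: bilinear_lmul[OF lin])
  qed
  show ?thesis
    unfolding curv_def
    by (rule linearI) (simp_all add: add scale linear_add[OF l] linear_scale[OF l]
      linear_add[OF l1(1)] linear_add[OF l1(2)] linear_scale[OF l1(1)] linear_scale[OF l1(2)] algebra_simps)
qed

text \<open>By \<open>curv_transform\<close> the Jacobian conjugates the two endomorphisms whose
  traces are taken, and it is invertible, being injective in finite dimension.\<close>

lemma ric_transform:
  fixes \<Gamma> \<Gamma>' :: "real^'n::finite \<Rightarrow> real^'n \<Rightarrow> real^'n \<Rightarrow> real^'n"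
  assumes S: "open S" "u \<in> S" and f: "smooth_on f S" and T: "open T" "f ` S \<subseteq> T"
    and inj: "inj (fd f u)"
    and lin: "\<And>p. p \<in> S \<Longrightarrow> bilinear (\<Gamma> p)" "\<And>q. q \<in> T \<Longrightarrow> bilinear (\<Gamma>' q)"
    and dG: "\<And>b c. (\<lambda>p. \<Gamma> p b c) differentiable (at u)"
    and dG': "\<And>b c. (\<lambda>q. \<Gamma>' q b c) differentiable (at (f u))"
    and eq: "\<And>p b c. p \<in> S \<Longrightarrow>
      fd f p (\<Gamma> p b c) = \<Gamma>' (f p) (fd f p b) (fd f p c) + fd (\<lambda>q. fd f q c) p b"
  shows "ric \<Gamma> u v = ric \<Gamma>' (f u) (fd f u v)"
  unfolding ric_def
proof (rule tr_conjugate)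
  show "linear (fd f u)" using smooth_on_has_derivative[OF f S(2)] has_derivative_linear by blast
  show "linear (\<lambda>a. curv \<Gamma> u a v v)" using curv_linear[OF S lin(1) dG] .
  have "f u \<in> T" using S T by auto
  then show "linear (\<lambda>a. curv \<Gamma>' (f u) a (fd f u v) (fd f u v))"
    using curv_linear[OF T(1) _ lin(2) dG'] by blast
  show "fd f u (curv \<Gamma> u a v v) = curv \<Gamma>' (f u) (fd f u a) (fd f u v) (fd f u v)" for a
    by (rule curv_transform[OF S f lin(1) _ dG dG' eq]) (use T lin in auto)
qed (fact inj)

lemma has_derivative_matrix_vector_mult:
  assumes "(G has_derivative G') F"
  shows "((\<lambda>p. G p *v c) has_derivative (\<lambda>a. G' a *v (c::real^'n::finite))) F"
proof -
  have "bounded_linear (\<lambda>M::real^'n^'m. M *v c)"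
    by (intro linear_conv_bounded_linear[THEN iffD1] linearI)
      (simp_all add: matrix_vector_mult_add_rdistrib scaleR_matrix_vector_assoc)
  from bounded_linear.has_derivative[OF this assms] show ?thesis .
qed

lemma sym_matrix_inner: "transpose G = G \<Longrightarrow> a \<bullet> (G *v b) = b \<bullet> (G *v (a::real^'n::finite))"
  by (metis dot_lmul_matrix inner_commute vector_transpose_matrix)

text \<open>In the application \<open>w\<close> is the coordinate gradient of \<omega>,
  \<open>X\<close> is the same covector with its index raised, and \<open>\<Gamma>'\<close> is the
  connection of the metric multiplied by exp(2 \<omega>). Then
  \<open>w' v \<bullet> v - w u \<bullet> \<Gamma> u v v\<close> is the Hessian of \<omega> on
  \<open>v\<close>.\<close>

lemma ric_conformal:
  fixes G :: "real^'n::finite \<Rightarrow> real^'n^'n" and \<Gamma> :: "real^'n \<Rightarrow> real^'n \<Rightarrow> real^'n \<Rightarrow> real^'n"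
  assumes S: "open S" "u \<in> S" and sym: "transpose (G u) = G u" and dG: "(G has_derivative G') (at u)"
    and lin: "bilinear (\<Gamma> u)" and com: "\<And>a b. \<Gamma> u a b = \<Gamma> u b a"
    and compat: "\<And>a b c. b \<bullet> (G' a *v c) = \<Gamma> u a b \<bullet> (G u *v c) + b \<bullet> (G u *v \<Gamma> u a c)"
    and d\<Gamma>: "\<And>b c. (\<lambda>p. \<Gamma> p b c) differentiable (at u)"
    and w: "(w has_derivative w') (at u)" and X: "(X has_derivative X') (at u)"
    and GX: "\<And>p. p \<in> S \<Longrightarrow> G p *v X p = w p"
    and null: "v \<bullet> (G u *v v) = 0"
    and \<Gamma>': "\<Gamma>' = (\<lambda>p b c. \<Gamma> p b c + ((w p \<bullet> b) *\<^sub>R c + (w p \<bullet> c) *\<^sub>R b - (b \<bullet> (G p *v c)) *\<^sub>R X p))"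
  shows "ric \<Gamma>' u v = ric \<Gamma> u v - (real CARD('n) - 2) * (w' v \<bullet> v - w u \<bullet> \<Gamma> u v v - (w u \<bullet> v)^2)"
proof -
  have d: "((\<lambda>p. \<Gamma> p b c) has_derivative fd (\<lambda>p. \<Gamma> p b c) u) (at u)" for b c
    using d\<Gamma> frechet_derivative_works by blast
  have l1: "linear (\<Gamma> u x)" "linear (\<lambda>x. \<Gamma> u x y)" for x y
    using lin by (auto simp: bilinear_def)
  have lw: "linear w'" using w has_derivative_linear by blast
  have lG: "linear G'" using dG has_derivative_linear by blast
  have d': "fd (\<lambda>p. \<Gamma>' p b c) u a = fd (\<lambda>p. \<Gamma> p b c) u a + ((w' a \<bullet> b) *\<^sub>R c + (w' a \<bullet> c) *\<^sub>R b
      - ((b \<bullet> (G u *v c)) *\<^sub>R X' a + (b \<bullet> (G' a *v c)) *\<^sub>R X u))" for a b c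
  proof -
    have "((\<lambda>p. \<Gamma>' p b c) has_derivative (\<lambda>a. fd (\<lambda>p. \<Gamma> p b c) u a + ((w' a \<bullet> b) *\<^sub>R c + (w' a \<bullet> c) *\<^sub>R b
      - ((b \<bullet> (G u *v c)) *\<^sub>R X' a + (b \<bullet> (G' a *v c)) *\<^sub>R X u)))) (at u)"
      unfolding \<Gamma>' by (intro has_derivative_add has_derivative_diff has_derivative_scaleR has_derivative_inner_left
        has_derivative_inner_right has_derivative_scaleR_left has_derivative_matrix_vector_mult d w X dG)
    from fd_eq[OF this] show ?thesis by simp
  qed
  \<comment> \<open>Differentiating \<open>G p *v X p = w p\<close> is the only information
    available about \<open>X'\<close>.\<close>
  have w'X: "w' a \<bullet> b = b \<bullet> (G' a *v X u) + b \<bullet> (G u *v X' a)" for a b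
  proof -
    have "((\<lambda>p. G p *v X p) has_derivative (\<lambda>a. G' a *v X u + G u *v X' a)) (at u)"
      by (rule has_derivative_linear_field[OF S _ has_derivative_matrix_vector_mult[OF dG] X]) simp
    then have "(w has_derivative (\<lambda>a. G' a *v X u + G u *v X' a)) (at u)"
      by (rule has_derivative_transform_within_open[OF _ S]) (simp add: GX)
    from has_derivative_unique[OF w this] show ?thesis
      by (simp add: inner_add_right inner_commute)
  qed
  have GXu: "G u *v X u = w u" using GX S by blast
  let ?n = "real CARD('n)"
  let ?T = "tr (\<lambda>a. \<Gamma> u a v)"
  \<comment> \<open>Full expansion for null \<open>v\<close>. It is arranged as a combination of
    multiples of \<open>a\<close>, of rank one maps and of \<open>\<Gamma> u a v\<close>, so that
    the trace can be read off term by term.\<close>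
  have E: "curv \<Gamma>' u a v v = curv \<Gamma> u a v v
     + (2 *\<^sub>R ((w' a \<bullet> v) *\<^sub>R v) - (v \<bullet> (G' a *v v)) *\<^sub>R X u)
     - ((w' v \<bullet> a) *\<^sub>R v + (w' v \<bullet> v) *\<^sub>R a - ((a \<bullet> (G u *v v)) *\<^sub>R X' v + (a \<bullet> (G' v *v v)) *\<^sub>R X u))
     + (2 * (w u \<bullet> v)) *\<^sub>R \<Gamma> u a v
     + ((w u \<bullet> a) *\<^sub>R \<Gamma> u v v + (w u \<bullet> \<Gamma> u v v) *\<^sub>R a - (a \<bullet> (G u *v \<Gamma> u v v)) *\<^sub>R X u)
     + (2 * (w u \<bullet> v)) *\<^sub>R ((w u \<bullet> a) *\<^sub>R v + (w u \<bullet> v) *\<^sub>R a - (a \<bullet> (G u *v v)) *\<^sub>R X u)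
     - ((w u \<bullet> a) *\<^sub>R \<Gamma> u v v + (w u \<bullet> v) *\<^sub>R \<Gamma> u a v - (a \<bullet> (G u *v v)) *\<^sub>R \<Gamma> u v (X u))
     - ((w u \<bullet> v) *\<^sub>R \<Gamma> u a v + (w u \<bullet> \<Gamma> u a v) *\<^sub>R v - (v \<bullet> (G u *v \<Gamma> u a v)) *\<^sub>R X u)
     - ((w u \<bullet> a) *\<^sub>R (2 * (w u \<bullet> v)) *\<^sub>R v
        + (w u \<bullet> v) *\<^sub>R ((w u \<bullet> v) *\<^sub>R a + (w u \<bullet> a) *\<^sub>R v - (a \<bullet> (G u *v v)) *\<^sub>R X u)
        - (a \<bullet> (G u *v v)) *\<^sub>R ((w u \<bullet> v) *\<^sub>R X u + (w u \<bullet> X u) *\<^sub>R v - (w u \<bullet> v) *\<^sub>R X u))" for a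
  proof -
    have va: "v \<bullet> (G u *v a) = a \<bullet> (G u *v v)" using sym_matrix_inner[OF sym] .
    have vX: "v \<bullet> (G u *v X u) = w u \<bullet> v" by (simp add: GXu inner_commute)
    have cv: "\<Gamma> u v a = \<Gamma> u a v" by (rule com)
    have vv: "\<Gamma>' u v v = \<Gamma> u v v + (2 * (w u \<bullet> v)) *\<^sub>R v"
      by (simp add: \<Gamma>' null flip: scaleR_left_distrib)
    have av: "\<Gamma>' u a v = \<Gamma> u a v + ((w u \<bullet> a) *\<^sub>R v + (w u \<bullet> v) *\<^sub>R a - (a \<bullet> (G u *v v)) *\<^sub>R X u)"
      by (simp add: \<Gamma>')
    have ax: "\<Gamma>' u a x = \<Gamma> u a x + ((w u \<bullet> a) *\<^sub>R x + (w u \<bullet> x) *\<^sub>R a - (a \<bullet> (G u *v x)) *\<^sub>R X u)" for a x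
      by (simp add: \<Gamma>')
    show ?thesis
      unfolding curv_def d' vv av unfolding ax
        linear_add[OF l1(1)] linear_diff[OF l1(1)] linear_scale[OF l1(1)]
        inner_add_right inner_diff_right matrix_vector_right_distrib matrix_vector_mult_diff_distrib
        matrix_vector_mult_scaleR inner_scaleR_right null va vX cv com[of v "\<Gamma> u a v"]
      by (simp add: vec_eq_iff algebra_simps)
  qed
  have lins: "linear (\<lambda>a. w' a \<bullet> v)" "linear (\<lambda>a. v \<bullet> (G' a *v v))" "linear (\<lambda>a. q \<bullet> a)" "linear (\<lambda>a. a \<bullet> q)"
    "linear (\<lambda>a. w u \<bullet> \<Gamma> u a v)" "linear (\<lambda>a. v \<bullet> (G u *v \<Gamma> u a v))" for q
    by (auto intro!: linearI simp: linear_add[OF lw] linear_scale[OF lw] linear_add[OF lG] linear_scale[OF lG]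
      inner_add_left inner_add_right matrix_vector_mult_add_rdistrib matrix_vector_right_distrib
      scaleR_matrix_vector_assoc[symmetric] matrix_vector_mult_scaleR linear_add[OF l1(2)] linear_scale[OF l1(2)])
  have c1: "v \<bullet> (G' (X u) *v v) = 2 * (v \<bullet> (G u *v \<Gamma> u (X u) v))"
    using compat[of v "X u" v] sym_matrix_inner[OF sym, of "\<Gamma> u (X u) v" v] by simp
  have wv: "w u \<bullet> v = v \<bullet> (G u *v X u)" by (simp add: GXu inner_commute)
  have X'v: "X' v \<bullet> (G u *v v) = v \<bullet> (G u *v X' v)" using sym_matrix_inner[OF sym] .
  have c2: "X u \<bullet> (G' v *v v) + X' v \<bullet> (G u *v v) = w' v \<bullet> v"
  proof -
    have "X u \<bullet> (G' v *v v) = v \<bullet> (G' v *v X u)"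
      using compat[of "X u" v v] compat[of v v "X u"] sym_matrix_inner[OF sym] by (metis add.commute inner_commute)
    then show ?thesis using w'X[of v v] X'v by simp
  qed
  have c3: "X u \<bullet> (G u *v \<Gamma> u v v) = w u \<bullet> \<Gamma> u v v"
    using sym_matrix_inner[OF sym, of "X u"] by (metis GXu inner_commute)
  have c4: "\<Gamma> u v (X u) \<bullet> (G u *v v) = v \<bullet> (G u *v \<Gamma> u (X u) v)"
    using sym_matrix_inner[OF sym] com by metis
  have c5: "X u \<bullet> (G u *v v) = w u \<bullet> v" using wv sym_matrix_inner[OF sym] by metis
  \<comment> \<open>The multiples of \<open>?T\<close> cancel, and by \<open>c1\<close> and
    \<open>c4\<close> so do those of \<open>v \<bullet> (G u *v \<Gamma> u (X u) v)\<close>. The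
    factor \<open>?n\<close> comes from the multiples of the identity; the rank one maps leave the
    \<open>- 2\<close>.\<close>
  have "ric \<Gamma>' u v = ric \<Gamma> u v + (2 * (w' v \<bullet> v) - v \<bullet> (G' (X u) *v v))
     - (w' v \<bullet> v + (w' v \<bullet> v) * ?n - (X' v \<bullet> (G u *v v) + X u \<bullet> (G' v *v v)))
     + 2 * (w u \<bullet> v) * ?T
     + (w u \<bullet> \<Gamma> u v v + (w u \<bullet> \<Gamma> u v v) * ?n - X u \<bullet> (G u *v \<Gamma> u v v))
     + 2 * (w u \<bullet> v) * (w u \<bullet> v + (w u \<bullet> v) * ?n - X u \<bullet> (G u *v v))
     - (w u \<bullet> \<Gamma> u v v + (w u \<bullet> v) * ?T - \<Gamma> u v (X u) \<bullet> (G u *v v))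
     - ((w u \<bullet> v) * ?T + w u \<bullet> \<Gamma> u v v - v \<bullet> (G u *v \<Gamma> u (X u) v))
     - (w u \<bullet> ((2 * (w u \<bullet> v)) *\<^sub>R v)
        + (w u \<bullet> v) * ((w u \<bullet> v) * ?n + w u \<bullet> v - X u \<bullet> (G u *v v))
        - ((w u \<bullet> v) *\<^sub>R X u + (w u \<bullet> X u) *\<^sub>R v - (w u \<bullet> v) *\<^sub>R X u) \<bullet> (G u *v v))"
    unfolding ric_def E by (simp only: tr_add tr_diff tr_scaleR tr_rank1[OF lins(1)] tr_rank1[OF lins(2)]
      tr_rank1[OF lins(3)] tr_rank1[OF lins(4)] tr_rank1[OF lins(5)] tr_rank1[OF lins(6)] tr_id)
  then show ?thesis
    using c2 by (simp add: c1 c3 c4 c5 null inner_add_left inner_diff_left power2_eq_square algebra_simps)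
qed

section \<open>Levi-Civita connections in coordinates\<close>

lemma differentiable_det:
  fixes M :: "'a::real_normed_vector \<Rightarrow> real^'n::finite^'n"
  assumes "\<And>i j. (\<lambda>w. M w $ i $ j) differentiable (at u)"
  shows "(\<lambda>w. det (M w)) differentiable (at u)"
proof -
  from assms obtain M' where M': "\<And>i j. ((\<lambda>w. M w $ i $ j) has_derivative M' i j) (at u)"
    unfolding differentiable_def by metis
  show ?thesis
    unfolding det_def differentiable_def
    by (rule exI, rule has_derivative_sum, rule has_derivative_mult_right, rule has_derivative_prod, rule M')
qed

lemma differentiable_vec_nth:
  "f differentiable F \<Longrightarrow> (\<lambda>x. f x $ i) differentiable F"
  unfolding differentiable_def using bounded_linear.has_derivative[OF bounded_linear_vec_nth] by blast

lemma has_derivative_vec_nth: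
  "(f has_derivative f') F \<Longrightarrow> ((\<lambda>x. f x $ i) has_derivative (\<lambda>a. f' a $ i)) F"
  by (rule bounded_linear.has_derivative[OF bounded_linear_vec_nth])

lemma fd_vec_nth: "f differentiable (at u) \<Longrightarrow> fd (\<lambda>x. f x $ i) u a = fd f u a $ i"
  using fd_eq[OF has_derivative_vec_nth] frechet_derivative_works by metis

lemma differentiable_vec_lambda:
  fixes f :: "'n::finite \<Rightarrow> 'a::real_normed_vector \<Rightarrow> real"
  assumes "\<And>i. f i differentiable (at u)"
  shows "(\<lambda>x. \<chi> i. f i x) differentiable (at u)"
proof -
  have "(\<lambda>x. \<Sum>i\<in>UNIV. f i x *\<^sub>R axis i (1::real)) differentiable (at u)"
    using assms by (intro differentiable_sum differentiable_scaleR differentiable_const) auto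
  moreover have "(\<chi> i. f i x) = (\<Sum>i\<in>UNIV. f i x *\<^sub>R axis i (1::real))" for x
    using basis_expansion[of "\<chi> i. f i x"] by (simp add: scalar_mult_eq_scaleR)
  ultimately show ?thesis by simp
qed

lemma matrix_inv_mult:
  fixes A :: "'a::semiring_1^'n^'m"
  assumes "invertible A"
  shows "A ** matrix_inv A = mat 1" "matrix_inv A ** A = mat 1"
  using someI_ex[OF assms[unfolded invertible_def]] unfolding matrix_inv_def by auto

text \<open>Cramer's rule presents the entries of the inverse as quotients of polynomials in the
  entries of the matrix. Differentiability of the Christoffel symbols rests on this.\<close>

lemma matrix_inv_cramer:
  fixes A :: "real^'n::finite^'n"
  assumes "invertible A"
  shows "matrix_inv A $ k $ l = det (\<chi> i j. if j = k then axis l 1 $ i else A $ i $ j) / det A"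
proof -
  have "A *v (matrix_inv A *v axis l 1) = axis l 1"
    using assms by (simp add: matrix_vector_mul_assoc matrix_inv_mult(1))
  moreover have "det A \<noteq> 0" using assms by (simp add: invertible_det_nz)
  ultimately have "matrix_inv A *v axis l 1 = (\<chi> k. det (\<chi> i j. if j = k then axis l 1 $ i else A $ i $ j) / det A)"
    using cramer by blast
  then show ?thesis
    by (metis (no_types, lifting) matrix_vector_mult_basis column_def vec_lambda_beta)
qed

lemma differentiable_transform_open:
  "f differentiable (at u) \<Longrightarrow> open S \<Longrightarrow> u \<in> S \<Longrightarrow> (\<And>p. p \<in> S \<Longrightarrow> f p = g p) \<Longrightarrow> g differentiable (at u)"
  unfolding differentiable_def using has_derivative_transform_within_open by blast

lemma differentiable_matrix_inv:
  fixes G :: "'a::real_normed_vector \<Rightarrow> real^'n::finite^'n"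
  assumes S: "open S" "u \<in> S" and inv: "\<And>p. p \<in> S \<Longrightarrow> invertible (G p)" and G: "G differentiable (at u)"
  shows "(\<lambda>w. matrix_inv (G w) $ k $ l) differentiable (at u)"
proof (rule differentiable_transform_open[OF _ S])
  show "(\<lambda>w. det (\<chi> i j. if j = k then axis l 1 $ i else G w $ i $ j) / det (G w)) differentiable (at u)"
  proof (intro differentiable_divide differentiable_det)
    show "det (G u) \<noteq> 0" using inv S by (simp add: invertible_det_nz[symmetric])
    show "(\<lambda>w. G w $ i $ j) differentiable (at u)" for i j by (intro differentiable_vec_nth G)
    show "(\<lambda>w. (\<chi> i j. if j = k then axis l 1 $ i else G w $ i $ j) $ i $ j) differentiable (at u)" for i j
      by (cases "j = k") (simp_all add: differentiable_vec_nth G)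
  qed
qed (simp add: matrix_inv_cramer inv)

lemma matrix_inner_sum:
  "b \<bullet> ((M::real^'n::finite^'n) *v d) = (\<Sum>j\<in>UNIV. \<Sum>l\<in>UNIV. b $ j * d $ l * M $ j $ l)"
  by (simp add: inner_vec_def matrix_vector_mult_def sum_distrib_left mult.assoc mult.commute mult.left_commute)

section \<open>The Levi-Civita connection in one chart\<close>

lemma bilinear_christoffel_form: "bilinear (christoffel_form A g c u)"
  unfolding bilinear_def christoffel_form_def
  by (intro conjI allI linearI; simp add: vec_eq_iff distrib_left distrib_right sum.distrib sum_distrib_left
     mult.assoc mult.commute mult.left_commute)

lemma christoffel_form_axis: "christoffel_form A g c u (axis i 1) (axis j 1) $ k = christoffel A g c k i j u"
proof -
  have "(\<Sum>i'\<in>UNIV. \<Sum>j'\<in>UNIV. christoffel A g c k i' j' u * axis i 1 $ i' * axis j 1 $ j')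
     = (\<Sum>i'\<in>UNIV. if i' = i then \<Sum>j'\<in>UNIV. if j' = j then christoffel A g c k i' j' u else 0 else 0)"
    by (intro sum.cong) (auto simp: axis_def if_distrib cong: if_cong)
  then show ?thesis by (simp add: christoffel_form_def)
qed

text \<open>The coordinate matrix and its domain are parameters, so that one instance for each
  manifold can be joined in \<open>conformal_charts\<close>.\<close>

locale metric_chart =
  fixes A :: "('m, 'n::finite) chart set" and g :: "('m, 'n) metric" and c :: "('m, 'n) chart"
    and G :: "real^'n \<Rightarrow> real^'n^'n" and S :: "(real^'n) set"
  assumes G_eq: "G = metric_matrix A g c"
    and S: "open S" and smooth: "smooth_on G S"
    and sym: "\<And>u. u \<in> S \<Longrightarrow> transpose (G u) = G u"
    and inv: "\<And>u. u \<in> S \<Longrightarrow> invertible (G u)"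
begin

abbreviation \<Gamma> where "\<Gamma> \<equiv> christoffel_form A g c"

lemma G_diff: "u \<in> S \<Longrightarrow> G differentiable (at u)"
  using smooth smooth_on_differentiable by blast

lemma G_has_derivative: "u \<in> S \<Longrightarrow> (G has_derivative fd G u) (at u)"
  using smooth smooth_on_has_derivative by blast

lemma G_nth_sym: "u \<in> S \<Longrightarrow> G u $ i $ j = G u $ j $ i"
  using arg_cong[OF sym, of u "\<lambda>M. M $ i $ j"] by (simp add: transpose_def)

lemma fd_G_nth: "u \<in> S \<Longrightarrow> fd (\<lambda>w. G w $ i $ j) u a = fd G u a $ i $ j"
  using fd_vec_nth[OF G_diff, of u i a] fd_vec_nth[OF differentiable_vec_nth[OF G_diff], of u i j a] by simp

lemma fd_G_sym: "u \<in> S \<Longrightarrow> transpose (fd G u a) = fd G u a"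
proof -
  assume u: "u \<in> S"
  have "fd (\<lambda>w. G w $ i $ j) u = fd (\<lambda>w. G w $ j $ i) u" for i j
    by (rule fd_cong_open[OF S u G_nth_sym])
  then show ?thesis
    by (simp add: vec_eq_iff transpose_def fd_G_nth[OF u, symmetric])
qed

text \<open>Multiplication by \<open>G u\<close> cancels the inverse matrix in the definition of the
  Christoffel symbols. Symmetry, metric compatibility and the conformal change of the connection are
  all derived from this formula instead of from indices.\<close>

lemma christoffel_form_koszul:
  assumes u: "u \<in> S"
  shows "2 * (d \<bullet> (G u *v \<Gamma> u a b)) =
    b \<bullet> (fd G u a *v d) + a \<bullet> (fd G u b *v d) - a \<bullet> (fd G u d *v b)"
proof -
  let ?P = "\<lambda>i j l. fd G u (axis i 1) $ j $ l"
  have lin: "linear (\<lambda>a. fd G u a $ j $ l)" for j l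
    using has_derivative_linear[OF has_derivative_vec_nth[OF has_derivative_vec_nth[OF G_has_derivative[OF u]]]] .
  have fdG: "b \<bullet> (fd G u a *v d) = (\<Sum>i\<in>UNIV. \<Sum>j\<in>UNIV. \<Sum>l\<in>UNIV. a $ i * b $ j * d $ l * ?P i j l)" for a b d
  proof -
    have "b \<bullet> (fd G u a *v d) = (\<Sum>j\<in>UNIV. \<Sum>l\<in>UNIV. \<Sum>i\<in>UNIV. a $ i * b $ j * d $ l * ?P i j l)"
      unfolding matrix_inner_sum
      by (subst linear_sum_axis[OF lin]) (simp add: sum_distrib_left algebra_simps)
    also have "\<dots> = (\<Sum>j\<in>UNIV. \<Sum>i\<in>UNIV. \<Sum>l\<in>UNIV. a $ i * b $ j * d $ l * ?P i j l)"
      by (rule sum.cong[OF refl], rule sum.swap)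
    also have "\<dots> = (\<Sum>i\<in>UNIV. \<Sum>j\<in>UNIV. \<Sum>l\<in>UNIV. a $ i * b $ j * d $ l * ?P i j l)"
      by (rule sum.swap)
    finally show ?thesis .
  qed
  \<comment> \<open>Christoffel symbols of the first kind, contracted with \<open>a\<close> and
    \<open>b\<close>.\<close>
  define K where "K = (\<chi> l. \<Sum>i\<in>UNIV. \<Sum>j\<in>UNIV. (?P i j l + ?P j i l - ?P l i j) / 2 * a $ i * b $ j)"
  have "\<Gamma> u a b = matrix_inv (G u) *v K"
  proof (simp add: vec_eq_iff christoffel_form_def matrix_vector_mult_def, intro allI)
    fix k
    have "christoffel A g c k i j u = (\<Sum>l\<in>UNIV. matrix_inv (G u) $ k $ l * ((?P i j l + ?P j i l - ?P l i j) / 2))" for i j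
      by (simp add: christoffel_def G_eq[symmetric] pderiv_on_def fd_G_nth[OF u] Let_def sum_divide_distrib)
    then have "(\<Sum>i\<in>UNIV. \<Sum>j\<in>UNIV. christoffel A g c k i j u * a $ i * b $ j) =
       (\<Sum>i\<in>UNIV. \<Sum>j\<in>UNIV. \<Sum>l\<in>UNIV. matrix_inv (G u) $ k $ l * ((?P i j l + ?P j i l - ?P l i j) / 2 * a $ i * b $ j))"
      by (simp add: sum_distrib_right mult.assoc)
    also have "\<dots> = (\<Sum>i\<in>UNIV. \<Sum>l\<in>UNIV. \<Sum>j\<in>UNIV. matrix_inv (G u) $ k $ l * ((?P i j l + ?P j i l - ?P l i j) / 2 * a $ i * b $ j))"
      by (rule sum.cong[OF refl], rule sum.swap)
    also have "\<dots> = (\<Sum>l\<in>UNIV. \<Sum>i\<in>UNIV. \<Sum>j\<in>UNIV. matrix_inv (G u) $ k $ l * ((?P i j l + ?P j i l - ?P l i j) / 2 * a $ i * b $ j))"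
      by (rule sum.swap)
    also have "\<dots> = (\<Sum>l\<in>UNIV. matrix_inv (G u) $ k $ l * K $ l)"
      by (simp add: K_def sum_distrib_left)
    finally show "(\<Sum>i\<in>UNIV. \<Sum>j\<in>UNIV. christoffel A g c k i j u * a $ i * b $ j) = (\<Sum>l\<in>UNIV. matrix_inv (G u) $ k $ l * K $ l)" .
  qed
  then have "G u *v \<Gamma> u a b = K"
    using inv[OF u] by (simp add: matrix_vector_mul_assoc matrix_inv_mult(1))
  then have "2 * (d \<bullet> (G u *v \<Gamma> u a b)) = (\<Sum>l\<in>UNIV. \<Sum>i\<in>UNIV. \<Sum>j\<in>UNIV. d $ l * a $ i * b $ j * (?P i j l + ?P j i l - ?P l i j))"
    by (simp add: K_def inner_vec_def sum_distrib_left add_divide_distrib diff_divide_distrib algebra_simps)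
  also have "\<dots> = (\<Sum>l\<in>UNIV. \<Sum>i\<in>UNIV. \<Sum>j\<in>UNIV. a $ i * b $ j * d $ l * ?P i j l)
     + (\<Sum>l\<in>UNIV. \<Sum>i\<in>UNIV. \<Sum>j\<in>UNIV. b $ j * a $ i * d $ l * ?P j i l)
     - (\<Sum>l\<in>UNIV. \<Sum>i\<in>UNIV. \<Sum>j\<in>UNIV. d $ l * a $ i * b $ j * ?P l i j)"
    by (simp add: sum.distrib sum_subtractf algebra_simps)
  also have "(\<Sum>l\<in>UNIV. \<Sum>i\<in>UNIV. \<Sum>j\<in>UNIV. a $ i * b $ j * d $ l * ?P i j l) = b \<bullet> (fd G u a *v d)"
    unfolding fdG by (subst sum.swap, rule sum.cong[OF refl], rule sum.swap)
  also have "(\<Sum>l\<in>UNIV. \<Sum>i\<in>UNIV. \<Sum>j\<in>UNIV. b $ j * a $ i * d $ l * ?P j i l) = a \<bullet> (fd G u b *v d)"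
  proof -
    have "(\<Sum>l\<in>UNIV. \<Sum>i\<in>UNIV. \<Sum>j\<in>UNIV. b $ j * a $ i * d $ l * ?P j i l)
       = (\<Sum>l\<in>UNIV. \<Sum>j\<in>UNIV. \<Sum>i\<in>UNIV. b $ j * a $ i * d $ l * ?P j i l)"
      by (rule sum.cong[OF refl], rule sum.swap)
    also have "\<dots> = a \<bullet> (fd G u b *v d)"
      unfolding fdG by (subst sum.swap, rule sum.cong[OF refl], rule sum.swap)
    finally show ?thesis .
  qed
  also have "(\<Sum>l\<in>UNIV. \<Sum>i\<in>UNIV. \<Sum>j\<in>UNIV. d $ l * a $ i * b $ j * ?P l i j) = a \<bullet> (fd G u d *v b)"
    unfolding fdG ..
  finally show ?thesis .
qed

text \<open>Nondegeneracy of the metric, in the form in which Koszul's formula determines the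
  connection: by testing against every \<open>d\<close>.\<close>

lemma G_cancel: "u \<in> S \<Longrightarrow> (\<And>d. d \<bullet> (G u *v x) = d \<bullet> (G u *v y)) \<Longrightarrow> x = y"
proof -
  assume u: "u \<in> S" and d: "\<And>d. d \<bullet> (G u *v x) = d \<bullet> (G u *v y)"
  have e: "G u *v x = G u *v y" by (rule iffD1[OF vector_eq_ldot]) (simp add: d)
  have "matrix_inv (G u) *v (G u *v z) = z" for z
    by (simp add: matrix_vector_mul_assoc matrix_inv_mult(2)[OF inv[OF u]])
  then show "x = y" using e by metis
qed

lemma christoffel_form_sym: "u \<in> S \<Longrightarrow> \<Gamma> u a b = \<Gamma> u b a"
proof (rule G_cancel)
  fix d assume u: "u \<in> S"
  show "d \<bullet> (G u *v \<Gamma> u a b) = d \<bullet> (G u *v \<Gamma> u b a)"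
    using christoffel_form_koszul[OF u, of d a b] christoffel_form_koszul[OF u, of d b a]
      sym_matrix_inner[OF fd_G_sym[OF u, of d], of a b] by simp
qed

text \<open>Add Koszul's formula for \<open>d, a, b\<close> to the one for \<open>b, a, d\<close>:
  the derivatives of \<open>G\<close> along \<open>b\<close> and \<open>d\<close> cancel by
  symmetry.\<close>

lemma christoffel_form_compat:
  assumes u: "u \<in> S"
  shows "b \<bullet> (fd G u a *v d) = \<Gamma> u a b \<bullet> (G u *v d) + b \<bullet> (G u *v \<Gamma> u a d)"
  using christoffel_form_koszul[OF u, of d a b] christoffel_form_koszul[OF u, of b a d]
    sym_matrix_inner[OF sym[OF u], of "\<Gamma> u a b" d]
    sym_matrix_inner[OF fd_G_sym[OF u, of a], of b d] sym_matrix_inner[OF fd_G_sym[OF u, of b], of a d]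
    sym_matrix_inner[OF fd_G_sym[OF u, of d], of a b] by simp

lemma christoffel_differentiable:
  assumes u: "u \<in> S" shows "christoffel A g c k i j differentiable (at u)"
proof -
  let ?f = "\<lambda>p. (\<Sum>l\<in>UNIV. matrix_inv (G p) $ k $ l * (fd G p (axis i 1) $ j $ l + fd G p (axis j 1) $ i $ l
      - fd G p (axis l 1) $ i $ j)) / 2"
  have "(\<lambda>p. fd G p x $ i $ j) differentiable (at u)" for x i j
    by (intro differentiable_vec_nth smooth_on_differentiable[OF smooth_on_fd[OF smooth] u])
  then have "?f differentiable (at u)"
    by (intro differentiable_divide differentiable_sum ballI differentiable_mult differentiable_diff
      differentiable_add differentiable_matrix_inv[OF S u inv G_diff[OF u]]) auto
  then show ?thesis
    by (rule differentiable_transform_open[OF _ S u])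
      (simp add: christoffel_def G_eq[symmetric] pderiv_on_def fd_G_nth Let_def)
qed

lemma christoffel_form_differentiable:
  "u \<in> S \<Longrightarrow> (\<lambda>p. \<Gamma> p a b) differentiable (at u)"
  unfolding christoffel_form_def
  by (intro differentiable_vec_lambda differentiable_sum ballI finite differentiable_mult
    christoffel_differentiable differentiable_const)

text \<open>The facts \<open>1\<close> to \<open>4\<close> are the traces of the four terms of
  \<open>curv\<close>, each matched with one term of \<open>ricci\<close>. Symmetry in the lower
  indices reconciles the index orders: the trace puts \<open>axis k 1\<close> into the first slot,
  while \<open>ricci\<close> has the contracted index last.\<close>

lemma ricci_contract:
  assumes u: "u \<in> S"
  shows "(\<Sum>i\<in>UNIV. \<Sum>j\<in>UNIV. v $ i * v $ j * ricci A g c i j u) = ric \<Gamma> u v"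
proof -
  let ?C = "\<lambda>k i j. christoffel A g c k i j u"
  let ?D = "\<lambda>m k i j. pderiv_on m (christoffel A g c k i j) u"
  have Cs: "?C k i j = ?C k j i" for k i j
    using christoffel_form_sym[OF u] christoffel_form_axis by metis
  have Ds: "?D m k i j = ?D m k j i" for m k i j
  proof -
    have "christoffel A g c k i j p = christoffel A g c k j i p" if "p \<in> S" for p
      using christoffel_form_sym[OF that] christoffel_form_axis by metis
    from fd_cong_open[OF S u this] show ?thesis by (simp add: pderiv_on_def)
  qed
  have fdG: "fd (\<lambda>p. \<Gamma> p b d) u a $ k = (\<Sum>m\<in>UNIV. \<Sum>i\<in>UNIV. \<Sum>j\<in>UNIV. a $ m * (?D m k i j * b $ i * d $ j))" for a b d k
  proof -
    have "((\<lambda>p. \<Gamma> p b d $ k) has_derivative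
       (\<lambda>a. \<Sum>i\<in>UNIV. \<Sum>j\<in>UNIV. fd (christoffel A g c k i j) u a * b $ i * d $ j)) (at u)"
      unfolding christoffel_form_def vec_lambda_beta
      by (intro has_derivative_sum has_derivative_mult_left frechet_derivative_works[THEN iffD1]
        christoffel_differentiable u)
    from fd_eq[OF this] fd_vec_nth[OF christoffel_form_differentiable[OF u], of b d k]
    have *: "fd (\<lambda>p. \<Gamma> p b d) u a $ k = (\<Sum>i\<in>UNIV. \<Sum>j\<in>UNIV. fd (christoffel A g c k i j) u a * b $ i * d $ j)" for a
      by simp
    have "linear (\<lambda>a. fd (\<lambda>p. \<Gamma> p b d) u a $ k)"
      by (rule has_derivative_linear[OF has_derivative_vec_nth[OF frechet_derivative_works[THEN iffD1]]])
        (rule christoffel_form_differentiable[OF u])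
    from linear_sum_axis[OF this, of a] show ?thesis
      by (simp add: * pderiv_on_def sum_distrib_left)
  qed
  have GG: "\<Gamma> u a b $ k = (\<Sum>i\<in>UNIV. \<Sum>j\<in>UNIV. a $ i * b $ j * ?C k i j)" for a b k
    by (simp add: christoffel_form_def algebra_simps)
  have ax: "(\<Sum>i\<in>UNIV. axis k 1 $ i * f i) = f k" for k and f :: "'n \<Rightarrow> real"
  proof -
    have "(\<Sum>i\<in>UNIV. axis k 1 $ i * f i) = (\<Sum>i\<in>UNIV. if i = k then f i else 0)"
      by (intro sum.cong) (auto simp: axis_def)
    then show ?thesis by simp
  qed
  have rot: "(\<Sum>i\<in>UNIV. \<Sum>j\<in>UNIV. \<Sum>k\<in>UNIV. f i j k) = (\<Sum>k\<in>UNIV. \<Sum>i\<in>UNIV. \<Sum>j\<in>UNIV. f i j k)"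
    for f :: "'n \<Rightarrow> 'n \<Rightarrow> 'n \<Rightarrow> real"
  proof -
    have "(\<Sum>i\<in>UNIV. \<Sum>j\<in>UNIV. \<Sum>k\<in>UNIV. f i j k) = (\<Sum>i\<in>UNIV. \<Sum>k\<in>UNIV. \<Sum>j\<in>UNIV. f i j k)"
      by (rule sum.cong[OF refl], rule sum.swap)
    also have "\<dots> = (\<Sum>k\<in>UNIV. \<Sum>i\<in>UNIV. \<Sum>j\<in>UNIV. f i j k)" by (rule sum.swap)
    finally show ?thesis .
  qed
  have 1: "(\<Sum>k\<in>UNIV. fd (\<lambda>p. \<Gamma> p v v) u (axis k 1) $ k) = (\<Sum>i\<in>UNIV. \<Sum>j\<in>UNIV. v $ i * v $ j * (\<Sum>k\<in>UNIV. ?D k k i j))"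
  proof -
    have "fd (\<lambda>p. \<Gamma> p v v) u (axis k 1) $ k = (\<Sum>i\<in>UNIV. \<Sum>j\<in>UNIV. ?D k k i j * v $ i * v $ j)" for k
      unfolding fdG sum_distrib_left[symmetric] by (rule ax)
    then have "(\<Sum>k\<in>UNIV. fd (\<lambda>p. \<Gamma> p v v) u (axis k 1) $ k) =
      (\<Sum>k\<in>UNIV. \<Sum>i\<in>UNIV. \<Sum>j\<in>UNIV. ?D k k i j * v $ i * v $ j)" by simp
    also have "\<dots> = (\<Sum>i\<in>UNIV. \<Sum>j\<in>UNIV. \<Sum>k\<in>UNIV. ?D k k i j * v $ i * v $ j)" by (rule rot[symmetric])
    finally show ?thesis by (simp add: sum_distrib_left algebra_simps)
  qed
  have 2: "(\<Sum>k\<in>UNIV. fd (\<lambda>p. \<Gamma> p (axis k 1) v) u v $ k) = (\<Sum>i\<in>UNIV. \<Sum>j\<in>UNIV. v $ i * v $ j * (\<Sum>k\<in>UNIV. ?D j k i k))"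
  proof -
    have "(\<Sum>i\<in>UNIV. \<Sum>j\<in>UNIV. ?D m k i j * axis k 1 $ i * v $ j) = (\<Sum>j\<in>UNIV. v $ j * ?D m k j k)" for m k
      using ax[of k "\<lambda>i. \<Sum>j\<in>UNIV. v $ j * ?D m k i j"]
      by (simp add: Ds[of m k _ k] sum_distrib_left algebra_simps)
    then have "(\<Sum>k\<in>UNIV. fd (\<lambda>p. \<Gamma> p (axis k 1) v) u v $ k) = (\<Sum>k\<in>UNIV. \<Sum>j\<in>UNIV. \<Sum>i\<in>UNIV. v $ j * (v $ i * ?D j k i k))"
      by (simp add: fdG sum_distrib_left[symmetric])
    also have "\<dots> = (\<Sum>j\<in>UNIV. \<Sum>i\<in>UNIV. \<Sum>k\<in>UNIV. v $ j * (v $ i * ?D j k i k))" by (rule rot[symmetric])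
    also have "\<dots> = (\<Sum>i\<in>UNIV. \<Sum>j\<in>UNIV. \<Sum>k\<in>UNIV. v $ j * (v $ i * ?D j k i k))" by (rule sum.swap)
    finally show ?thesis by (simp add: sum_distrib_left algebra_simps)
  qed
  have 3: "(\<Sum>k\<in>UNIV. \<Gamma> u (axis k 1) (\<Gamma> u v v) $ k) =
      (\<Sum>i\<in>UNIV. \<Sum>j\<in>UNIV. v $ i * v $ j * (\<Sum>k\<in>UNIV. \<Sum>l\<in>UNIV. ?C k k l * ?C l i j))"
  proof -
    have e: "\<Gamma> u (axis k 1) w $ k = (\<Sum>l\<in>UNIV. w $ l * ?C k k l)" for k w
      by (simp add: GG sum_distrib_left[symmetric] ax mult.assoc)
    have "(\<Sum>k\<in>UNIV. \<Gamma> u (axis k 1) (\<Gamma> u v v) $ k) =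
        (\<Sum>k\<in>UNIV. \<Sum>l\<in>UNIV. \<Sum>i\<in>UNIV. \<Sum>j\<in>UNIV. v $ i * v $ j * (?C k k l * ?C l i j))"
      unfolding e GG[of v v] by (simp add: sum_distrib_right sum_distrib_left mult.commute mult.left_commute)
    also have "\<dots> = (\<Sum>k\<in>UNIV. \<Sum>i\<in>UNIV. \<Sum>j\<in>UNIV. \<Sum>l\<in>UNIV. v $ i * v $ j * (?C k k l * ?C l i j))"
      by (rule sum.cong[OF refl], rule rot[symmetric])
    also have "\<dots> = (\<Sum>i\<in>UNIV. \<Sum>j\<in>UNIV. \<Sum>k\<in>UNIV. \<Sum>l\<in>UNIV. v $ i * v $ j * (?C k k l * ?C l i j))"
      by (rule rot[symmetric])
    finally show ?thesis by (simp add: sum_distrib_left)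
  qed
  have 4: "(\<Sum>k\<in>UNIV. \<Gamma> u v (\<Gamma> u (axis k 1) v) $ k) =
      (\<Sum>i\<in>UNIV. \<Sum>j\<in>UNIV. v $ i * v $ j * (\<Sum>k\<in>UNIV. \<Sum>l\<in>UNIV. ?C k j l * ?C l i k))"
  proof -
    have e: "\<Gamma> u (axis k 1) v $ l = (\<Sum>i\<in>UNIV. v $ i * ?C l i k)" for k l
      unfolding GG mult.assoc sum_distrib_left[symmetric] ax by (simp add: Cs[of l k])
    have "(\<Sum>k\<in>UNIV. \<Gamma> u v (\<Gamma> u (axis k 1) v) $ k) =
        (\<Sum>k\<in>UNIV. \<Sum>j\<in>UNIV. \<Sum>l\<in>UNIV. \<Sum>i\<in>UNIV. v $ i * v $ j * (?C k j l * ?C l i k))"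
      unfolding GG[of v "\<Gamma> u (axis k 1) v" for k] e by (simp add: sum_distrib_right sum_distrib_left mult.assoc mult.commute mult.left_commute)
    also have "\<dots> = (\<Sum>k\<in>UNIV. \<Sum>i\<in>UNIV. \<Sum>j\<in>UNIV. \<Sum>l\<in>UNIV. v $ i * v $ j * (?C k j l * ?C l i k))"
      by (rule sum.cong[OF refl], rule rot)
    also have "\<dots> = (\<Sum>i\<in>UNIV. \<Sum>j\<in>UNIV. \<Sum>k\<in>UNIV. \<Sum>l\<in>UNIV. v $ i * v $ j * (?C k j l * ?C l i k))"
      by (rule rot[symmetric])
    finally show ?thesis by (simp add: sum_distrib_left)
  qed
  have "ric \<Gamma> u v = (\<Sum>k\<in>UNIV. fd (\<lambda>p. \<Gamma> p v v) u (axis k 1) $ k) - (\<Sum>k\<in>UNIV. fd (\<lambda>p. \<Gamma> p (axis k 1) v) u v $ k)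
     + (\<Sum>k\<in>UNIV. \<Gamma> u (axis k 1) (\<Gamma> u v v) $ k) - (\<Sum>k\<in>UNIV. \<Gamma> u v (\<Gamma> u (axis k 1) v) $ k)"
    by (simp add: ric_def tr_def curv_def sum.distrib sum_subtractf)
  also have "\<dots> = (\<Sum>i\<in>UNIV. \<Sum>j\<in>UNIV. v $ i * v $ j * ricci A g c i j u)"
    unfolding 1 2 3 4
    by (simp add: ricci_def Let_def right_diff_distrib distrib_left sum.distrib sum_subtractf)
  finally show ?thesis ..
qed

end

section \<open>Charts and tangent vectors\<close>

lemma smooth_atlasD:
  assumes "smooth_atlas A" "c \<in> A"
  shows "open (cdom c)" "open (cimg c)" "homeomorphism (cdom c) (cimg c) (cmap c) (cinv c)"
  using assms by (auto simp: smooth_atlas_def)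

lemma chart_exists:
  fixes A :: "('m::{t2_space, second_countable_topology}, 'n::finite) chart set"
  assumes "smooth_atlas A" obtains c where "c \<in> A" "x \<in> cdom c"
proof -
  have "x \<in> (\<Union>c\<in>A. cdom c)" using assms unfolding smooth_atlas_def by blast
  then show ?thesis using that by blast
qed

lemma chart_at:
  assumes "smooth_atlas A" shows "chart_at A x \<in> A" "x \<in> cdom (chart_at A x)"
proof -
  obtain c where "c \<in> A \<and> x \<in> cdom c" by (rule chart_exists[OF assms, of x]) blast
  then have "chart_at A x \<in> A \<and> x \<in> cdom (chart_at A x)" unfolding chart_at_def by (rule someI)
  then show "chart_at A x \<in> A" "x \<in> cdom (chart_at A x)" by simp_all
qed

lemma cinv_cmap: "smooth_atlas A \<Longrightarrow> c \<in> A \<Longrightarrow> x \<in> cdom c \<Longrightarrow> cinv c (cmap c x) = x"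
  by (rule homeomorphism_apply1[OF smooth_atlasD(3)])

lemma open_chart_image:
  assumes "smooth_atlas A" "c \<in> A" "open W"
  shows "open (cmap c ` (W \<inter> cdom c))"
proof -
  note h = smooth_atlasD[OF assms(1,2)]
  have "openin (top_of_set (cdom c)) (W \<inter> cdom c)" using assms(3) by (auto simp: openin_open)
  then have "openin (top_of_set (cimg c)) (cmap c ` (W \<inter> cdom c))"
    by (rule homeomorphism_imp_open_map[OF h(3)])
  then show ?thesis by (rule openin_open_trans[OF _ h(2)])
qed

text \<open>With the identity as a smooth map, the lemmas on changes of charts also cover the
  transition maps and their cocycle property.\<close>

lemma smooth_map_transition:
  assumes "smooth_atlas A" shows "smooth_map A A UNIV (\<lambda>x. x)"
proof -
  have "cmap d \<circ> (\<lambda>x. x) \<circ> cinv c = cmap d \<circ> cinv c" "UNIV \<inter> cdom c \<inter> (\<lambda>x. x) -` cdom d = cdom c \<inter> cdom d"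
    for c d :: "('a, 'b) chart" by auto
  then show ?thesis using assms by (simp add: smooth_map_def smooth_atlas_def)
qed

lemma smooth_map_coords:
  assumes "smooth_atlas A" "smooth_atlas B" "open U" "smooth_map A B U f" "c \<in> A" "d \<in> B"
  shows "open (cmap c ` (U \<inter> cdom c \<inter> f -` cdom d))"
    "smooth_on (cmap d \<circ> f \<circ> cinv c) (cmap c ` (U \<inter> cdom c \<inter> f -` cdom d))"
proof -
  have "continuous_on U f" using assms(4) unfolding smooth_map_def by blast
  then have "open (U \<inter> f -` cdom d)"
    by (rule continuous_open_preimage[OF _ assms(3) smooth_atlasD(1)[OF assms(2,6)]])
  from open_chart_image[OF assms(1,5) this] show "open (cmap c ` (U \<inter> cdom c \<inter> f -` cdom d))"
    by (simp add: Int_ac)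
  show "smooth_on (cmap d \<circ> f \<circ> cinv c) (cmap c ` (U \<inter> cdom c \<inter> f -` cdom d))"
    using assms unfolding smooth_map_def by blast
qed

lemma smooth_map_has_derivative:
  assumes "smooth_atlas A" "smooth_atlas B" "open U" "smooth_map A B U f" "c \<in> A" "d \<in> B"
    and "x \<in> U" "x \<in> cdom c" "f x \<in> cdom d"
  shows "((cmap d \<circ> f \<circ> cinv c) has_derivative fd (cmap d \<circ> f \<circ> cinv c) (cmap c x)) (at (cmap c x))"
  by (rule smooth_on_has_derivative[OF smooth_map_coords(2)[OF assms(1-6)]]) (use assms in auto)

lemma transition_has_derivative:
  assumes A: "smooth_atlas A" "c \<in> A" "d \<in> A" "x \<in> cdom c" "x \<in> cdom d"
  shows "((cmap d \<circ> cinv c) has_derivative fd (cmap d \<circ> cinv c) (cmap c x)) (at (cmap c x))"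
proof -
  have "smooth_on (cmap d \<circ> cinv c) (cmap c ` (cdom c \<inter> cdom d))"
    using A by (auto simp: smooth_atlas_def)
  then show ?thesis using A by (intro smooth_on_has_derivative) auto
qed

text \<open>Chain rule. Together with the lemma on the target chart it frees
  \<open>differential\<close> from the arbitrary choice of \<open>chart_at\<close> and shows that
  its values are tangent vectors.\<close>

lemma fd_chart_change_source:
  assumes A: "smooth_atlas A" "smooth_atlas B" "open U" "smooth_map A B U f"
    and c: "c \<in> A" "x \<in> cdom c" "c' \<in> A" "x \<in> cdom c'" and d: "d \<in> B" "f x \<in> cdom d" and x: "x \<in> U"
  shows "fd (cmap d \<circ> f \<circ> cinv c') (cmap c' x) (fd (cmap c' \<circ> cinv c) (cmap c x) a)
     = fd (cmap d \<circ> f \<circ> cinv c) (cmap c x) a"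
proof -
  let ?S = "cmap c ` ((U \<inter> cdom c') \<inter> cdom c)"
  have S: "open ?S" "cmap c x \<in> ?S"
    using A c x smooth_atlasD(1)[OF A(1) c(3)] by (auto intro!: open_chart_image)
  have e: "(cmap c' \<circ> cinv c) (cmap c x) = cmap c' x" using A c by (simp add: cinv_cmap)
  have 1: "((cmap d \<circ> f \<circ> cinv c') has_derivative fd (cmap d \<circ> f \<circ> cinv c') (cmap c' x))
     (at ((cmap c' \<circ> cinv c) (cmap c x)))"
    unfolding e by (rule smooth_map_has_derivative[OF A]) (use assms in auto)
  have "((\<lambda>u. (cmap d \<circ> f \<circ> cinv c') ((cmap c' \<circ> cinv c) u)) has_derivative
      (\<lambda>a. fd (cmap d \<circ> f \<circ> cinv c') (cmap c' x) (fd (cmap c' \<circ> cinv c) (cmap c x) a))) (at (cmap c x))"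
    by (rule has_derivative_compose[OF transition_has_derivative[OF A(1) c(1,3,2,4)] 1])
  then have "((cmap d \<circ> f \<circ> cinv c) has_derivative
      (\<lambda>a. fd (cmap d \<circ> f \<circ> cinv c') (cmap c' x) (fd (cmap c' \<circ> cinv c) (cmap c x) a))) (at (cmap c x))"
    by (rule has_derivative_transform_within_open[OF _ S]) (auto simp: cinv_cmap[OF A(1)] c)
  from fd_eq[OF this] show ?thesis by simp
qed

lemma fd_chart_change_target:
  assumes A: "smooth_atlas A" "smooth_atlas B" "open U" "smooth_map A B U f"
    and c: "c \<in> A" "x \<in> cdom c" and d: "d \<in> B" "f x \<in> cdom d" "d' \<in> B" "f x \<in> cdom d'" and x: "x \<in> U"
  shows "fd (cmap d' \<circ> cinv d) (cmap d (f x)) (fd (cmap d \<circ> f \<circ> cinv c) (cmap c x) a)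
     = fd (cmap d' \<circ> f \<circ> cinv c) (cmap c x) a"
proof -
  let ?S = "cmap c ` (U \<inter> cdom c \<inter> f -` cdom d)"
  have S: "open ?S" "cmap c x \<in> ?S"
    using smooth_map_coords(1)[OF A c(1) d(1)] c d x by auto
  have e: "(cmap d \<circ> f \<circ> cinv c) (cmap c x) = cmap d (f x)" using A c by (simp add: cinv_cmap)
  have 1: "((cmap d' \<circ> cinv d) has_derivative fd (cmap d' \<circ> cinv d) (cmap d (f x)))
     (at ((cmap d \<circ> f \<circ> cinv c) (cmap c x)))"
    unfolding e by (rule transition_has_derivative[OF A(2) d(1,3,2,4)])
  have "((\<lambda>u. (cmap d' \<circ> cinv d) ((cmap d \<circ> f \<circ> cinv c) u)) has_derivative
      (\<lambda>a. fd (cmap d' \<circ> cinv d) (cmap d (f x)) (fd (cmap d \<circ> f \<circ> cinv c) (cmap c x) a))) (at (cmap c x))"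
    by (rule has_derivative_compose[OF smooth_map_has_derivative[OF A c(1) d(1) x c(2) d(2)] 1])
  then have "((cmap d' \<circ> f \<circ> cinv c) has_derivative
      (\<lambda>a. fd (cmap d' \<circ> cinv d) (cmap d (f x)) (fd (cmap d \<circ> f \<circ> cinv c) (cmap c x) a))) (at (cmap c x))"
    by (rule has_derivative_transform_within_open[OF _ S]) (auto simp: cinv_cmap[OF A(1)] cinv_cmap[OF A(2)] c d)
  from fd_eq[OF this] show ?thesis by simp
qed

lemma fd_transition_self:
  assumes A: "smooth_atlas A" "c \<in> A" "x \<in> cdom c"
  shows "fd (cmap c \<circ> cinv c) (cmap c x) a = a"
proof -
  have "fd (cmap c \<circ> cinv c) (cmap c x) = fd (\<lambda>u. u) (cmap c x)"
    by (rule fd_cong_open[of "cimg c"]) (use A smooth_atlasD(2)[OF A(1,2)] in \<open>auto simp: cinv_cmap\<close>)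
  also have "fd (\<lambda>u. u) (cmap c x) = (\<lambda>a. a)" by (rule fd_eq) (rule has_derivative_ident)
  finally show ?thesis by simp
qed

lemma tangent_space_chart:
  "v \<in> tangent_space A x \<Longrightarrow> c \<in> A \<Longrightarrow> d \<in> A \<Longrightarrow> x \<in> cdom c \<Longrightarrow> x \<in> cdom d \<Longrightarrow>
    v d = fd (cmap d \<circ> cinv c) (cmap c x) (v c)"
  unfolding tangent_space_def by blast

lemma tangent_space_off: "v \<in> tangent_space A x \<Longrightarrow> c \<notin> A \<or> x \<notin> cdom c \<Longrightarrow> v c = 0"
  unfolding tangent_space_def by blast

lemma tangent_spaceI:
  assumes "\<And>c d. c \<in> A \<Longrightarrow> d \<in> A \<Longrightarrow> x \<in> cdom c \<Longrightarrow> x \<in> cdom d \<Longrightarrow> v d = fd (cmap d \<circ> cinv c) (cmap c x) (v c)"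
    and "\<And>c. c \<notin> A \<or> x \<notin> cdom c \<Longrightarrow> v c = 0"
  shows "v \<in> tangent_space A x"
  using assms unfolding tangent_space_def by blast

text \<open>The Jacobians carry the components from one chart to all charts around the point, and
  the remaining entries are 0 by convention.\<close>

lemma tangent_space_eqI:
  assumes "v \<in> tangent_space A x" "w \<in> tangent_space A x" "c \<in> A" "x \<in> cdom c" "v c = w c"
  shows "v = w"
proof
  fix d show "v d = w d"
  proof (cases "d \<in> A \<and> x \<in> cdom d")
    case True
    then show ?thesis using tangent_space_chart[OF assms(1,3), of d] tangent_space_chart[OF assms(2,3), of d] assms by simp
  next
    case False
    then show ?thesis using tangent_space_off[OF assms(1), of d] tangent_space_off[OF assms(2), of d] by simp
  qed
qed

lemma differential_chart:
  assumes A: "smooth_atlas A" "smooth_atlas B" "open U" "smooth_map A B U f" and x: "x \<in> U"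
    and c: "c \<in> A" "x \<in> cdom c" and d: "d \<in> B" "f x \<in> cdom d" and v: "v \<in> tangent_space A x"
  shows "differential A B f x v d = fd (cmap d \<circ> f \<circ> cinv c) (cmap c x) (v c)"
proof -
  note ca = chart_at[OF A(1), of x]
  have "differential A B f x v d = fd (cmap d \<circ> f \<circ> cinv (chart_at A x)) (cmap (chart_at A x) x) (v (chart_at A x))"
    using d by (simp add: differential_def Let_def)
  also have "\<dots> = fd (cmap d \<circ> f \<circ> cinv c) (cmap c x) (v c)"
    unfolding tangent_space_chart[OF v c(1) ca(1) c(2) ca(2)]
    by (rule fd_chart_change_source[OF A c ca d x])
  finally show ?thesis .
qed

lemma differential_tangent:
  assumes A: "smooth_atlas A" "smooth_atlas B" "open U" "smooth_map A B U f" and x: "x \<in> U"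
    and v: "v \<in> tangent_space A x"
  shows "differential A B f x v \<in> tangent_space B (f x)"
proof (rule tangent_spaceI)
  note ca = chart_at[OF A(1), of x]
  fix d d' assume d: "d \<in> B" "d' \<in> B" "f x \<in> cdom d" "f x \<in> cdom d'"
  show "differential A B f x v d' = fd (cmap d' \<circ> cinv d) (cmap d (f x)) (differential A B f x v d)"
    unfolding differential_chart[OF A x ca d(1,3) v] differential_chart[OF A x ca d(2,4) v]
    using fd_chart_change_target[OF A ca d(1,3,2,4) x] by simp
qed (auto simp: differential_def Let_def)

lemma tvec_of_tangent:
  assumes A: "smooth_atlas A" and c: "c \<in> A" "x \<in> cdom c"
  shows "tvec_of A c x a \<in> tangent_space A x" "tvec_of A c x a c = a"
proof -
  show "tvec_of A c x a c = a" using fd_transition_self[OF A c] c by (simp add: tvec_of_def)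
  have comp: "fd (cmap d' \<circ> cinv d) (cmap d x) (fd (cmap d \<circ> cinv c) (cmap c x) a) = fd (cmap d' \<circ> cinv c) (cmap c x) a"
    if "d \<in> A" "x \<in> cdom d" "d' \<in> A" "x \<in> cdom d'" for d d'
    using fd_chart_change_target[OF A A open_UNIV smooth_map_transition[OF A] c that] by (simp add: comp_def)
  show "tvec_of A c x a \<in> tangent_space A x"
    by (rule tangent_spaceI) (auto simp: tvec_of_def comp)
qed

lemma tangent_space_linear:
  assumes A: "smooth_atlas A" and v: "v \<in> tangent_space A x" "w \<in> tangent_space A x"
  shows "(\<lambda>c. r *\<^sub>R v c + s *\<^sub>R w c) \<in> tangent_space A x"
proof -
  have "r *\<^sub>R v d + s *\<^sub>R w d = fd (cmap d \<circ> cinv c) (cmap c x) (r *\<^sub>R v c + s *\<^sub>R w c)"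
    if c: "c \<in> A" "d \<in> A" "x \<in> cdom c" "x \<in> cdom d" for c d
  proof -
    have "linear (fd (cmap d \<circ> cinv c) (cmap c x))"
      using transition_has_derivative[OF A c] has_derivative_linear by blast
    then show ?thesis
      by (simp add: linear_add linear_scale tangent_space_chart[OF v(1) c] tangent_space_chart[OF v(2) c])
  qed
  moreover have "r *\<^sub>R v c + s *\<^sub>R w c = 0" if "c \<notin> A \<or> x \<notin> cdom c" for c
    by (simp add: tangent_space_off[OF v(1) that] tangent_space_off[OF v(2) that])
  ultimately show ?thesis by (rule tangent_spaceI)
qed

lemma tangent_space_scale:
  assumes A: "smooth_atlas A" and v: "v \<in> tangent_space A x"
  shows "(\<lambda>c. r *\<^sub>R v c) \<in> tangent_space A x"
  using tangent_space_linear[OF A v v, of r 0] by simp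

lemma zero_tangent_space: "smooth_atlas A \<Longrightarrow> zero_tvec \<in> tangent_space A x"
  using tangent_space_scale[OF _ tvec_of_tangent(1)[OF _ chart_at], where r = 0] by simp

lemma tangent_nonzero_chart:
  assumes "smooth_atlas A" "v \<in> tangent_space A x" "c \<in> A" "x \<in> cdom c"
  shows "v = zero_tvec \<longleftrightarrow> v c = 0"
  using tangent_space_eqI[OF assms(2) zero_tangent_space[OF assms(1)] assms(3,4)] by auto

lemma metric_chart_eq:
  "smooth_sym_tensor A g \<Longrightarrow> v \<in> tangent_space A x \<Longrightarrow> w \<in> tangent_space A x \<Longrightarrow> c \<in> A \<Longrightarrow> x \<in> cdom c \<Longrightarrow>
    g x v w = v c \<bullet> (metric_matrix A g c (cmap c x) *v w c)"
  unfolding smooth_sym_tensor_def by blast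

lemma metric_sym:
  "smooth_sym_tensor A g \<Longrightarrow> v \<in> tangent_space A x \<Longrightarrow> w \<in> tangent_space A x \<Longrightarrow> g x v w = g x w v"
  unfolding smooth_sym_tensor_def by blast

lemma metric_matrix_sym:
  assumes A: "smooth_atlas A" "smooth_sym_tensor A g" and c: "c \<in> A" "x \<in> cdom c"
  shows "transpose (metric_matrix A g c (cmap c x)) = metric_matrix A g c (cmap c x)"
proof -
  have "g x (tvec_of A c x a) (tvec_of A c x b) = g x (tvec_of A c x b) (tvec_of A c x a)" for a b
    by (rule metric_sym[OF A(2) tvec_of_tangent(1)[OF A(1) c] tvec_of_tangent(1)[OF A(1) c]])
  then show ?thesis
    unfolding transpose_def metric_matrix_def cinv_cmap[OF A(1) c] vec_eq_iff vec_lambda_beta by blast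
qed

lemma lorentz_signature_invertible:
  assumes "lorentz_signature (G :: real^'n::finite^'n)" shows "invertible G"
proof -
  obtain P :: "real^'n^'n" and k where P: "invertible P"
    "transpose P ** G ** P = (\<chi> i j. if i = j then (if i = k then - 1 else 1) else 0)"
    using assms unfolding lorentz_signature_def by blast
  have "det (transpose P ** G ** P) = (\<Prod>i\<in>UNIV. if i = k then - 1 else 1)"
    unfolding P(2) by (subst det_diagonal) auto
  also have "\<dots> \<noteq> 0" by (simp add: prod_zero_iff)
  finally show ?thesis unfolding det_mul invertible_det_nz by simp
qed

lemma metric_chartI:
  assumes A: "smooth_atlas A" "lorentzian_metric A g" and c: "c \<in> A"
  shows "metric_chart A g c (metric_matrix A g c) (cimg c)"
proof
  show "open (cimg c)" using smooth_atlasD(2)[OF A(1) c] .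
  show "smooth_on (metric_matrix A g c) (cimg c)"
    using A c by (auto simp: lorentzian_metric_def smooth_sym_tensor_def)
  show "transpose (metric_matrix A g c u) = metric_matrix A g c u" if "u \<in> cimg c" for u
    using metric_matrix_sym[OF A(1) _ c] A(2) that by (auto simp: lorentzian_metric_def)
  show "invertible (metric_matrix A g c u)" if "u \<in> cimg c" for u
    using A(2) c that by (auto simp: lorentzian_metric_def intro: lorentz_signature_invertible)
qed simp

section \<open>Lorentzian metrics and curves\<close>

lemma bounded_bilinear_matrix_vector_mult:
  "bounded_bilinear (\<lambda>(M::real^'n::finite^'m::finite) v. M *v v)"
  by (rule bilinear_conv_bounded_bilinear[THEN iffD1])
    (auto simp: bilinear_def matrix_vector_mult_add_rdistrib matrix_vector_right_distrib
      matrix_vector_mult_scaleR scaleR_matrix_vector_assoc[symmetric] intro!: linearI)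

text \<open>The Minkowski product is written as the Euclidean one minus twice its time part, so that
  the Euclidean Cauchy-Schwarz inequality can be applied to spatial parts.\<close>

lemma lorentz_signature_form:
  fixes G :: "real^'n::finite^'n"
  assumes "lorentz_signature G"
  obtains P :: "real^'n^'n" and k where "invertible P"
    "\<And>x y. (P *v x) \<bullet> (G *v (P *v y)) = x \<bullet> y - 2 * (x $ k * y $ k)"
proof -
  obtain P :: "real^'n^'n" and k where P: "invertible P"
    "transpose P ** G ** P = (\<chi> i j. if i = j then (if i = k then - 1 else 1) else 0)"
    using assms unfolding lorentz_signature_def by blast
  have J: "(transpose P ** G ** P) *v y = (\<chi> i. if i = k then - y $ i else y $ i)" for y :: "real^'n"
    unfolding P(2) by (simp add: vec_eq_iff matrix_vector_mult_def if_distrib[of "\<lambda>x. x * _"] cong: if_cong)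
  have "(P *v x) \<bullet> (G *v (P *v y)) = x \<bullet> y - 2 * (x $ k * y $ k)" for x y :: "real^'n"
  proof -
    have "(P *v x) \<bullet> (G *v (P *v y)) = x \<bullet> ((transpose P ** G ** P) *v y)"
      by (metis dot_lmul_matrix matrix_vector_mul_assoc matrix_mul_assoc vector_transpose_matrix transpose_transpose)
    also have "\<dots> = (\<Sum>i\<in>UNIV. x $ i * y $ i - (if i = k then 2 * (x $ k * y $ k) else 0))"
      unfolding J inner_vec_def by (intro sum.cong) auto
    also have "\<dots> = x \<bullet> y - 2 * (x $ k * y $ k)"
      by (simp add: sum_subtractf inner_vec_def)
    finally show ?thesis .
  qed
  with P(1) show ?thesis by (rule that)
qed

text \<open>Let \<open>a'\<close>, \<open>b'\<close> be the spatial parts. Orthogonality equates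
  their product with the product of the time components, yet \<open>a'\<close> is strictly shorter
  than its time component and \<open>b'\<close> is at most as long. Cauchy-Schwarz then forces the
  time component of \<open>v\<close> to be 0, and with it \<open>v\<close>. All later arguments by
  constancy of sign rest on this.\<close>

lemma lorentz_signature_orthogonal:
  fixes G :: "real^'n::finite^'n"
  assumes G: "lorentz_signature G" and t: "t \<bullet> (G *v t) < 0" and v: "v \<bullet> (G *v v) \<le> 0" "v \<noteq> 0"
  shows "t \<bullet> (G *v v) \<noteq> 0"
proof
  assume o: "t \<bullet> (G *v v) = 0"
  obtain P :: "real^'n^'n" and k where P: "invertible P"
    and form: "\<And>x y. (P *v x) \<bullet> (G *v (P *v y)) = x \<bullet> y - 2 * (x $ k * y $ k)"
    using lorentz_signature_form[OF G] by blast
  define a where "a = matrix_inv P *v t"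
  define b where "b = matrix_inv P *v v"
  have ab: "t = P *v a" "v = P *v b"
    by (simp_all add: a_def b_def matrix_vector_mul_assoc matrix_inv_mult(1)[OF P])
  define a' where "a' = a - a $ k *\<^sub>R axis k 1"
  define b' where "b' = b - b $ k *\<^sub>R axis k 1"
  have 1: "a' \<bullet> a' = a \<bullet> a - a $ k * a $ k" "b' \<bullet> b' = b \<bullet> b - b $ k * b $ k" "a' \<bullet> b' = a \<bullet> b - a $ k * b $ k"
    by (simp_all add: a'_def b'_def inner_diff_left inner_diff_right inner_axis inner_axis' inner_axis_axis algebra_simps)
  have 2: "a' \<bullet> a' < a $ k * a $ k" "b' \<bullet> b' \<le> b $ k * b $ k" "a' \<bullet> b' = a $ k * b $ k"
    using t v(1) o unfolding ab form 1 by simp_all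
  have "(a $ k * b $ k)\<^sup>2 \<le> (a' \<bullet> a') * (b' \<bullet> b')"
    using Cauchy_Schwarz_ineq[of a' b'] 2(3) by simp
  also have "\<dots> \<le> (a' \<bullet> a') * (b $ k * b $ k)"
    using 2(2) by (intro mult_left_mono) auto
  finally have 3: "(a $ k * a $ k) * (b $ k * b $ k) \<le> (a' \<bullet> a') * (b $ k * b $ k)"
    by (simp add: power2_eq_square algebra_simps)
  have "b $ k = 0"
  proof (rule ccontr)
    assume "b $ k \<noteq> 0"
    then have "0 < b $ k * b $ k" by (metis not_real_square_gt_zero)
    then show False using 3 2(1) by (simp add: mult_le_cancel_right)
  qed
  then have "b' \<bullet> b' \<le> 0" "b' = b" using 2(2) by (auto simp: b'_def)
  then have "b = 0" by (metis inner_ge_zero inner_eq_zero_iff antisym)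
  then show False using ab v(2) by simp
qed

text \<open>The parameter space is left general: it is an interval for curves, but the open set
  \<open>U1\<close>, with the identity or \<Phi> as the base map, when the time orientation of
  \<Phi> is studied.\<close>

definition cont_field ::
    "('m::topological_space, 'n::finite) chart set \<Rightarrow> 'a::t2_space set \<Rightarrow> ('a \<Rightarrow> 'm) \<Rightarrow> ('a \<Rightarrow> ('m, 'n) tvec) \<Rightarrow> bool" where
  "cont_field A I \<gamma> W \<longleftrightarrow> (\<forall>t\<in>I. W t \<in> tangent_space A (\<gamma> t) \<and>
     (\<forall>c\<in>A. \<gamma> t \<in> cdom c \<longrightarrow> continuous (at t within I) (\<lambda>s. W s c)))"

lemma cont_fieldD:
  "cont_field A I \<gamma> W \<Longrightarrow> t \<in> I \<Longrightarrow> W t \<in> tangent_space A (\<gamma> t)"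
  "cont_field A I \<gamma> W \<Longrightarrow> t \<in> I \<Longrightarrow> c \<in> A \<Longrightarrow> \<gamma> t \<in> cdom c \<Longrightarrow> ((\<lambda>s. W s c) \<longlongrightarrow> W t c) (at t within I)"
  unfolding cont_field_def continuous_within by blast+

lemma eventually_curve_in:
  fixes \<gamma> :: "'a::t2_space \<Rightarrow> 'm::topological_space"
  assumes "continuous_on I \<gamma>" "t \<in> I" "open W" "\<gamma> t \<in> W"
  shows "\<forall>\<^sub>F s in at t within I. s \<in> I \<and> \<gamma> s \<in> W"
proof -
  have "(\<gamma> \<longlongrightarrow> \<gamma> t) (at t within I)" using assms by (auto simp: continuous_on_def)
  then have "\<forall>\<^sub>F s in at t within I. \<gamma> s \<in> W" using assms(3,4) by (rule topological_tendstoD)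
  moreover have "\<forall>\<^sub>F s in at t within I. s \<in> I" by (simp add: eventually_at_filter)
  ultimately show ?thesis by eventually_elim simp
qed

lemma cmap_curve_tendsto:
  fixes \<gamma> :: "'a::t2_space \<Rightarrow> 'm::{t2_space, second_countable_topology}"
  assumes A: "smooth_atlas A" "c \<in> A" and g: "continuous_on I \<gamma>" "t \<in> I" "\<gamma> t \<in> cdom c"
  shows "((\<lambda>s. cmap c (\<gamma> s)) \<longlongrightarrow> cmap c (\<gamma> t)) (at t within I)"
proof -
  have "continuous_on (cdom c) (cmap c)" using smooth_atlasD(3)[OF A] homeomorphism_cont1 by blast
  then have "isCont (cmap c) (\<gamma> t)"
    using smooth_atlasD(1)[OF A] g(3) continuous_on_eq_continuous_at by blast
  moreover have "(\<gamma> \<longlongrightarrow> \<gamma> t) (at t within I)" using g by (auto simp: continuous_on_def)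
  ultimately show ?thesis by (rule isCont_tendsto_compose)
qed

lemma metric_cont_field:
  fixes \<gamma> :: "'a::t2_space \<Rightarrow> 'm::{t2_space, second_countable_topology}"
  assumes A: "smooth_atlas A" "smooth_sym_tensor A g" and \<gamma>: "continuous_on I \<gamma>"
    and V: "cont_field A I \<gamma> V" and W: "cont_field A I \<gamma> W"
  shows "continuous_on I (\<lambda>s. g (\<gamma> s) (V s) (W s))"
  unfolding continuous_on_def
proof
  fix t assume t: "t \<in> I"
  obtain c where c: "c \<in> A" "\<gamma> t \<in> cdom c" by (rule chart_exists[OF A(1)])
  let ?G = "metric_matrix A g c"
  have G: "continuous_on (cimg c) ?G"
    using A(2) c(1) smooth_on_continuous unfolding smooth_sym_tensor_def by blast
  then have "isCont ?G (cmap c (\<gamma> t))"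
    using smooth_atlasD(2)[OF A(1) c(1)] c(2) continuous_on_eq_continuous_at by blast
  then have 1: "((\<lambda>s. ?G (cmap c (\<gamma> s))) \<longlongrightarrow> ?G (cmap c (\<gamma> t))) (at t within I)"
    by (rule isCont_tendsto_compose) (rule cmap_curve_tendsto[OF A(1) c(1) \<gamma> t c(2)])
  have e: "\<forall>\<^sub>F s in at t within I. V s c \<bullet> (?G (cmap c (\<gamma> s)) *v W s c) = g (\<gamma> s) (V s) (W s)"
    using eventually_curve_in[OF \<gamma> t smooth_atlasD(1)[OF A(1) c(1)] c(2)]
    by eventually_elim (use metric_chart_eq[OF A(2) cont_fieldD(1)[OF V] cont_fieldD(1)[OF W] c(1)] in auto)
  have "((\<lambda>s. V s c \<bullet> (?G (cmap c (\<gamma> s)) *v W s c)) \<longlongrightarrow> V t c \<bullet> (?G (cmap c (\<gamma> t)) *v W t c)) (at t within I)"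
    by (intro tendsto_inner bounded_bilinear.tendsto[OF bounded_bilinear_matrix_vector_mult] 1
      cont_fieldD(2)[OF V t c] cont_fieldD(2)[OF W t c])
  from Lim_transform_eventually[OF this e]
  show "((\<lambda>s. g (\<gamma> s) (V s) (W s)) \<longlongrightarrow> g (\<gamma> t) (V t) (W t)) (at t within I)"
    using metric_chart_eq[OF A(2) cont_fieldD(1)[OF V t] cont_fieldD(1)[OF W t] c] by simp
qed

lemma cont_field_differential:
  fixes \<gamma> :: "'a::t2_space \<Rightarrow> 'm::{t2_space, second_countable_topology}"
    and f :: "'m \<Rightarrow> 'k::{t2_space, second_countable_topology}"
  assumes A: "smooth_atlas A" "smooth_atlas B" "open U" "smooth_map A B U f" and \<gamma>: "continuous_on I \<gamma>"
    and U: "\<gamma> ` I \<subseteq> U" and W: "cont_field A I \<gamma> W"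
  shows "cont_field B I (f \<circ> \<gamma>) (\<lambda>s. differential A B f (\<gamma> s) (W s))"
  unfolding cont_field_def continuous_within
proof (intro ballI conjI impI)
  fix t assume t: "t \<in> I"
  have tU: "\<gamma> t \<in> U" using t U by blast
  show "differential A B f (\<gamma> t) (W t) \<in> tangent_space B ((f \<circ> \<gamma>) t)"
    using differential_tangent[OF A tU cont_fieldD(1)[OF W t]] by simp
  fix d assume d: "d \<in> B" "(f \<circ> \<gamma>) t \<in> cdom d"
  obtain c where c: "c \<in> A" "\<gamma> t \<in> cdom c" by (rule chart_exists[OF A(1)])
  let ?S = "cmap c ` (U \<inter> cdom c \<inter> f -` cdom d)" and ?F = "cmap d \<circ> f \<circ> cinv c"
  note S = smooth_map_coords[OF A c(1) d(1)]
  have fc: "continuous_on U f" using A(4) unfolding smooth_map_def by blast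
  have W': "open (U \<inter> cdom c \<inter> f -` cdom d)"
  proof -
    have "open (U \<inter> f -` cdom d)"
      by (rule continuous_open_preimage[OF fc A(3) smooth_atlasD(1)[OF A(2) d(1)]])
    moreover have "U \<inter> cdom c \<inter> f -` cdom d = (U \<inter> f -` cdom d) \<inter> cdom c" by blast
    ultimately show ?thesis using smooth_atlasD(1)[OF A(1) c(1)] by (simp add: open_Int)
  qed
  have ev: "\<forall>\<^sub>F s in at t within I. s \<in> I \<and> \<gamma> s \<in> U \<inter> cdom c \<inter> f -` cdom d"
    by (rule eventually_curve_in[OF \<gamma> t W']) (use tU c d in auto)
  have u: "cmap c (\<gamma> t) \<in> ?S" using tU c d by auto
  have lin: "linear (fd ?F p)" if "p \<in> ?S" for p
    using smooth_on_has_derivative[OF S(2) that] has_derivative_linear by blast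
  have "((\<lambda>s. fd ?F (cmap c (\<gamma> s)) (W s c)) \<longlongrightarrow> fd ?F (cmap c (\<gamma> t)) (W t c)) (at t within I)"
  proof (rule tendsto_linear_field[where F = "\<lambda>s. fd ?F (cmap c (\<gamma> s))" and L = "fd ?F (cmap c (\<gamma> t))"])
    show "\<forall>\<^sub>F s in at t within I. linear (fd ?F (cmap c (\<gamma> s)))"
      using ev by eventually_elim (rule lin, auto)
    show "linear (fd ?F (cmap c (\<gamma> t)))" by (rule lin[OF u])
    show "((\<lambda>s. W s c) \<longlongrightarrow> W t c) (at t within I)" by (rule cont_fieldD(2)[OF W t c])
    fix a
    have "isCont (\<lambda>p. fd ?F p a) (cmap c (\<gamma> t))"
      using smooth_on_continuous[OF smooth_on_fd[OF S(2)]] S(1) u continuous_on_eq_continuous_at by blast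
    then show "((\<lambda>s. fd ?F (cmap c (\<gamma> s)) a) \<longlongrightarrow> fd ?F (cmap c (\<gamma> t)) a) (at t within I)"
      by (rule isCont_tendsto_compose) (rule cmap_curve_tendsto[OF A(1) c(1) \<gamma> t c(2)])
  qed
  moreover have "\<forall>\<^sub>F s in at t within I. fd ?F (cmap c (\<gamma> s)) (W s c) = differential A B f (\<gamma> s) (W s) d"
    using ev by eventually_elim (use differential_chart[OF A _ c(1) _ d(1) _ cont_fieldD(1)[OF W]] in auto)
  ultimately have "((\<lambda>s. differential A B f (\<gamma> s) (W s) d) \<longlongrightarrow> fd ?F (cmap c (\<gamma> t)) (W t c)) (at t within I)"
    by (rule Lim_transform_eventually)
  then show "((\<lambda>s. differential A B f (\<gamma> s) (W s) d) \<longlongrightarrow> differential A B f (\<gamma> t) (W t) d) (at t within I)"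
    using differential_chart[OF A tU c d(1) _ cont_fieldD(1)[OF W t]] d by simp
qed

section \<open>Curves and geodesics under maps and reparametrization\<close>

lemma C1_curve_cont_field: "C1_curve A I \<gamma> V \<Longrightarrow> cont_field A I \<gamma> V"
  unfolding C1_curve_def cont_field_def by blast

lemma C1_curve_continuous: "C1_curve A I \<gamma> V \<Longrightarrow> continuous_on I \<gamma>"
  unfolding C1_curve_def by blast

lemma C1_curve_tangent: "C1_curve A I \<gamma> V \<Longrightarrow> t \<in> I \<Longrightarrow> V t \<in> tangent_space A (\<gamma> t)"
  unfolding C1_curve_def by blast

lemma C1_curve_deriv:
  "C1_curve A I \<gamma> V \<Longrightarrow> t \<in> I \<Longrightarrow> c \<in> A \<Longrightarrow> \<gamma> t \<in> cdom c \<Longrightarrow>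
    ((\<lambda>s. cmap c (\<gamma> s)) has_vector_derivative V t c) (at t within I)"
  unfolding C1_curve_def by blast

lemma C1_curveI:
  assumes "continuous_on I \<gamma>" "cont_field A I \<gamma> V"
    "\<And>t c. t \<in> I \<Longrightarrow> c \<in> A \<Longrightarrow> \<gamma> t \<in> cdom c \<Longrightarrow> ((\<lambda>s. cmap c (\<gamma> s)) has_vector_derivative V t c) (at t within I)"
  shows "C1_curve A I \<gamma> V"
  using assms unfolding C1_curve_def cont_field_def by blast

lemma C1_curve_image:
  fixes \<gamma> :: "real \<Rightarrow> 'm::{t2_space, second_countable_topology}"
    and f :: "'m \<Rightarrow> 'k::{t2_space, second_countable_topology}"
  assumes A: "smooth_atlas A" "smooth_atlas B" "open U" "smooth_map A B U f"
    and \<gamma>: "C1_curve A I \<gamma> V" and U: "\<gamma> ` I \<subseteq> U"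
  shows "C1_curve B I (f \<circ> \<gamma>) (\<lambda>s. differential A B f (\<gamma> s) (V s))"
proof (rule C1_curveI)
  have fc: "continuous_on U f" using A(4) unfolding smooth_map_def by blast
  show "continuous_on I (f \<circ> \<gamma>)"
    using continuous_on_compose[OF C1_curve_continuous[OF \<gamma>]] continuous_on_subset[OF fc U] by blast
  show "cont_field B I (f \<circ> \<gamma>) (\<lambda>s. differential A B f (\<gamma> s) (V s))"
    by (rule cont_field_differential[OF A C1_curve_continuous[OF \<gamma>] U C1_curve_cont_field[OF \<gamma>]])
  fix t d assume t: "t \<in> I" and d: "d \<in> B" "(f \<circ> \<gamma>) t \<in> cdom d"
  have tU: "\<gamma> t \<in> U" using t U by blast
  obtain c where c: "c \<in> A" "\<gamma> t \<in> cdom c" by (rule chart_exists[OF A(1)])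
  let ?F = "cmap d \<circ> f \<circ> cinv c"
  have d': "f (\<gamma> t) \<in> cdom d" using d by simp
  have "(?F has_derivative fd ?F (cmap c (\<gamma> t))) (at (cmap c (\<gamma> t)))"
    by (rule smooth_map_has_derivative[OF A c(1) d(1) tU c(2) d'])
  from vector_derivative_diff_chain_within[OF C1_curve_deriv[OF \<gamma> t c] has_derivative_at_withinI[OF this]]
  have "(?F \<circ> (\<lambda>s. cmap c (\<gamma> s)) has_vector_derivative fd ?F (cmap c (\<gamma> t)) (V t c)) (at t within I)" .
  moreover have "\<forall>\<^sub>F s in at t within I. (?F \<circ> (\<lambda>s. cmap c (\<gamma> s))) s = cmap d ((f \<circ> \<gamma>) s)"
    using eventually_curve_in[OF C1_curve_continuous[OF \<gamma>] t smooth_atlasD(1)[OF A(1) c(1)] c(2)]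
    by eventually_elim (auto simp: cinv_cmap[OF A(1) c(1)])
  ultimately have "((\<lambda>s. cmap d ((f \<circ> \<gamma>) s)) has_vector_derivative fd ?F (cmap c (\<gamma> t)) (V t c)) (at t within I)"
    unfolding has_vector_derivative_def
    by (rule has_derivative_transform_eventually) (use c t in \<open>auto simp: cinv_cmap[OF A(1)]\<close>)
  then show "((\<lambda>s. cmap d ((f \<circ> \<gamma>) s)) has_vector_derivative differential A B f (\<gamma> t) (V t) d) (at t within I)"
    using differential_chart[OF A tU c d(1) d' C1_curve_tangent[OF \<gamma> t]] by simp
qed

lemma C1_curve_subset: "C1_curve A I \<gamma> V \<Longrightarrow> J \<subseteq> I \<Longrightarrow> C1_curve A J \<gamma> V"
  unfolding C1_curve_def
  by (meson continuous_on_subset continuous_within_subset has_vector_derivative_within_subset subsetD)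

text \<open>The degenerate case \<open>k = 0\<close> is included because
  \<open>sasaki_curve_initial\<close> may stop a curve at its starting point.\<close>

lemma C1_curve_affine:
  fixes \<gamma> :: "real \<Rightarrow> 'm::{t2_space, second_countable_topology}"
  assumes A: "smooth_atlas A" and \<gamma>: "C1_curve A I \<gamma> V" and J: "\<And>s. s \<in> J \<Longrightarrow> a + k * s \<in> I"
  shows "C1_curve A J (\<lambda>s. \<gamma> (a + k * s)) (\<lambda>s c. k *\<^sub>R V (a + k * s) c)"
proof (rule C1_curveI)
  have cl: "continuous_on J (\<lambda>s. a + k * s)" by (intro continuous_intros)
  show "continuous_on J (\<lambda>s. \<gamma> (a + k * s))"
    by (rule continuous_on_compose2[OF C1_curve_continuous[OF \<gamma>] cl]) (use J in auto)
  fix t assume t: "t \<in> J"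
  have l: "((\<lambda>s. a + k * s) has_vector_derivative k) (at t within J)"
    by (auto intro!: derivative_eq_intros simp: has_vector_derivative_def)
  fix c assume c: "c \<in> A" "\<gamma> (a + k * t) \<in> cdom c"
  have "((\<lambda>s. cmap c (\<gamma> s)) has_vector_derivative V (a + k * t) c) (at (a + k * t) within (\<lambda>s. a + k * s) ` J)"
    by (rule has_vector_derivative_within_subset[OF C1_curve_deriv[OF \<gamma> J[OF t] c]]) (use J in auto)
  from vector_diff_chain_within[OF l this]
  show "((\<lambda>s. cmap c (\<gamma> (a + k * s))) has_vector_derivative k *\<^sub>R V (a + k * t) c) (at t within J)"
    by (simp add: comp_def)
next
  show "cont_field A J (\<lambda>s. \<gamma> (a + k * s)) (\<lambda>s c. k *\<^sub>R V (a + k * s) c)"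
    unfolding cont_field_def
  proof (intro ballI conjI impI)
    fix t assume t: "t \<in> J"
    show "(\<lambda>c. k *\<^sub>R V (a + k * t) c) \<in> tangent_space A (\<gamma> (a + k * t))"
      by (rule tangent_space_scale[OF A C1_curve_tangent[OF \<gamma> J[OF t]]])
    fix c assume c: "c \<in> A" "\<gamma> (a + k * t) \<in> cdom c"
    have "continuous (at (a + k * t) within (\<lambda>s. a + k * s) ` J) (\<lambda>s. V s c)"
      by (rule continuous_within_subset[of _ I])
        (use \<gamma> J t c in \<open>auto simp: C1_curve_def\<close>)
    then have "continuous (at t within J) (\<lambda>s. V (a + k * s) c)"
      by (rule continuous_within_compose2[where f = "\<lambda>s. a + k * s" and g = "\<lambda>s. V s c", rotated])
        (intro continuous_intros)
    then show "continuous (at t within J) (\<lambda>s. k *\<^sub>R V (a + k * s) c)"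
      by (rule continuous_scaleR[OF continuous_const])
  qed
qed

lemma geodesic_C1_curve: "geodesic A g I \<gamma> V \<Longrightarrow> C1_curve A I \<gamma> V"
  unfolding geodesic_def by blast

lemma geodesic_velocity_deriv:
  assumes "geodesic A g I \<gamma> V" "t \<in> I" "c \<in> A" "\<gamma> t \<in> cdom c"
  shows "((\<lambda>s. V s c) has_vector_derivative - christoffel_form A g c (cmap c (\<gamma> t)) (V t c) (V t c)) (at t within I)"
proof -
  have "((\<lambda>s. V s c) has_vector_derivative 0 - christoffel_form A g c (cmap c (\<gamma> t)) (V t c) (V t c)) (at t within I)"
    using assms unfolding geodesic_def covariant_derivative_along_def by blast
  then show ?thesis by simp
qed

lemma geodesic_subset:
  assumes "geodesic A g I \<gamma> V" "J \<subseteq> I" shows "geodesic A g J \<gamma> V"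
  unfolding geodesic_def
proof
  show "C1_curve A J \<gamma> V" by (rule C1_curve_subset[OF geodesic_C1_curve[OF assms(1)] assms(2)])
  have "\<forall>t\<in>I. V t \<in> tangent_space A (\<gamma> t) \<and> zero_tvec \<in> tangent_space A (\<gamma> t) \<and>
     (\<forall>c\<in>A. \<gamma> t \<in> cdom c \<longrightarrow> ((\<lambda>s. V s c) has_vector_derivative
        0 - christoffel_form A g c (cmap c (\<gamma> t)) (V t c) (V t c)) (at t within I))"
    using assms(1) unfolding geodesic_def covariant_derivative_along_def by blast
  then show "covariant_derivative_along A g J \<gamma> V V (\<lambda>_. zero_tvec)"
    unfolding covariant_derivative_along_def
    using assms(2) has_vector_derivative_within_subset[OF _ assms(2)] by blast
qed

section \<open>A uniqueness estimate for vanishing velocity\<close>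

lemma bilinear_norm_bound:
  fixes B :: "real^'n::finite \<Rightarrow> real^'n \<Rightarrow> 'b::real_normed_vector"
  assumes "bilinear B"
  shows "norm (B x y) \<le> (\<Sum>i\<in>UNIV. \<Sum>j\<in>UNIV. norm (B (axis i 1) (axis j 1))) * (norm x * norm y)"
proof -
  have l: "linear (\<lambda>x. B x y)" "linear (B x)" for x y using assms unfolding bilinear_def by blast+
  have e: "B (axis i 1) y = (\<Sum>j\<in>UNIV. y $ j *\<^sub>R B (axis i 1) (axis j 1))" for i
    by (rule linear_sum_axis[OF l(2)])
  have "B x y = (\<Sum>i\<in>UNIV. x $ i *\<^sub>R B (axis i 1) y)" by (rule linear_sum_axis[OF l(1)])
  also have "\<dots> = (\<Sum>i\<in>UNIV. x $ i *\<^sub>R (\<Sum>j\<in>UNIV. y $ j *\<^sub>R B (axis i 1) (axis j 1)))"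
    by (simp only: e)
  also have "norm \<dots> \<le> (\<Sum>i\<in>UNIV. norm x * (\<Sum>j\<in>UNIV. norm y * norm (B (axis i 1) (axis j 1))))"
  proof (intro order_trans[OF norm_sum] sum_mono)
    fix i
    have "norm (\<Sum>j\<in>UNIV. y $ j *\<^sub>R B (axis i 1) (axis j 1)) \<le> (\<Sum>j\<in>UNIV. norm y * norm (B (axis i 1) (axis j 1)))"
      by (intro order_trans[OF norm_sum] sum_mono)
        (simp add: mult_right_mono component_le_norm_cart)
    then show "norm (x $ i *\<^sub>R (\<Sum>j\<in>UNIV. y $ j *\<^sub>R B (axis i 1) (axis j 1)))
        \<le> norm x * (\<Sum>j\<in>UNIV. norm y * norm (B (axis i 1) (axis j 1)))"
      by (simp add: mult_mono component_le_norm_cart)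
  qed
  also have "\<dots> = (\<Sum>i\<in>UNIV. \<Sum>j\<in>UNIV. norm (B (axis i 1) (axis j 1))) * (norm x * norm y)"
    by (simp add: sum_distrib_left sum_distrib_right mult.assoc mult.commute mult.left_commute)
  finally show ?thesis .
qed

text \<open>Let \<open>m\<close> be the maximum of \<open>norm (w s)\<close> on a short interval
  around \<open>t\<close>. The mean value inequality gives
  \<open>m \<le> \<bar>K\<bar> * \<delta> * m\<close>, hence \<open>m = 0\<close>. This replaces
  uniqueness of geodesics, of which only the case of zero velocity is needed.\<close>

lemma quadratic_ode_zero:
  fixes w :: "real \<Rightarrow> 'b::real_normed_vector"
  assumes I: "convex I" "closed I" "t \<in> I" and w0: "w t = 0"
    and K: "\<forall>\<^sub>F s in at t within I. norm (w' s) \<le> K * (norm (w s) * norm (w s))" "norm (w' t) \<le> K * (norm (w t) * norm (w t))"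
    and d: "\<forall>\<^sub>F s in at t within I. (w has_vector_derivative w' s) (at s within I)"
      "(w has_vector_derivative w' t) (at t within I)"
  shows "\<forall>\<^sub>F s in at t within I. w s = 0"
proof -
  have "(w \<longlongrightarrow> w t) (at t within I)"
    using has_vector_derivative_continuous[OF d(2)] by (simp add: continuous_within)
  then have "\<forall>\<^sub>F s in at t within I. dist (w s) (w t) < 1" by (rule tendstoD) simp
  then have "\<forall>\<^sub>F s in at t within I. norm (w s) < 1 \<and> norm (w' s) \<le> K * (norm (w s) * norm (w s))
      \<and> (w has_vector_derivative w' s) (at s within I)"
    using K(1) d(1) by eventually_elim (simp add: w0)
  then obtain r where r: "r > 0" and near: "\<And>s. s \<in> I \<Longrightarrow> s \<noteq> t \<Longrightarrow> dist s t < r \<Longrightarrow> norm (w s) < 1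
      \<and> norm (w' s) \<le> K * (norm (w s) * norm (w s)) \<and> (w has_vector_derivative w' s) (at s within I)"
    unfolding eventually_at by blast
  have near': "norm (w s) < 1 \<and> norm (w' s) \<le> K * (norm (w s) * norm (w s)) \<and> (w has_vector_derivative w' s) (at s within I)"
    if "s \<in> I" "dist s t < r" for s
    using near[OF that(1) _ that(2)] K(2) d(2) w0 by (cases "s = t") auto
  \<comment> \<open>The first bound stays within the range of the local estimates, the second makes
    \<open>\<bar>K\<bar> * \<delta>\<close> less than 1; the \<open>+ 1\<close> covers
    \<open>K = 0\<close>.\<close>
  define \<delta> where "\<delta> = min (r / 2) (1 / (2 * (\<bar>K\<bar> + 1)))"
  have \<delta>: "\<delta> > 0" "\<delta> < r" "\<bar>K\<bar> * \<delta> < 1"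
  proof -
    show "\<delta> > 0" "\<delta> < r" using r by (auto simp: \<delta>_def)
    have "\<bar>K\<bar> * \<delta> \<le> \<bar>K\<bar> * (1 / (2 * (\<bar>K\<bar> + 1)))" by (intro mult_left_mono) (auto simp: \<delta>_def)
    also have "\<dots> < 1" by (simp add: field_simps)
    finally show "\<bar>K\<bar> * \<delta> < 1" .
  qed
  define J where "J = I \<inter> cball t \<delta>"
  have Jn: "s \<in> I" "dist s t < r" if "s \<in> J" for s
    using that \<delta> by (auto simp: J_def dist_commute)
  have tJ: "t \<in> J" using I \<delta> by (simp add: J_def)
  have cJ: "compact J" "convex J"
    using I by (auto simp: J_def compact_Int_closed Int_commute[of I] intro!: convex_Int)
  have dJ: "(w has_vector_derivative w' s) (at s within J)" if "s \<in> J" for s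
    using near'[OF Jn[OF that]] by (auto simp: J_def intro: has_vector_derivative_within_subset)
  have "continuous (at s within J) w" if "s \<in> J" for s
    by (rule has_vector_derivative_continuous[OF dJ[OF that]])
  then have cont: "continuous_on J (\<lambda>s. norm (w s))"
    by (intro continuous_on_norm) (simp add: continuous_on_eq_continuous_within)
  obtain s1 where s1: "s1 \<in> J" "\<And>s. s \<in> J \<Longrightarrow> norm (w s) \<le> norm (w s1)"
    using continuous_attains_sup[OF cJ(1) _ cont] tJ by blast
  let ?m = "norm (w s1)"
  have "norm (w s1 - w t) \<le> (\<bar>K\<bar> * ?m) * norm (s1 - t)"
  proof (rule differentiable_bound[OF cJ(2) _ _ s1(1) tJ])
    fix s assume s: "s \<in> J"
    show "(w has_derivative (\<lambda>h. h *\<^sub>R w' s)) (at s within J)"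
      using dJ[OF s] by (simp add: has_vector_derivative_def)
    have "norm (w' s) \<le> K * (norm (w s) * norm (w s))" using near'[OF Jn[OF s]] by blast
    also have "\<dots> \<le> \<bar>K\<bar> * (norm (w s) * norm (w s))" by (intro mult_right_mono) auto
    \<comment> \<open>Since \<open>norm (w s) < 1\<close>, one factor of the quadratic bound can be
      given up, which leaves a linear one.\<close>
    also have "\<dots> \<le> \<bar>K\<bar> * (?m * 1)"
      using near'[OF Jn[OF s]] s1(2)[OF s] by (intro mult_left_mono mult_mono) auto
    finally have le: "norm (w' s) \<le> \<bar>K\<bar> * ?m" by simp
    show "onorm (\<lambda>h. h *\<^sub>R w' s) \<le> \<bar>K\<bar> * ?m"
    proof (rule onorm_bound)
      show "norm (h *\<^sub>R w' s) \<le> \<bar>K\<bar> * ?m * norm h" for h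
        using mult_right_mono[OF le, of "norm h"] by (simp add: mult.commute)
    qed simp
  qed
  also have "\<dots> \<le> (\<bar>K\<bar> * ?m) * \<delta>"
    using s1(1) by (intro mult_left_mono) (auto simp: J_def dist_norm norm_minus_commute)
  finally have le: "?m \<le> (\<bar>K\<bar> * \<delta>) * ?m" by (simp add: w0 mult.commute mult.left_commute)
  have "?m = 0"
  proof (rule ccontr)
    assume "?m \<noteq> 0"
    then have "(\<bar>K\<bar> * \<delta>) * ?m < 1 * ?m" by (intro mult_strict_right_mono \<delta>(3)) simp
    then show False using le by simp
  qed
  then have "w s = 0" if "s \<in> J" for s using s1(2)[OF that] by simp
  then show ?thesis
    unfolding eventually_at J_def using \<delta>(1) by (auto simp: dist_commute intro!: exI[of _ \<delta>])
qed

locale lorentz_mfd =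
  fixes M :: "('m::{t2_space, second_countable_topology}, 'n::finite) lorentz"
  assumes mfd: "lorentzian_manifold M"
begin

abbreviation "A \<equiv> atlas M"
abbreviation "g \<equiv> metric M"

lemma atlas: "smooth_atlas A"
  using mfd unfolding lorentzian_manifold_def by blast

lemma lorentz: "lorentzian_metric A g"
  using mfd unfolding lorentzian_manifold_def by blast

lemma sym_tensor: "smooth_sym_tensor A g"
  using lorentz unfolding lorentzian_metric_def by blast

lemma signature: "c \<in> A \<Longrightarrow> x \<in> cdom c \<Longrightarrow> lorentz_signature (metric_matrix A g c (cmap c x))"
  using lorentz unfolding lorentzian_metric_def by blast

lemma timefield: "timefield M x \<in> tangent_space A x" "g x (timefield M x) (timefield M x) < 0"
  using mfd unfolding lorentzian_manifold_def by blast+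

lemma g_linear:
  assumes "u \<in> tangent_space A x" "v \<in> tangent_space A x" "w \<in> tangent_space A x"
  shows "g x (\<lambda>c. r *\<^sub>R u c + s *\<^sub>R v c) w = r * g x u w + s * g x v w"
    "g x w (\<lambda>c. r *\<^sub>R u c + s *\<^sub>R v c) = r * g x w u + s * g x w v"
proof -
  obtain c where c: "c \<in> A" "x \<in> cdom c" by (rule chart_exists[OF atlas])
  note m = metric_chart_eq[OF sym_tensor _ _ c] tangent_space_linear[OF atlas assms(1,2), of r s]
  show 1: "g x (\<lambda>c. r *\<^sub>R u c + s *\<^sub>R v c) w = r * g x u w + s * g x v w"
    unfolding m(1)[OF m(2) assms(3)] m(1)[OF assms(1,3)] m(1)[OF assms(2,3)] by (simp add: inner_add_left)
  then show "g x w (\<lambda>c. r *\<^sub>R u c + s *\<^sub>R v c) = r * g x w u + s * g x w v"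
    unfolding metric_sym[OF sym_tensor assms(3) m(2)] metric_sym[OF sym_tensor assms(3,1)] metric_sym[OF sym_tensor assms(3,2)] .
qed

lemma g_scale:
  assumes "u \<in> tangent_space A x" "w \<in> tangent_space A x"
  shows "g x (\<lambda>c. r *\<^sub>R u c) w = r * g x u w" "g x w (\<lambda>c. r *\<^sub>R u c) = r * g x w u"
  using g_linear[OF assms(1,1,2), of r 0] by simp_all

lemma timelike_causal_nonzero:
  assumes t: "t \<in> tangent_space A x" "g x t t < 0" and v: "v \<in> tangent_space A x" "v \<noteq> zero_tvec" "g x v v \<le> 0"
  shows "g x t v \<noteq> 0"
proof -
  obtain c where c: "c \<in> A" "x \<in> cdom c" by (rule chart_exists[OF atlas])
  note m = metric_chart_eq[OF sym_tensor _ _ c]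
  have "v c \<noteq> 0" using tangent_nonzero_chart[OF atlas v(1) c] v(2) by blast
  then show ?thesis
    using lorentz_signature_orthogonal[OF signature[OF c], of "t c" "v c"] t v m[OF t(1) t(1)] m[OF t(1) v(1)] m[OF v(1) v(1)] by simp
qed

text \<open>Otherwise a combination \<open>T\<close> of \<open>t1\<close> and \<open>t2\<close> with
  a nonnegative and a positive coefficient is orthogonal to \<open>v\<close>. As \<open>t1\<close>
  and \<open>t2\<close> lie in one cone, \<open>T\<close> is timelike, and a timelike vector is not
  orthogonal to a nonzero causal one.\<close>

lemma same_cone:
  assumes t: "t1 \<in> tangent_space A x" "g x t1 t1 < 0" "t2 \<in> tangent_space A x" "g x t2 t2 < 0" "g x t1 t2 < 0"
    and v: "v \<in> tangent_space A x" "v \<noteq> zero_tvec" "g x v v \<le> 0" "g x v t1 < 0"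
  shows "g x v t2 < 0"
proof (rule ccontr)
  assume "\<not> g x v t2 < 0"
  then have b: "g x v t2 \<ge> 0" by simp
  let ?a = "- g x v t1" and ?b = "g x v t2"
  have a: "?a > 0" using v(4) by simp
  define T where "T = (\<lambda>c. ?b *\<^sub>R t1 c + ?a *\<^sub>R t2 c)"
  have T: "T \<in> tangent_space A x" unfolding T_def by (rule tangent_space_linear[OF atlas t(1,3)])
  have vT: "g x v T = 0" unfolding T_def g_linear(2)[OF t(1,3) v(1)] by simp
  have "g x T T = ?b * g x t1 T + ?a * g x t2 T" using g_linear(1)[OF t(1,3) T, of ?b ?a] by (simp add: T_def)
  also have "\<dots> = ?b * (?b * g x t1 t1 + ?a * g x t1 t2) + ?a * (?b * g x t2 t1 + ?a * g x t2 t2)"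
    unfolding T_def g_linear(2)[OF t(1,3,1)] g_linear(2)[OF t(1,3,3)] ..
  also have "\<dots> = ?b * ?b * g x t1 t1 + 2 * (?a * ?b) * g x t1 t2 + ?a * ?a * g x t2 t2"
    using metric_sym[OF sym_tensor t(3,1)] by (simp add: algebra_simps)
  also have "\<dots> < 0"
  proof -
    have "?b * ?b * g x t1 t1 \<le> 0" using t(2) by (intro mult_nonneg_nonpos) auto
    moreover have "2 * (?a * ?b) * g x t1 t2 \<le> 0" using a b t(5) by (intro mult_nonneg_nonpos mult_nonneg_nonneg) auto
    moreover have "?a * ?a * g x t2 t2 < 0" using a t(4) by (intro mult_pos_neg mult_pos_pos) auto
    ultimately show ?thesis by linarith
  qed
  finally have "g x T v \<noteq> 0" using timelike_causal_nonzero[OF T _ v(1-3)] by blast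
  then show False using vT metric_sym[OF sym_tensor T v(1)] by simp
qed

lemma timefield_cont_field:
  fixes \<gamma> :: "'a::t2_space \<Rightarrow> 'm"
  assumes \<gamma>: "continuous_on I \<gamma>"
  shows "cont_field A I \<gamma> (\<lambda>s. timefield M (\<gamma> s))"
  unfolding cont_field_def continuous_within
proof (intro ballI conjI impI timefield(1))
  fix t c assume t: "t \<in> I" and c: "c \<in> A" "\<gamma> t \<in> cdom c"
  have "continuous_on (cimg c) (\<lambda>u. timefield M (cinv c u) c)"
    using mfd c(1) smooth_on_continuous unfolding lorentzian_manifold_def by blast
  then have "isCont (\<lambda>u. timefield M (cinv c u) c) (cmap c (\<gamma> t))"
    using smooth_atlasD(2)[OF atlas c(1)] c(2) continuous_on_eq_continuous_at by blast
  then have "((\<lambda>s. timefield M (cinv c (cmap c (\<gamma> s))) c) \<longlongrightarrow> timefield M (cinv c (cmap c (\<gamma> t))) c) (at t within I)"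
    by (rule isCont_tendsto_compose) (rule cmap_curve_tendsto[OF atlas c(1) \<gamma> t c(2)])
  moreover have "\<forall>\<^sub>F s in at t within I. timefield M (cinv c (cmap c (\<gamma> s))) c = timefield M (\<gamma> s) c"
    using eventually_curve_in[OF \<gamma> t smooth_atlasD(1)[OF atlas c(1)] c(2)]
    by eventually_elim (simp add: cinv_cmap[OF atlas c(1)])
  ultimately have "((\<lambda>s. timefield M (\<gamma> s) c) \<longlongrightarrow> timefield M (cinv c (cmap c (\<gamma> t))) c) (at t within I)"
    by (rule Lim_transform_eventually)
  then show "((\<lambda>s. timefield M (\<gamma> s) c) \<longlongrightarrow> timefield M (\<gamma> t) c) (at t within I)"
    by (simp add: cinv_cmap[OF atlas c])
qed

lemma geodesic_square_const:
  assumes \<gamma>: "geodesic A g I \<gamma> V" and I: "convex I" "s \<in> I" "t \<in> I"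
  shows "g (\<gamma> s) (V s) (V s) = g (\<gamma> t) (V t) (V t)"
proof -
  note C = geodesic_C1_curve[OF \<gamma>]
  have "\<exists>k. \<forall>t\<in>I. g (\<gamma> t) (V t) (V t) = k"
  proof (rule has_derivative_zero_constant[OF I(1)])
    fix t assume t: "t \<in> I"
    obtain c where c: "c \<in> A" "\<gamma> t \<in> cdom c" by (rule chart_exists[OF atlas])
    let ?G = "metric_matrix A g c" and ?u = "\<lambda>s. cmap c (\<gamma> s)" and ?w = "\<lambda>s. V s c"
    let ?w' = "- christoffel_form A g c (cmap c (\<gamma> t)) (V t c) (V t c)"
    interpret mc: metric_chart A g c ?G "cimg c" by (rule metric_chartI[OF atlas lorentz c(1)])
    have u: "?u t \<in> cimg c" using c by auto
    have du: "(?u has_derivative (\<lambda>h. h *\<^sub>R V t c)) (at t within I)"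
      using C1_curve_deriv[OF C t c] by (simp add: has_vector_derivative_def)
    have dw: "(?w has_derivative (\<lambda>h. h *\<^sub>R ?w')) (at t within I)"
      using geodesic_velocity_deriv[OF \<gamma> t c] by (simp only: has_vector_derivative_def)
    have dG: "((\<lambda>s. ?G (?u s)) has_derivative (\<lambda>h. fd ?G (?u t) (h *\<^sub>R V t c))) (at t within I)"
      by (rule has_derivative_compose[OF du mc.G_has_derivative[OF u]])
    have "((\<lambda>s. ?w s \<bullet> (?G (?u s) *v ?w s)) has_derivative
      (\<lambda>h. ?w t \<bullet> (?G (?u t) *v (h *\<^sub>R ?w') + fd ?G (?u t) (h *\<^sub>R V t c) *v ?w t)
         + (h *\<^sub>R ?w') \<bullet> (?G (?u t) *v ?w t))) (at t within I)"
      by (rule has_derivative_inner[OF dw bounded_bilinear.FDERIV[OF bounded_bilinear_matrix_vector_mult dG dw]])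
    also have "(\<lambda>h. ?w t \<bullet> (?G (?u t) *v (h *\<^sub>R ?w') + fd ?G (?u t) (h *\<^sub>R V t c) *v ?w t)
         + (h *\<^sub>R ?w') \<bullet> (?G (?u t) *v ?w t)) = (\<lambda>h. 0)"
    proof
      fix h
      have "fd ?G (?u t) (h *\<^sub>R V t c) = h *\<^sub>R fd ?G (?u t) (V t c)"
        using has_derivative_linear[OF mc.G_has_derivative[OF u]] by (rule linear_scale)
      moreover have "?w' = - 1 *\<^sub>R christoffel_form A g c (cmap c (\<gamma> t)) (V t c) (V t c)" by simp
      ultimately show "?w t \<bullet> (?G (?u t) *v (h *\<^sub>R ?w') + fd ?G (?u t) (h *\<^sub>R V t c) *v ?w t)
         + (h *\<^sub>R ?w') \<bullet> (?G (?u t) *v ?w t) = 0"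
        using mc.christoffel_form_compat[OF u, of "V t c" "V t c" "V t c"]
        by (simp add: inner_add_right matrix_vector_mult_scaleR scaleR_matrix_vector_assoc[symmetric]
            linear_neg algebra_simps del: scaleR_minus_left)
    qed
    finally have d: "((\<lambda>s. ?w s \<bullet> (?G (?u s) *v ?w s)) has_derivative (\<lambda>h. 0)) (at t within I)" .
    have "\<forall>\<^sub>F s in at t within I. ?w s \<bullet> (?G (?u s) *v ?w s) = g (\<gamma> s) (V s) (V s)"
      using eventually_curve_in[OF C1_curve_continuous[OF C] t smooth_atlasD(1)[OF atlas c(1)] c(2)]
      by eventually_elim (use metric_chart_eq[OF sym_tensor C1_curve_tangent[OF C] C1_curve_tangent[OF C] c(1)] in auto)
    then show "((\<lambda>t. g (\<gamma> t) (V t) (V t)) has_derivative (\<lambda>h. 0)) (at t within I)"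
      by (rule has_derivative_transform_eventually[OF d])
        (use t metric_chart_eq[OF sym_tensor C1_curve_tangent[OF C t] C1_curve_tangent[OF C t] c] in auto)
  qed
  then show ?thesis using I by metis
qed

text \<open>Vanishing of the velocity is a locally constant property: near a nonzero value by
  continuity, near a zero because the geodesic equation is quadratic in the velocity. The interval
  is connected.\<close>

lemma geodesic_nonzero:
  assumes \<gamma>: "geodesic A g I \<gamma> V" and I: "convex I" "closed I" "s \<in> I" "t \<in> I" and nz: "V s \<noteq> zero_tvec"
  shows "V t \<noteq> zero_tvec"
proof -
  note C = geodesic_C1_curve[OF \<gamma>]
  have "\<forall>t\<in>I. \<forall>\<^sub>F s in at t within I. (V t = zero_tvec) = (V s = zero_tvec)"
  proof
    fix t assume t: "t \<in> I"
    obtain c where c: "c \<in> A" "\<gamma> t \<in> cdom c" by (rule chart_exists[OF atlas])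
    let ?G = "metric_matrix A g c" and ?u = "\<lambda>s. cmap c (\<gamma> s)"
    let ?\<Gamma> = "christoffel_form A g c"
    interpret mc: metric_chart A g c ?G "cimg c" by (rule metric_chartI[OF atlas lorentz c(1)])
    have u: "?u t \<in> cimg c" using c by auto
    have in_c: "\<forall>\<^sub>F s in at t within I. s \<in> I \<and> \<gamma> s \<in> cdom c"
      by (rule eventually_curve_in[OF C1_curve_continuous[OF C] t smooth_atlasD(1)[OF atlas c(1)] c(2)])
    have zc: "V s = zero_tvec \<longleftrightarrow> V s c = 0" if "s \<in> I" "\<gamma> s \<in> cdom c" for s
      by (rule tangent_nonzero_chart[OF atlas C1_curve_tangent[OF C that(1)] c(1) that(2)])
    show "\<forall>\<^sub>F s in at t within I. (V t = zero_tvec) = (V s = zero_tvec)"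
    proof (cases "V t c = 0")
      case False
      have "\<forall>\<^sub>F s in at t within I. V s c \<noteq> 0"
        using cont_fieldD(2)[OF C1_curve_cont_field[OF C] t c] False by (rule tendsto_imp_eventually_ne)
      then show ?thesis using in_c by eventually_elim (use zc zc[OF t c(2)] False in auto)
    next
      case True
      \<comment> \<open>A bound for the connection form as a bilinear map. It is continuous in the
        point, so near \<open>t\<close> it stays below its value at \<open>t\<close> plus 1.\<close>
      let ?N = "\<lambda>p. \<Sum>i\<in>UNIV. \<Sum>j\<in>UNIV. norm (?\<Gamma> p (axis i 1) (axis j 1))"
      have "isCont ?N (?u t)"
        by (intro continuous_intros differentiable_imp_continuous_within mc.christoffel_form_differentiable u)
      then have "((\<lambda>s. ?N (?u s)) \<longlongrightarrow> ?N (?u t)) (at t within I)"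
        by (rule isCont_tendsto_compose) (rule cmap_curve_tendsto[OF atlas c(1) C1_curve_continuous[OF C] t c(2)])
      then have "\<forall>\<^sub>F s in at t within I. ?N (?u s) < ?N (?u t) + 1" by (rule order_tendstoD) simp
      then have K: "\<forall>\<^sub>F s in at t within I. norm (- ?\<Gamma> (?u s) (V s c) (V s c)) \<le> (?N (?u t) + 1) * (norm (V s c) * norm (V s c))"
      proof eventually_elim
        case (elim s)
        have "norm (- ?\<Gamma> (?u s) (V s c) (V s c)) \<le> ?N (?u s) * (norm (V s c) * norm (V s c))"
          unfolding norm_minus_cancel by (rule bilinear_norm_bound[OF bilinear_christoffel_form])
        also have "\<dots> \<le> (?N (?u t) + 1) * (norm (V s c) * norm (V s c))"
          using elim by (intro mult_right_mono) auto
        finally show ?case .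
      qed
      have "\<forall>\<^sub>F s in at t within I. V s c = 0"
      proof (rule quadratic_ode_zero[where w' = "\<lambda>s. - ?\<Gamma> (?u s) (V s c) (V s c)", OF I(1,2) t _ K])
        show "norm (- ?\<Gamma> (?u t) (V t c) (V t c)) \<le> (?N (?u t) + 1) * (norm (V t c) * norm (V t c))"
          using bilinear_lzero[OF bilinear_christoffel_form] by (simp add: True)
        show "((\<lambda>s. V s c) has_vector_derivative - ?\<Gamma> (?u t) (V t c) (V t c)) (at t within I)"
          by (rule geodesic_velocity_deriv[OF \<gamma> t c])
        show "\<forall>\<^sub>F s in at t within I. ((\<lambda>s. V s c) has_vector_derivative - ?\<Gamma> (?u s) (V s c) (V s c)) (at s within I)"
          using in_c by eventually_elim (use geodesic_velocity_deriv[OF \<gamma> _ c(1)] in blast)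
      qed (fact True)
      then show ?thesis using in_c by eventually_elim (use zc zc[OF t c(2)] True in auto)
    qed
  qed
  then have "(V t = zero_tvec) = (V s = zero_tvec)"
    using connected_local_const[OF convex_connected[OF I(1)] I(4,3), of "\<lambda>t. V t = zero_tvec"] by blast
  then show ?thesis using nz by blast
qed

end

section \<open>Causality and observers\<close>

lemma sym_tensor_scale:
  fixes A :: "('m::{t2_space, second_countable_topology}, 'n::finite) chart set"
  assumes A: "smooth_atlas A" "smooth_sym_tensor A h" and v: "v \<in> tangent_space A x"
  shows "h x (\<lambda>c. r *\<^sub>R v c) (\<lambda>c. r *\<^sub>R v c) = r * r * h x v v"
proof -
  obtain c where c: "c \<in> A" "x \<in> cdom c" by (rule chart_exists[OF A(1)])
  note m = metric_chart_eq[OF A(2) _ _ c]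
  note rv = tangent_space_scale[OF A(1) v, of r]
  show ?thesis unfolding m[OF rv rv] m[OF v v] by (simp add: matrix_vector_mult_scaleR)
qed

lemma riemannian_nonneg:
  fixes A :: "('m::{t2_space, second_countable_topology}, 'n::finite) chart set"
  assumes A: "smooth_atlas A" "riemannian_metric A h" and v: "v \<in> tangent_space A x"
  shows "h x v v \<ge> 0"
proof (cases "v = zero_tvec")
  case True
  have s: "smooth_sym_tensor A h" using A(2) unfolding riemannian_metric_def by blast
  show ?thesis using sym_tensor_scale[OF A(1) s v, of 0] by (simp add: True)
next
  case False
  then show ?thesis using A(2) v unfolding riemannian_metric_def by (meson less_imp_le)
qed

text \<open>Stretching the piece over \<open>{0..t0}\<close> to the unit interval multiplies
  velocity and covariant derivative by \<open>t0\<close>, so its length is the integral over that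
  piece and does not exceed \<open>len\<close>. A Sasaki ball thus contains a whole curve from its
  centre to each of its points.\<close>

lemma sasaki_curve_initial:
  fixes A :: "('m::{t2_space, second_countable_topology}, 'n::finite) chart set"
  assumes A: "smooth_atlas A" "riemannian_metric A h"
    and C: "C1_curve A {0..1} \<alpha> V" and W: "covariant_derivative_along A h {0..1} \<alpha> V W D"
    and D: "\<forall>t\<in>{0..1}. \<forall>c\<in>A. \<alpha> t \<in> cdom c \<longrightarrow> continuous (at t within {0..1}) (\<lambda>s. D s c)"
    and len: "((\<lambda>t. sqrt (h (\<alpha> t) (V t) (V t) + h (\<alpha> t) (D t) (D t))) has_integral len) {0..1}"
    and r: "len < r" and t0: "t0 \<in> {0..1}"
  shows "(\<alpha> t0, W t0) \<in> sasaki_nbhd A h (\<alpha> 0, W 0) r"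
proof -
  have s: "smooth_sym_tensor A h" using A(2) unfolding riemannian_metric_def by blast
  let ?F = "\<lambda>t. sqrt (h (\<alpha> t) (V t) (V t) + h (\<alpha> t) (D t) (D t))"
  have J: "0 + t0 * t \<in> {0..1}" if "t \<in> {0..1}" for t
    using that t0 by (auto simp: mult_le_one)
  have Vt: "V t \<in> tangent_space A (\<alpha> t)" if "t \<in> {0..1}" for t by (rule C1_curve_tangent[OF C that])
  have WD: "W t \<in> tangent_space A (\<alpha> t)" "D t \<in> tangent_space A (\<alpha> t)"
    "\<And>c. c \<in> A \<Longrightarrow> \<alpha> t \<in> cdom c \<Longrightarrow> ((\<lambda>s. W s c) has_vector_derivative
       D t c - christoffel_form A h c (cmap c (\<alpha> t)) (V t c) (W t c)) (at t within {0..1})" if "t \<in> {0..1}" for t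
    using W that unfolding covariant_derivative_along_def by blast+
  have F0: "0 \<le> ?F t" if "t \<in> {0..1}" for t
    using riemannian_nonneg[OF A Vt[OF that]] riemannian_nonneg[OF A WD(2)[OF that]] by simp
  define \<alpha>' where "\<alpha>' = (\<lambda>t. \<alpha> (0 + t0 * t))"
  define V' where "V' = (\<lambda>t c. t0 *\<^sub>R V (0 + t0 * t) c)"
  define W' where "W' = (\<lambda>t. W (0 + t0 * t))"
  define D' where "D' = (\<lambda>t c. t0 *\<^sub>R D (0 + t0 * t) c)"
  have l: "((\<lambda>s. 0 + t0 * s) has_vector_derivative t0) (at t within {0..1})" for t
    by (auto intro!: derivative_eq_intros simp: has_vector_derivative_def)
  have img: "(\<lambda>s. 0 + t0 * s) ` {0..1} \<subseteq> {0..1}" using J by blast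
  have C': "C1_curve A {0..1} \<alpha>' V'"
    unfolding \<alpha>'_def V'_def by (rule C1_curve_affine[OF A(1) C J])
  have W': "covariant_derivative_along A h {0..1} \<alpha>' V' W' D'"
    unfolding covariant_derivative_along_def
  proof (intro ballI conjI impI)
    fix t :: real assume t: "t \<in> {0..1}"
    show "W' t \<in> tangent_space A (\<alpha>' t)" "D' t \<in> tangent_space A (\<alpha>' t)"
      unfolding \<alpha>'_def W'_def D'_def by (rule WD(1)[OF J[OF t]], rule tangent_space_scale[OF A(1) WD(2)[OF J[OF t]]])
    fix c assume c: "c \<in> A" "\<alpha>' t \<in> cdom c"
    let ?\<Gamma> = "christoffel_form A h c (cmap c (\<alpha>' t))"
    have "((\<lambda>s. W s c) has_vector_derivative D (0 + t0 * t) c - ?\<Gamma> (V (0 + t0 * t) c) (W (0 + t0 * t) c))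
       (at (0 + t0 * t) within (\<lambda>s. 0 + t0 * s) ` {0..1})"
      using has_vector_derivative_within_subset[OF WD(3)[OF J[OF t] c(1)] img] c(2) unfolding \<alpha>'_def by blast
    from vector_diff_chain_within[OF l this]
    have "((\<lambda>s. W' s c) has_vector_derivative t0 *\<^sub>R (D (0 + t0 * t) c - ?\<Gamma> (V (0 + t0 * t) c) (W (0 + t0 * t) c))) (at t within {0..1})"
      unfolding W'_def comp_def .
    also have "t0 *\<^sub>R (D (0 + t0 * t) c - ?\<Gamma> (V (0 + t0 * t) c) (W (0 + t0 * t) c)) = D' t c - ?\<Gamma> (V' t c) (W' t c)"
      unfolding D'_def V'_def W'_def by (simp add: scaleR_diff_right bilinear_lmul[OF bilinear_christoffel_form])
    finally show "((\<lambda>s. W' s c) has_vector_derivative D' t c - ?\<Gamma> (V' t c) (W' t c)) (at t within {0..1})" .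
  qed
  have cD: "continuous (at t within {0..1}) (\<lambda>s. D' s c)" if t: "t \<in> {0..1}" and c: "c \<in> A" "\<alpha>' t \<in> cdom c" for t c
  proof -
    have "continuous (at (0 + t0 * t) within {0..1}) (\<lambda>s. D s c)"
      using D J[OF t] c unfolding \<alpha>'_def by blast
    then have "continuous (at (0 + t0 * t) within (\<lambda>s. 0 + t0 * s) ` {0..1}) (\<lambda>s. D s c)"
      using img by (rule continuous_within_subset)
    then have "continuous (at t within {0..1}) (\<lambda>s. D (0 + t0 * s) c)"
      by (rule continuous_within_compose2[where f = "\<lambda>s. 0 + t0 * s" and g = "\<lambda>s. D s c", rotated])
        (intro continuous_intros)
    then show ?thesis unfolding D'_def by (rule continuous_scaleR[OF continuous_const])
  qed
  have F': "sqrt (h (\<alpha>' t) (V' t) (V' t) + h (\<alpha>' t) (D' t) (D' t)) = t0 * ?F (t0 * t)" if t: "t \<in> {0..1}" for t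
  proof -
    have "h (\<alpha>' t) (V' t) (V' t) + h (\<alpha>' t) (D' t) (D' t)
       = (t0 * t0) * (h (\<alpha> (t0 * t)) (V (t0 * t)) (V (t0 * t)) + h (\<alpha> (t0 * t)) (D (t0 * t)) (D (t0 * t)))"
      using sym_tensor_scale[OF A(1) s Vt[OF J[OF t]], of t0] sym_tensor_scale[OF A(1) s WD(2)[OF J[OF t]], of t0]
      by (simp add: \<alpha>'_def V'_def D'_def distrib_left)
    then show ?thesis using t0 by (simp add: real_sqrt_mult)
  qed
  obtain len' where len': "((\<lambda>t. t0 * ?F (t0 * t)) has_integral len') {0..1}" "len' \<le> len"
  proof (cases "t0 = 0")
    case True
    have "0 \<le> len" using has_integral_nonneg[OF len] F0 by blast
    moreover have "((\<lambda>t. t0 * ?F (t0 * t)) has_integral 0) {0..1}" by (simp add: True)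
    ultimately show ?thesis using that by blast
  next
    case False
    then have pos: "t0 > 0" using t0 by simp
    have int: "?F integrable_on {0..1}" using len by blast
    have int': "?F integrable_on {0..t0}"
      by (rule integrable_subinterval_real[OF int]) (use t0 in auto)
    have "((\<lambda>t. ?F (t0 * t)) has_integral (1 / \<bar>t0\<bar>) *\<^sub>R integral {0..t0} ?F) ((\<lambda>x. x / t0) ` {0..t0})"
      by (rule has_integral_stretch_real[OF integrable_integral[OF int'] False])
    also have "(\<lambda>x. x / t0) ` {0..t0} = {0..1}"
      using pos by (simp add: image_divide_atLeastAtMost)
    finally have "((\<lambda>t. t0 * ?F (t0 * t)) has_integral t0 * ((1 / \<bar>t0\<bar>) *\<^sub>R integral {0..t0} ?F)) {0..1}"
      by (rule has_integral_mult_right)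
    moreover have "t0 * ((1 / \<bar>t0\<bar>) *\<^sub>R integral {0..t0} ?F) \<le> len"
    proof -
      have "integral {0..t0} ?F \<le> integral {0..1} ?F"
        by (rule integral_subset_le[OF _ int' int]) (use t0 F0 in auto)
      then show ?thesis using pos integral_unique[OF len] by simp
    qed
    ultimately show ?thesis using that by blast
  qed
  have "((\<lambda>t. sqrt (h (\<alpha>' t) (V' t) (V' t) + h (\<alpha>' t) (D' t) (D' t))) has_integral len') {0..1}"
    using has_integral_eq[OF F'[symmetric] len'(1)] by simp
  moreover have "(\<alpha>' 0, W' 0) = (\<alpha> 0, W 0)" "(\<alpha>' 1, W' 1) = (\<alpha> t0, W t0)" by (simp_all add: \<alpha>'_def W'_def)
  ultimately have "sasaki_curve A h (\<alpha> 0, W 0) (\<alpha> t0, W t0) len'"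
    unfolding sasaki_curve_def using C' W' cD by blast
  moreover have "len' < r" using len'(2) r by simp
  ultimately show ?thesis unfolding sasaki_nbhd_def mem_Collect_eq by blast
qed

lemma connected_neg:
  fixes f :: "'a::topological_space \<Rightarrow> real"
  assumes "connected I" "continuous_on I f" "\<And>t. t \<in> I \<Longrightarrow> f t \<noteq> 0" "s \<in> I" "f s < 0" "t \<in> I"
  shows "f t < 0"
proof (rule ccontr)
  assume "\<not> f t < 0"
  then have "0 \<in> f ` I"
    using connectedD_interval[OF connected_continuous_image[OF assms(2,1)], of "f s" "f t" 0] assms by auto
  then show False using assms(3) by auto
qed

context lorentz_mfd
begin

section \<open>Light rays and causal segments\<close>

lemma future_causalD:
  "future_causal M x v \<Longrightarrow> v \<in> tangent_space A x" "future_causal M x v \<Longrightarrow> v \<noteq> zero_tvec"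
  "future_causal M x v \<Longrightarrow> g x v v \<le> 0" "future_causal M x v \<Longrightarrow> g x v (timefield M x) < 0"
  unfolding future_causal_def by blast+

text \<open>The velocity stays null and nonzero, so its product with the time field never vanishes
  and keeps its initial sign.\<close>

lemma null_geodesic_future_causal:
  assumes \<gamma>: "geodesic A g {0..r} \<gamma> V" and l: "future_lightlike M (\<gamma> 0) (V 0)" and t: "t \<in> {0..r}"
  shows "future_causal M (\<gamma> t) (V t)"
proof -
  note C = geodesic_C1_curve[OF \<gamma>]
  have 0: "0 \<in> {0..r}" using t by simp
  have l': "V 0 \<noteq> zero_tvec" "g (\<gamma> 0) (V 0) (V 0) = 0" "g (\<gamma> 0) (V 0) (timefield M (\<gamma> 0)) < 0"
    using l unfolding future_lightlike_def lightlike_def by blast+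
  have nz: "V s \<noteq> zero_tvec" if "s \<in> {0..r}" for s
    by (rule geodesic_nonzero[OF \<gamma> _ _ 0 that l'(1)]) auto
  have null: "g (\<gamma> s) (V s) (V s) = 0" if "s \<in> {0..r}" for s
    using geodesic_square_const[OF \<gamma> _ that 0] l'(2) by simp
  have "g (\<gamma> t) (V t) (timefield M (\<gamma> t)) < 0"
  proof (rule connected_neg[of "{0..r}" "\<lambda>t. g (\<gamma> t) (V t) (timefield M (\<gamma> t))", OF _ _ _ 0 l'(3) t])
    show "continuous_on {0..r} (\<lambda>t. g (\<gamma> t) (V t) (timefield M (\<gamma> t)))"
      by (rule metric_cont_field[OF atlas sym_tensor C1_curve_continuous[OF C] C1_curve_cont_field[OF C]
        timefield_cont_field[OF C1_curve_continuous[OF C]]])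
    fix s assume s: "s \<in> {0..r}"
    show "g (\<gamma> s) (V s) (timefield M (\<gamma> s)) \<noteq> 0"
      using timelike_causal_nonzero[OF timefield C1_curve_tangent[OF C s] nz[OF s]] null[OF s]
        metric_sym[OF sym_tensor timefield(1) C1_curve_tangent[OF C s]] by simp
  qed simp
  then show ?thesis
    unfolding future_causal_def using C1_curve_tangent[OF C t] nz[OF t] null[OF t] by simp
qed

lemma causal_segmentI:
  assumes C: "C1_curve A {a..b} \<gamma> V" and ab: "a < b" and f: "\<And>t. t \<in> {a..b} \<Longrightarrow> future_causal M (\<gamma> t) (V t)"
  shows "causal_segment M (\<gamma> a) (\<gamma> b)"
proof -
  have J: "a + (b - a) * s \<in> {a..b}" if "s \<in> {0..1}" for s
  proof -
    have "0 \<le> (b - a) * s" "(b - a) * s \<le> (b - a) * 1" using that ab by (intro mult_left_mono mult_nonneg_nonneg; simp)+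
    then show ?thesis by simp
  qed
  let ?\<gamma> = "\<lambda>s. \<gamma> (a + (b - a) * s)" and ?V = "\<lambda>s c. (b - a) *\<^sub>R V (a + (b - a) * s) c"
  have C': "C1_curve A {0..1} ?\<gamma> ?V" by (rule C1_curve_affine[OF atlas C J])
  have "future_causal M (?\<gamma> s) (?V s)" if s: "s \<in> {0..1}" for s
  proof -
    note fc = future_causalD[OF f[OF J[OF s]]]
    have nz: "?V s \<noteq> zero_tvec"
    proof
      assume z: "?V s = zero_tvec"
      have "V (a + (b - a) * s) c = 0" for c using fun_cong[OF z, of c] ab by simp
      then show False using fc(2) by blast
    qed
    show ?thesis
      unfolding future_causal_def
      using nz tangent_space_scale[OF atlas fc(1)] sym_tensor_scale[OF atlas sym_tensor fc(1), of "b - a"]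
        g_scale(1)[OF fc(1) timefield(1), of "b - a"] fc(3,4) ab
      by (auto intro: mult_nonneg_nonpos mult_pos_neg)
  qed
  then show ?thesis
    unfolding causal_segment_def using C' by (intro exI[of _ ?\<gamma>] exI[of _ ?V]) simp
qed

text \<open>In Minkowski normal form the sum of the time axis and one space axis is null; the
  dimension bound provides the space axis. If the resulting vector points to the past, its negative
  is taken.\<close>

lemma future_lightlike_exists:
  assumes "CARD('n) \<ge> 2" obtains v where "future_lightlike M x v"
proof -
  obtain c where c: "c \<in> A" "x \<in> cdom c" by (rule chart_exists[OF atlas])
  let ?G = "metric_matrix A g c (cmap c x)"
  obtain P :: "real^'n^'n" and k where P: "invertible P"
    and form: "\<And>x y. (P *v x) \<bullet> (?G *v (P *v y)) = x \<bullet> y - 2 * (x $ k * y $ k)"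
    using lorentz_signature_form[OF signature[OF c]] by blast
  have "\<exists>j. j \<noteq> k"
  proof (rule ccontr)
    assume "\<not> (\<exists>j. j \<noteq> k)"
    then have "(UNIV :: 'n set) = {k}" by auto
    then have "CARD('n) = card {k}" by (rule arg_cong)
    then show False using assms by simp
  qed
  then obtain j where j: "j \<noteq> k" by blast
  define b :: "real^'n" where "b = axis k 1 + axis j 1"
  have bb: "b \<bullet> b = 2" "b $ k = 1"
    using j by (auto simp: b_def inner_add_left inner_add_right inner_axis_axis) (simp_all add: axis_def)
  define v where "v = tvec_of A c x (P *v b)"
  have v: "v \<in> tangent_space A x" "v c = P *v b"
    unfolding v_def by (rule tvec_of_tangent[OF atlas c])+
  have null: "g x v v = 0"
    unfolding metric_chart_eq[OF sym_tensor v(1) v(1) c] v(2) form by (simp add: bb)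
  have "P *v b \<noteq> 0"
  proof
    assume "P *v b = 0"
    then have "matrix_inv P *v (P *v b) = 0" by simp
    then show False using bb by (simp add: matrix_vector_mul_assoc matrix_inv_mult(2)[OF P])
  qed
  then have nz: "v \<noteq> zero_tvec" using tangent_nonzero_chart[OF atlas v(1) c] v(2) by simp
  have T: "g x v (timefield M x) \<noteq> 0"
    using timelike_causal_nonzero[OF timefield v(1) nz] null metric_sym[OF sym_tensor timefield(1) v(1)] by simp
  show ?thesis
  proof (cases "g x v (timefield M x) < 0")
    case True
    then show ?thesis using that v nz null unfolding future_lightlike_def lightlike_def by blast
  next
    case False
    let ?w = "\<lambda>c. (-1) *\<^sub>R v c"
    have w: "?w \<in> tangent_space A x" "g x ?w ?w = 0" "g x ?w (timefield M x) < 0"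
      using tangent_space_scale[OF atlas v(1), of "-1"] sym_tensor_scale[OF atlas sym_tensor v(1), of "-1"]
        g_scale(1)[OF v(1) timefield(1), of "-1"] null False T by auto
    have "?w \<noteq> zero_tvec"
    proof
      assume "?w = zero_tvec"
      then have "v c = 0" for c using fun_cong[of ?w zero_tvec c] by simp
      then show False using nz by blast
    qed
    then show ?thesis using that w unfolding future_lightlike_def lightlike_def by blast
  qed
qed

lemma self_light_observation_point:
  assumes n: "CARD('n) \<ge> 2" and x: "x \<in> U"
  shows "x \<in> light_observation_points M U x"
proof -
  obtain v where v: "future_lightlike M x v" by (rule future_lightlike_exists[OF n])
  then have vT: "v \<in> tangent_space A x" unfolding future_lightlike_def lightlike_def by blast
  have bot: "at (0::real) within {0..0} = bot" by (simp add: at_within_def)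
  have hvd: "(f has_vector_derivative d) (at (0::real) within {0..0})" for f :: "real \<Rightarrow> real^'n" and d
    unfolding bot has_vector_derivative_def has_derivative_def by (simp add: bounded_linear_scaleR_left)
  have "geodesic A g {0..0} (\<lambda>_. x) (\<lambda>_. v)"
    unfolding geodesic_def C1_curve_def covariant_derivative_along_def
  proof (intro conjI ballI impI)
    fix t :: real assume t: "t \<in> {0..0}"
    then have t0: "t = 0" by simp
    show "v \<in> tangent_space A x" by (rule vT)
    show "v \<in> tangent_space A x" by (rule vT)
    show "zero_tvec \<in> tangent_space A x" by (rule zero_tangent_space[OF atlas])
    show "((\<lambda>s. cmap c x) has_vector_derivative v c) (at t within {0..0})" for c unfolding t0 by (rule hvd)
    show "continuous (at t within {0..0}) (\<lambda>s. v c)" for c by (rule continuous_const)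
    show "((\<lambda>s. v c) has_vector_derivative zero_tvec c - christoffel_form A g c (cmap c x) (v c) (v c)) (at t within {0..0})" for c
      unfolding t0 by (rule hvd)
  qed (rule continuous_on_const)
  then show ?thesis
    unfolding light_observation_points_def using x v by fastforce
qed

section \<open>Connectedness of the observed region\<close>

lemma observation_region_iff:
  "x \<in> observation_region M gp s \<mu> V\<mu> h \<longleftrightarrow>
    (\<exists>z \<eta> \<gamma> V. (z, \<eta>) \<in> sasaki_nbhd A gp (\<mu> (s (- 2)), V\<mu> (s (- 2))) h \<and>
      observer M s z \<eta> \<gamma> V \<and> x \<in> \<gamma> ` {- 1<..<1})"
  unfolding observation_region_def mem_Collect_eq Bex_def split_paired_Ex prod.case by blast

text \<open>Each point is joined to the centre \<open>\<mu> (s (- 2))\<close> in two pieces: along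
  its observer to the initial point of that observer, then along the base curve of a Sasaki curve.
  The base curve stays in the region because each of its points starts an observer of its
  own.\<close>

lemma observation_region_connected:
  assumes gp: "riemannian_metric A gp" and s: "observer_times s" and h: "admissible_radius M gp s \<mu> V\<mu> h"
    and \<mu>: "geodesic A g {- 1..1} \<mu> V\<mu>"
  shows "connected (observation_region M gp s \<mu> V\<mu> h)"
proof -
  let ?U = "observation_region M gp s \<mu> V\<mu> h" and ?z = "\<mu> (s (- 2))"
  let ?N = "sasaki_nbhd A gp (\<mu> (s (- 2)), V\<mu> (s (- 2)))"
  have s2: "s (- 2) \<in> {- 1<..<1}" using s unfolding observer_times_def by auto
  have h0: "h > 0" using h unfolding admissible_radius_def by blast
  have inU: "z \<in> ?U" if "(z, \<eta>) \<in> ?N h" for z \<eta>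
  proof -
    \<comment> \<open>The radius at which \<open>admissible_radius\<close> guarantees observers is
      twice the one that defines the region.\<close>
    have "(z, \<eta>) \<in> ?N (2 * h)" using that h0 unfolding sasaki_nbhd_def by force
    then obtain \<gamma> V where o: "observer M s z \<eta> \<gamma> V"
      using h unfolding admissible_radius_def Ball_def split_paired_All prod.case by blast
    then have "z \<in> \<gamma> ` {- 1<..<1}" using s2 unfolding observer_def by blast
    then show ?thesis using that o unfolding observation_region_iff by blast
  qed
  have "connected_component ?U ?z x" if xU: "x \<in> ?U" for x
  proof -
    obtain z \<eta> \<gamma> V where z: "(z, \<eta>) \<in> ?N h" and o: "observer M s z \<eta> \<gamma> V" and x: "x \<in> \<gamma> ` {- 1<..<1}"
      using xU unfolding observation_region_iff by blast
    obtain len where len: "len < h" "sasaki_curve A gp (\<mu> (s (- 2)), V\<mu> (s (- 2))) (z, \<eta>) len"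
      using z unfolding sasaki_nbhd_def by blast
    obtain \<alpha> V\<alpha> W D where C: "C1_curve A {0..1} \<alpha> V\<alpha>" "covariant_derivative_along A gp {0..1} \<alpha> V\<alpha> W D"
      "\<forall>t\<in>{0..1}. \<forall>c\<in>A. \<alpha> t \<in> cdom c \<longrightarrow> continuous (at t within {0..1}) (\<lambda>s. D s c)"
      "(\<alpha> 0, W 0) = (\<mu> (s (- 2)), V\<mu> (s (- 2)))" "(\<alpha> 1, W 1) = (z, \<eta>)"
      "((\<lambda>t. sqrt (gp (\<alpha> t) (V\<alpha> t) (V\<alpha> t) + gp (\<alpha> t) (D t) (D t))) has_integral len) {0..1}"
      using len(2) unfolding sasaki_curve_def by blast
    have "\<alpha> ` {0..1} \<subseteq> ?U"
      using sasaki_curve_initial[OF atlas gp C(1-3,6) len(1)] inU unfolding C(4) by blast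
    moreover have "connected (\<alpha> ` {0..1})"
      by (rule connected_continuous_image[OF C1_curve_continuous[OF C(1)]]) simp
    moreover have "?z \<in> \<alpha> ` {0..1}" "z \<in> \<alpha> ` {0..1}"
      using C(4,5) by (auto intro: image_eqI[of _ _ 0] image_eqI[of _ _ 1])
    ultimately have 1: "connected_component ?U ?z z" by (intro connected_componentI)
    have "continuous_on {- 1..1} \<gamma>"
      using o C1_curve_continuous geodesic_C1_curve unfolding observer_def by blast
    then have "continuous_on {- 1<..<1} \<gamma>" by (rule continuous_on_subset) auto
    then have "connected (\<gamma> ` {- 1<..<1})" by (rule connected_continuous_image) simp
    moreover have "\<gamma> ` {- 1<..<1} \<subseteq> ?U" using z o observation_region_iff by blast
    moreover have "z \<in> \<gamma> ` {- 1<..<1}" using o s2 unfolding observer_def by blast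
    ultimately have "connected_component ?U z x" using x by (intro connected_componentI) auto
    with 1 show ?thesis by (rule connected_component_trans)
  qed
  then show ?thesis
    unfolding connected_iff_connected_component
    by (meson connected_component_sym connected_component_trans)
qed

end

text \<open>An isometry may reverse time. The product of the transported time field of
  \<open>M1\<close> with the time field of \<open>M2\<close> is continuous and nowhere 0 on the
  connected set \<open>U1\<close>, so its sign is decided at one point of the observer.\<close>

lemma isometry_future_causal:
  fixes M1 :: "('m1::{t2_space, second_countable_topology}, 'n::finite) lorentz"
    and M2 :: "('m2::{t2_space, second_countable_topology}, 'n) lorentz"
  assumes M: "lorentzian_manifold M1" "lorentzian_manifold M2"
    and iso: "isometry (atlas M1) U1 (metric M1) (atlas M2) U2 (metric M2) \<Phi>"
    and U1: "open U1" "connected U1"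
    and ab: "a < b" and C1: "C1_curve (atlas M1) {a..b} \<mu>1 V1" and C2: "C1_curve (atlas M2) {a..b} \<mu>2 V2"
    and f1: "\<And>t. t \<in> {a..b} \<Longrightarrow> future_timelike M1 (\<mu>1 t) (V1 t)"
    and f2: "\<And>t. t \<in> {a..b} \<Longrightarrow> future_timelike M2 (\<mu>2 t) (V2 t)"
    and \<mu>U: "\<mu>1 ` {a..b} \<subseteq> U1" and \<Phi>\<mu>: "\<And>t. t \<in> {a..b} \<Longrightarrow> \<Phi> (\<mu>1 t) = \<mu>2 t"
    and x: "x \<in> U1" and v: "future_causal M1 x v"
  shows "future_causal M2 (\<Phi> x) (differential (atlas M1) (atlas M2) \<Phi> x v)"
proof -
  interpret L1: lorentz_mfd M1 by standard (fact M(1))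
  interpret L2: lorentz_mfd M2 by standard (fact M(2))
  let ?A1 = "atlas M1" and ?A2 = "atlas M2" and ?g1 = "metric M1" and ?g2 = "metric M2"
  let ?d = "differential (atlas M1) (atlas M2) \<Phi>"
  let ?T1 = "timefield M1" and ?T2 = "timefield M2"
  have sm: "smooth_map ?A1 ?A2 U1 \<Phi>" using iso unfolding isometry_def diffeomorphism_def by blast
  note A = L1.atlas L2.atlas U1(1) sm
  have pb: "?g2 (\<Phi> x) (?d x u) (?d x w) = ?g1 x u w"
    if "x \<in> U1" "u \<in> tangent_space ?A1 x" "w \<in> tangent_space ?A1 x" for x u w
    using iso that unfolding isometry_def pullback_metric_def by blast
  have dT: "?d x u \<in> tangent_space ?A2 (\<Phi> x)" if "x \<in> U1" "u \<in> tangent_space ?A1 x" for x u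
    by (rule differential_tangent[OF A that])
  have dnz: "?d x u \<noteq> zero_tvec" if x: "x \<in> U1" and u: "u \<in> tangent_space ?A1 x" "w \<in> tangent_space ?A1 x" "?g1 x u w \<noteq> 0" for x u w
  proof
    assume z: "?d x u = zero_tvec"
    have "?g2 (\<Phi> x) (?d x u) (?d x w) = 0"
      using L2.g_scale(1)[OF dT[OF x u(1)] dT[OF x u(2)], of 0] z by simp
    then show False using pb[OF x u(1,2)] u(3) by simp
  qed
  define f where "f = (\<lambda>x. ?g2 (\<Phi> x) (?d x (?T1 x)) (?T2 (\<Phi> x)))"
  have T1: "?d x (?T1 x) \<in> tangent_space ?A2 (\<Phi> x)" "?g2 (\<Phi> x) (?d x (?T1 x)) (?d x (?T1 x)) < 0" if "x \<in> U1" for x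
    using dT[OF that L1.timefield(1)] pb[OF that L1.timefield(1) L1.timefield(1)] L1.timefield(2) by simp_all
  have T1nz: "?d x (?T1 x) \<noteq> zero_tvec" if "x \<in> U1" for x
    using dnz[OF that L1.timefield(1) L1.timefield(1)] L1.timefield(2)[of x] by simp
  have fneg: "f x < 0" if x: "x \<in> U1" for x
  proof -
    \<comment> \<open>Some point of the observer; here the identity
      \<open>\<Phi> (\<mu>1 t) = \<mu>2 t\<close> fixes the orientation.\<close>
    define t where "t = (a + b) / 2"
    have t: "t \<in> {a..b}" using ab by (simp add: t_def)
    have mU: "\<mu>1 t \<in> U1" using \<mu>U t by blast
    note ft1 = f1[OF t, unfolded future_timelike_def] and ft2 = f2[OF t, unfolded future_timelike_def]
    \<comment> \<open>Both vectors are derivatives of the same curve in a chart, and derivatives on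
      a nondegenerate closed interval are unique.\<close>
    have dV: "?d (\<mu>1 t) (V1 t) = V2 t"
    proof -
      obtain d where d: "d \<in> ?A2" "\<mu>2 t \<in> cdom d" by (rule chart_exists[OF L2.atlas])
      have C: "C1_curve ?A2 {a..b} (\<Phi> \<circ> \<mu>1) (\<lambda>s. ?d (\<mu>1 s) (V1 s))" by (rule C1_curve_image[OF A C1 \<mu>U])
      have d': "(\<Phi> \<circ> \<mu>1) t \<in> cdom d" using d(2) \<Phi>\<mu>[OF t] by simp
      have "((\<lambda>s. cmap d ((\<Phi> \<circ> \<mu>1) s)) has_vector_derivative ?d (\<mu>1 t) (V1 t) d) (at t within {a..b})"
        by (rule C1_curve_deriv[OF C t d(1) d'])
      then have e: "((\<lambda>s. cmap d (\<mu>2 s)) has_vector_derivative ?d (\<mu>1 t) (V1 t) d) (at t within cbox a b)"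
        unfolding cbox_interval by (rule has_vector_derivative_transform[OF t, rotated]) (simp add: \<Phi>\<mu>)
      have "((\<lambda>s. cmap d (\<mu>2 s)) has_vector_derivative V2 t d) (at t within cbox a b)"
        unfolding cbox_interval by (rule C1_curve_deriv[OF C2 t d])
      with e have "?d (\<mu>1 t) (V1 t) d = V2 t d"
        by (rule vector_derivative_unique_within_closed_interval[OF ab t[folded cbox_interval]])
      then show ?thesis
        using tangent_space_eqI[OF dT[OF mU C1_curve_tangent[OF C1 t]] _ d(1) _ ] C1_curve_tangent[OF C2 t] \<Phi>\<mu>[OF t] d(2) by simp
    qed
    have V1T: "?g1 (\<mu>1 t) (?T1 (\<mu>1 t)) (V1 t) < 0"
      using ft1 L1.sym_tensor L1.timefield(1) metric_sym by metis
    have "?g2 (\<Phi> (\<mu>1 t)) (?d (\<mu>1 t) (?T1 (\<mu>1 t))) (?T2 (\<Phi> (\<mu>1 t))) < 0"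
    \<comment> \<open>The velocity \<open>V2 t\<close> mediates: the transported time field and the
      time field of \<open>M2\<close> both lie in its cone.\<close>
    proof (rule L2.same_cone[where ?t1.0 = "V2 t"])
      show "V2 t \<in> tangent_space ?A2 (\<Phi> (\<mu>1 t))" "?g2 (\<Phi> (\<mu>1 t)) (V2 t) (V2 t) < 0"
        "?g2 (\<Phi> (\<mu>1 t)) (V2 t) (?T2 (\<Phi> (\<mu>1 t))) < 0" using ft2 \<Phi>\<mu>[OF t] by auto
      show "?g2 (\<Phi> (\<mu>1 t)) (?d (\<mu>1 t) (?T1 (\<mu>1 t))) (V2 t) < 0"
        using pb[OF mU L1.timefield(1) C1_curve_tangent[OF C1 t]] V1T dV by simp
      show "?g2 (\<Phi> (\<mu>1 t)) (?d (\<mu>1 t) (?T1 (\<mu>1 t))) (?d (\<mu>1 t) (?T1 (\<mu>1 t))) \<le> 0" using T1(2)[OF mU] by simp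
    qed (fact L2.timefield T1(1)[OF mU] T1nz[OF mU])+
    then have f0: "f (\<mu>1 t) < 0" by (simp add: f_def)
    have \<Phi>c: "continuous_on U1 \<Phi>" using sm unfolding smooth_map_def by blast
    have id: "continuous_on U1 (\<lambda>x. x)" by (rule continuous_on_id)
    have cf: "continuous_on U1 f"
      unfolding f_def
    proof (rule metric_cont_field[OF L2.atlas L2.sym_tensor \<Phi>c])
      show "cont_field ?A2 U1 \<Phi> (\<lambda>x. ?d x (?T1 x))"
        using cont_field_differential[OF A id _ L1.timefield_cont_field[OF id]] by (simp add: comp_def)
      show "cont_field ?A2 U1 \<Phi> (\<lambda>x. ?T2 (\<Phi> x))" by (rule L2.timefield_cont_field[OF \<Phi>c])
    qed
    show ?thesis
    proof (rule connected_neg[OF U1(2) cf _ mU f0 x])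
      fix y assume y: "y \<in> U1"
      show "f y \<noteq> 0"
        unfolding f_def
        using L2.timelike_causal_nonzero[OF L2.timefield T1(1)[OF y] T1nz[OF y]] T1(2)[OF y]
          metric_sym[OF L2.sym_tensor L2.timefield(1) T1(1)[OF y]] by simp
    qed
  qed
  note vc = L1.future_causalD[OF v]
  have "?g2 (\<Phi> x) (?d x v) (?T2 (\<Phi> x)) < 0"
  proof (rule L2.same_cone[where ?t1.0 = "?d x (?T1 x)"])
    show "?g2 (\<Phi> x) (?d x (?T1 x)) (?T2 (\<Phi> x)) < 0" using fneg[OF x] by (simp add: f_def)
    show "?g2 (\<Phi> x) (?d x v) (?d x v) \<le> 0" using pb[OF x vc(1,1)] vc(3) by simp
    show "?g2 (\<Phi> x) (?d x v) (?d x (?T1 x)) < 0" using pb[OF x vc(1) L1.timefield(1)] vc(4) by simp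
    show "?d x v \<noteq> zero_tvec" using dnz[OF x vc(1) L1.timefield(1)] vc(4) by simp
  qed (fact T1[OF x] L2.timefield dT[OF x vc(1)])+
  then show ?thesis
    unfolding future_causal_def
    using dT[OF x vc(1)] dnz[OF x vc(1) L1.timefield(1)] pb[OF x vc(1,1)] vc(3,4) by simp
qed

text \<open>Some \<open>q \<in> V1\<close> has the same observation set as \<open>\<Phi> z\<close>, so a light ray from \<open>q\<close> reaches
  \<open>z\<close>. If \<open>q \<noteq> z\<close>, then the ray is in \<open>U1\<close> just before \<open>z\<close>; the \<open>\<Phi>\<close>-image of such a point lies
  strictly before \<open>\<Phi> z\<close>, and, being an observation point of \<open>\<Phi> z\<close>, also after it.\<close>

lemma observed_region_preimage:
  fixes M1 :: "('m1::{t2_space, second_countable_topology}, 'n::finite) lorentz"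
    and M2 :: "('m2::{t2_space, second_countable_topology}, 'n) lorentz"
  assumes dim: "CARD('n) \<ge> 2" and gh: "globally_hyperbolic M1" "globally_hyperbolic M2"
    and U1: "open U1" and diff: "diffeomorphism (atlas M1) (atlas M2) U1 U2 \<Phi>"
    and causal: "\<And>x v. x \<in> U1 \<Longrightarrow> future_causal M1 x v \<Longrightarrow>
      future_causal M2 (\<Phi> x) (differential (atlas M1) (atlas M2) \<Phi> x v)"
    and light: "light_observation_points M2 U2 ` V2 \<subseteq> (`) \<Phi> ` light_observation_points M1 U1 ` V1"
    and z: "z \<in> U1" "\<Phi> z \<in> V2"
  shows "z \<in> V1"
proof -
  have M: "lorentzian_manifold M1" "lorentzian_manifold M2" using gh unfolding globally_hyperbolic_def by blast+
  interpret L1: lorentz_mfd M1 by standard (fact M(1))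
  interpret L2: lorentz_mfd M2 by standard (fact M(2))
  have acyc: "\<not> causal_path M1 x x" "\<not> causal_path M2 y y" for x y using gh unfolding globally_hyperbolic_def by blast+
  have sm: "smooth_map (atlas M1) (atlas M2) U1 \<Phi>" and bij: "bij_betw \<Phi> U1 U2"
    using diff unfolding diffeomorphism_def by blast+
  have inj: "inj_on \<Phi> U1" using bij by (rule bij_betw_imp_inj_on)
  have PU: "light_observation_points M1 U1 q \<subseteq> U1" for q unfolding light_observation_points_def by blast
  obtain q where q: "q \<in> V1" "light_observation_points M2 U2 (\<Phi> z) = \<Phi> ` light_observation_points M1 U1 q"
    using light z(2) by blast
  have wU: "\<Phi> z \<in> U2" using bij z(1) by (rule bij_betwE[rule_format])
  \<comment> \<open>Every point of the observed region belongs to its own observation set; this is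
    what places \<open>z\<close> on a light ray from \<open>q\<close>.\<close>
  have "\<Phi> z \<in> \<Phi> ` light_observation_points M1 U1 q"
    using L2.self_light_observation_point[OF dim wU] q(2) by simp
  then have zP: "z \<in> light_observation_points M1 U1 q"
    using inj z(1) PU unfolding inj_on_def by blast
  obtain r \<gamma> V where r: "r \<ge> 0" and \<gamma>: "geodesic (atlas M1) (metric M1) {0..r} \<gamma> V" "\<gamma> 0 = q"
    "future_lightlike M1 q (V 0)" "\<gamma> r = z"
    using zP unfolding light_observation_points_def by blast
  show ?thesis
  proof (cases "r = 0")
    case True
    then show ?thesis using \<gamma> q by simp
  next
    case False
    then have r0: "r > 0" using r by simp
    note C = geodesic_C1_curve[OF \<gamma>(1)]
    have fc: "future_causal M1 (\<gamma> t) (V t)" if "t \<in> {0..r}" for t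
      using L1.null_geodesic_future_causal[OF \<gamma>(1) _ that] \<gamma>(2,3) by simp
    have "\<forall>\<^sub>F s in at r within {0..r}. s \<in> {0..r} \<and> \<gamma> s \<in> U1"
      by (rule eventually_curve_in[OF C1_curve_continuous[OF C] _ U1]) (use r z \<gamma> in auto)
    then obtain e where e: "e > 0" "\<And>s. s \<in> {0..r} \<Longrightarrow> s \<noteq> r \<Longrightarrow> dist s r < e \<Longrightarrow> \<gamma> s \<in> U1"
      unfolding eventually_at by blast
    \<comment> \<open>Close enough to \<open>r\<close> for the rest of the ray to be in
      \<open>U1\<close>; the maximum keeps the parameter on the ray.\<close>
    define t where "t = max 0 (r - e / 2)"
    have t: "t \<in> {0..r}" "t < r" "{t..r} \<subseteq> {0..r}" using r0 e(1) by (auto simp: t_def)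
    have tU: "\<gamma> s \<in> U1" if "s \<in> {t..r}" for s
    proof (cases "s = r")
      case True
      then show ?thesis using z \<gamma> by simp
    next
      case False
      have "dist s r < e" using that e(1) by (auto simp: t_def dist_real_def)
      then show ?thesis using e(2)[OF _ False] that t by auto
    qed
    have yU: "\<gamma> t \<in> U1" using tU t by simp
    have "geodesic (atlas M1) (metric M1) {0..t} \<gamma> V" by (rule geodesic_subset[OF \<gamma>(1)]) (use t in auto)
    then have "\<gamma> t \<in> light_observation_points M1 U1 q"
      unfolding light_observation_points_def using yU \<gamma>(2,3) t(1) by auto
    then have "\<Phi> (\<gamma> t) \<in> light_observation_points M2 U2 (\<Phi> z)" using q(2) by blast
    then obtain r' \<gamma>' V' where r': "r' \<ge> 0" and \<gamma>': "geodesic (atlas M2) (metric M2) {0..r'} \<gamma>' V'" "\<gamma>' 0 = \<Phi> z"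
      "future_lightlike M2 (\<Phi> z) (V' 0)" "\<gamma>' r' = \<Phi> (\<gamma> t)"
      unfolding light_observation_points_def by blast
    have Ct: "C1_curve (atlas M1) {t..r} \<gamma> V" by (rule C1_curve_subset[OF C t(3)])
    \<comment> \<open>For \<open>r' = 0\<close> injectivity of \<Phi> closes up a causal curve in
      \<open>M1\<close>; otherwise the light ray from \<open>\<Phi> z\<close> and the image of the
      end of the first ray form a closed causal path in \<open>M2\<close>.\<close>
    have False
    proof (cases "r' = 0")
      case True
      then have "\<Phi> (\<gamma> t) = \<Phi> z" using \<gamma>' by simp
      then have "\<gamma> t = z" using inj yU z(1) unfolding inj_on_def by blast
      moreover have "causal_segment M1 (\<gamma> t) (\<gamma> r)"
        by (rule L1.causal_segmentI[OF Ct t(2)]) (use fc t(3) in blast)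
      ultimately have "causal_path M1 z z" using \<gamma>(4) unfolding causal_path_def by auto
      then show False using acyc by blast
    next
      case False
      then have "causal_segment M2 (\<gamma>' 0) (\<gamma>' r')"
        using r' L2.null_geodesic_future_causal[OF \<gamma>'(1)] \<gamma>'(2,3)
        by (intro L2.causal_segmentI[OF geodesic_C1_curve[OF \<gamma>'(1)]]) auto
      then have 1: "causal_segment M2 (\<Phi> z) (\<Phi> (\<gamma> t))" using \<gamma>' by simp
      have "causal_segment M2 ((\<Phi> \<circ> \<gamma>) t) ((\<Phi> \<circ> \<gamma>) r)"
      proof (rule L2.causal_segmentI[OF C1_curve_image[OF L1.atlas L2.atlas U1 sm Ct] t(2)])
        show "\<gamma> ` {t..r} \<subseteq> U1" using tU by blast
        show "future_causal M2 ((\<Phi> \<circ> \<gamma>) s) (differential (atlas M1) (atlas M2) \<Phi> (\<gamma> s) (V s))" if "s \<in> {t..r}" for s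
          using causal[OF tU[OF that] fc] that t(3) by auto
      qed
      then have 2: "causal_segment M2 (\<Phi> (\<gamma> t)) (\<Phi> z)" using \<gamma>(4) by simp
      have "causal_path M2 (\<Phi> z) (\<Phi> z)"
        unfolding causal_path_def using 1 2 by (meson tranclp.r_into_trancl tranclp.trancl_into_trancl)
      then show False using acyc by blast
    qed
    then show ?thesis ..
  qed
qed

section \<open>The conformal factor\<close>

text \<open>Coordinate components of d\<omega> for \<omega> = (ln \<open>s\<close>) / 2, that is
  \<open>s\<close> = exp(2 \<omega>).\<close>

definition half_log_grad :: "(real^'n::finite \<Rightarrow> real) \<Rightarrow> real^'n \<Rightarrow> real^'n" where
  "half_log_grad s p = (\<chi> i. fd s p (axis i 1) / (2 * s p))"

lemma half_log_grad_inner: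
  assumes "s differentiable (at p)"
  shows "half_log_grad s p \<bullet> b = fd s p b / (2 * s p)"
proof -
  have "linear (fd s p)" using assms frechet_derivative_works has_derivative_linear by blast
  from linear_sum_axis[OF this, of b] show ?thesis
    by (simp add: half_log_grad_def inner_vec_def sum_divide_distrib mult.commute)
qed

lemma half_log_grad_differentiable:
  assumes "smooth_on s S" "p \<in> S" "s p \<noteq> 0"
  shows "half_log_grad s differentiable (at p)"
  unfolding half_log_grad_def
  by (intro differentiable_vec_lambda differentiable_divide differentiable_mult differentiable_const
      smooth_on_differentiable[OF smooth_on_fd[OF assms(1)] assms(2)]
      smooth_on_differentiable[OF assms(1,2)]) (use assms(3) in simp)

text \<open>The coordinate picture of \<Psi> between one chart of each manifold, with
  \<open>s\<close> as the conformal factor.\<close>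

locale conformal_charts =
  m1: metric_chart A1 g1 c G1 S1 + m2: metric_chart A2 g2 d G2 S2
  for A1 :: "('m1, 'n::finite) chart set" and g1 c G1 S1
    and A2 :: "('m2, 'n) chart set" and g2 d G2 S2 +
  fixes S :: "(real^'n) set" and f :: "real^'n \<Rightarrow> real^'n" and s :: "real^'n \<Rightarrow> real"
  assumes S_open: "open S" and S_sub: "S \<subseteq> S1" and f: "smooth_on f S" "f ` S \<subseteq> S2"
    and s: "smooth_on s S" "\<And>p. p \<in> S \<Longrightarrow> s p > 0"
    and conf: "\<And>p a b. p \<in> S \<Longrightarrow> fd f p a \<bullet> (G2 (f p) *v fd f p b) = s p * (a \<bullet> (G1 p *v b))"
begin

text \<open>The gradient vector of \<omega> with respect to \<open>G1\<close>. It enters the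
  conformally changed connection \<open>\<Gamma>c\<close> below.\<close>

definition X :: "real^'n \<Rightarrow> real^'n" where
  "X p = matrix_inv (G1 p) *v half_log_grad s p"

definition \<Gamma>c :: "real^'n \<Rightarrow> real^'n \<Rightarrow> real^'n \<Rightarrow> real^'n" where
  "\<Gamma>c p b e = m1.\<Gamma> p b e + ((half_log_grad s p \<bullet> b) *\<^sub>R e + (half_log_grad s p \<bullet> e) *\<^sub>R b - (b \<bullet> (G1 p *v e)) *\<^sub>R X p)"

lemma in_S1: "p \<in> S \<Longrightarrow> p \<in> S1" using S_sub by blast
lemma in_S2: "p \<in> S \<Longrightarrow> f p \<in> S2" using f(2) by blast

lemma s_deriv: "p \<in> S \<Longrightarrow> (s has_derivative fd s p) (at p)"
  by (rule smooth_on_has_derivative[OF s(1)])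

lemma f_deriv: "p \<in> S \<Longrightarrow> (f has_derivative fd f p) (at p)"
  by (rule smooth_on_has_derivative[OF f(1)])

lemma grad_inner: "p \<in> S \<Longrightarrow> half_log_grad s p \<bullet> b = fd s p b / (2 * s p)"
  by (rule half_log_grad_inner[OF smooth_on_differentiable[OF s(1)]])

lemma grad_differentiable: "p \<in> S \<Longrightarrow> half_log_grad s differentiable (at p)"
  using half_log_grad_differentiable[OF s(1)] s(2) by force

lemma G1_X: "p \<in> S \<Longrightarrow> G1 p *v X p = half_log_grad s p"
  unfolding X_def by (simp add: matrix_vector_mul_assoc matrix_inv_mult(1)[OF m1.inv[OF in_S1]])

lemma X_differentiable:
  assumes p: "p \<in> S" shows "X differentiable (at p)"
proof -
  have "(\<lambda>p. \<chi> i. \<Sum>j\<in>UNIV. matrix_inv (G1 p) $ i $ j * half_log_grad s p $ j) differentiable (at p)"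
    by (intro differentiable_vec_lambda differentiable_sum ballI finite differentiable_mult
      differentiable_vec_nth[OF grad_differentiable[OF p]]
      differentiable_matrix_inv[OF m1.S in_S1[OF p] m1.inv m1.G_diff[OF in_S1[OF p]]])
  then show ?thesis by (simp add: X_def[abs_def] matrix_vector_mult_def)
qed

text \<open>A vector in the kernel is orthogonal to everything for \<open>G2\<close>, hence for
  \<open>G1\<close>, which is nondegenerate.\<close>

lemma fd_f_inj: assumes p: "p \<in> S" shows "inj (fd f p)"
proof (subst linear_injective_0[OF has_derivative_linear[OF f_deriv[OF p]]], intro allI impI)
  fix a assume "fd f p a = 0"
  then have "s p * (b \<bullet> (G1 p *v a)) = 0" for b using conf[OF p, of b a] by simp
  then have "b \<bullet> (G1 p *v a) = b \<bullet> (G1 p *v 0)" for b using s(2)[OF p] by simp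
  then show "a = 0" by (rule m1.G_cancel[OF in_S1[OF p]])
qed

text \<open>The pulled back connection of \<open>g2\<close> is \<open>\<Gamma>c\<close>: both sides satisfy Koszul's formula for the
  metric \<open>s G1\<close>, which is the pull-back of \<open>G2\<close>.\<close>

lemma connection_transform:
  assumes p: "p \<in> S"
  shows "fd f p (\<Gamma>c p b e) = m2.\<Gamma> (f p) (fd f p b) (fd f p e) + fd (\<lambda>q. fd f q e) p b"
proof (rule m2.G_cancel[OF in_S2[OF p]])
  fix y
  let ?L = "fd f p" and ?G = "G2 (f p)" and ?G' = "fd G2 (f p)" and ?H = "fd G1 p"
  let ?D = "\<lambda>k a. fd (\<lambda>q. fd f q a) p k"
  have linL: "linear ?L" using has_derivative_linear[OF f_deriv[OF p]] .
  \<comment> \<open>Every test vector is therefore the image of some \<open>x\<close>, which brings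
    the comparison back to \<open>G1\<close>.\<close>
  have "surj ?L" by (rule linear_injective_imp_surjective[OF linL fd_f_inj[OF p] refl])
  then obtain x where y: "y = ?L x" by (metis surjD)
  have D_sym: "?D a b = ?D b a" for a b
    by (rule smooth_mixed_derivatives_commute[OF S_open p f(1)])
  have G_sym: "a \<bullet> (?G *v b) = b \<bullet> (?G *v a)" for a b
    by (rule sym_matrix_inner[OF m2.sym[OF in_S2[OF p]]])
  \<comment> \<open>The conformality relation \<open>conf\<close>, differentiated in direction
    \<open>k\<close>.\<close>
  have id: "s p * (a \<bullet> (?H k *v b)) + fd s p k * (a \<bullet> (G1 p *v b)) =
     ?L a \<bullet> (?G *v ?D k b) + ?L a \<bullet> (?G' (?L k) *v ?L b) + ?D k a \<bullet> (?G *v ?L b)" for a b k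
  proof -
    have dL: "((\<lambda>q. fd f q a) has_derivative (\<lambda>k. ?D k a)) (at p)" for a
      by (rule smooth_on_has_derivative[OF smooth_on_fd[OF f(1)] p])
    have dG: "((\<lambda>q. G2 (f q)) has_derivative (\<lambda>k. ?G' (?L k))) (at p)"
      by (rule has_derivative_compose[OF f_deriv[OF p] m2.G_has_derivative[OF in_S2[OF p]]])
    have 1: "((\<lambda>q. fd f q a \<bullet> (G2 (f q) *v fd f q b)) has_derivative
       (\<lambda>k. ?L a \<bullet> (?G *v ?D k b + ?G' (?L k) *v ?L b) + ?D k a \<bullet> (?G *v ?L b))) (at p)"
      by (rule has_derivative_inner[OF dL bounded_bilinear.FDERIV[OF bounded_bilinear_matrix_vector_mult dG dL]])
    have dH: "((\<lambda>q. a \<bullet> (G1 q *v b)) has_derivative (\<lambda>k. a \<bullet> (?H k *v b))) (at p)"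
      by (rule has_derivative_inner_right[OF has_derivative_matrix_vector_mult[OF m1.G_has_derivative[OF in_S1[OF p]]]])
    have "((\<lambda>q. s q * (a \<bullet> (G1 q *v b))) has_derivative
       (\<lambda>k. s p * (a \<bullet> (?H k *v b)) + fd s p k * (a \<bullet> (G1 p *v b)))) (at p)"
      by (rule has_derivative_mult[OF s_deriv[OF p] dH])
    then have "((\<lambda>q. fd f q a \<bullet> (G2 (f q) *v fd f q b)) has_derivative
       (\<lambda>k. s p * (a \<bullet> (?H k *v b)) + fd s p k * (a \<bullet> (G1 p *v b)))) (at p)"
      by (rule has_derivative_transform_within_open[OF _ S_open p]) (simp add: conf)
    from fun_cong[OF has_derivative_unique[OF this 1], of k] show ?thesis by (simp add: inner_add_right)
  qed
  have k1: "2 * (x \<bullet> (G1 p *v m1.\<Gamma> p b e)) = e \<bullet> (?H b *v x) + b \<bullet> (?H e *v x) - b \<bullet> (?H x *v e)"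
    by (rule m1.christoffel_form_koszul[OF in_S1[OF p]])
  have k2: "2 * (?L x \<bullet> (?G *v m2.\<Gamma> (f p) (?L b) (?L e))) =
     ?L e \<bullet> (?G' (?L b) *v ?L x) + ?L b \<bullet> (?G' (?L e) *v ?L x) - ?L b \<bullet> (?G' (?L x) *v ?L e)"
    by (rule m2.christoffel_form_koszul[OF in_S2[OF p]])
  have grad: "2 * (s p * (half_log_grad s p \<bullet> b)) = fd s p b" for b
    using grad_inner[OF p, of b] s(2)[OF p] by simp
  have "2 * (y \<bullet> (?G *v ?L (\<Gamma>c p b e))) = s p * (2 * (x \<bullet> (G1 p *v \<Gamma>c p b e)))"
    unfolding y using conf[OF p, of x "\<Gamma>c p b e"] by simp
  also have "\<dots> = s p * (2 * (x \<bullet> (G1 p *v m1.\<Gamma> p b e)))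
      + (2 * (s p * (half_log_grad s p \<bullet> b))) * (x \<bullet> (G1 p *v e))
      + (2 * (s p * (half_log_grad s p \<bullet> e))) * (x \<bullet> (G1 p *v b))
      - (2 * (s p * (half_log_grad s p \<bullet> x))) * (b \<bullet> (G1 p *v e))"
    unfolding \<Gamma>c_def
    by (simp add: matrix_vector_right_distrib matrix_vector_mult_diff_distrib matrix_vector_mult_scaleR
      inner_add_right inner_diff_right G1_X[OF p] inner_commute[of x "half_log_grad s p"] algebra_simps)
  also have "\<dots> = s p * (e \<bullet> (?H b *v x)) + s p * (b \<bullet> (?H e *v x)) - s p * (b \<bullet> (?H x *v e))
      + fd s p b * (e \<bullet> (G1 p *v x)) + fd s p e * (b \<bullet> (G1 p *v x)) - fd s p x * (b \<bullet> (G1 p *v e))"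
    unfolding k1 grad sym_matrix_inner[OF m1.sym[OF in_S1[OF p]], of x e]
      sym_matrix_inner[OF m1.sym[OF in_S1[OF p]], of x b] by (simp add: algebra_simps)
  \<comment> \<open>Three instances of \<open>id\<close>, in the directions \<open>b\<close>,
    \<open>e\<close> and \<open>x\<close>, combined as in Koszul's formula. By symmetry of second
    derivatives only \<open>?D b e\<close> survives, and it appears twice.\<close>
  also have "\<dots> = 2 * (?L x \<bullet> (?G *v m2.\<Gamma> (f p) (?L b) (?L e))) + 2 * (?L x \<bullet> (?G *v ?D b e))"
    using id[of e b x] id[of b e x] id[of b x e] D_sym[of b e] D_sym[of x b] D_sym[of x e]
      G_sym[of "?L x" "?D b e"] G_sym[of "?L e" "?D b x"] G_sym[of "?L b" "?D e x"] unfolding k2 by simp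
  finally show "y \<bullet> (?G *v ?L (\<Gamma>c p b e)) = y \<bullet> (?G *v (m2.\<Gamma> (f p) (?L b) (?L e) + ?D b e))"
    unfolding y by (simp add: matrix_vector_right_distrib inner_add_right)
qed

lemma \<Gamma>c_bilinear: "bilinear (\<Gamma>c p)"
  unfolding bilinear_def \<Gamma>c_def
  using bilinear_ladd[OF bilinear_christoffel_form] bilinear_radd[OF bilinear_christoffel_form]
    bilinear_lmul[OF bilinear_christoffel_form] bilinear_rmul[OF bilinear_christoffel_form]
  by (intro conjI allI linearI) (simp_all add: matrix_vector_right_distrib matrix_vector_mult_scaleR
    inner_add_left inner_add_right scaleR_add_left scaleR_add_right scaleR_diff_right mult.commute)

lemma \<Gamma>c_differentiable:
  assumes p: "p \<in> S" shows "(\<lambda>q. \<Gamma>c q b e) differentiable (at p)"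
proof -
  note d = frechet_derivative_works[THEN iffD1, OF m1.christoffel_form_differentiable[OF in_S1[OF p]]]
    frechet_derivative_works[THEN iffD1, OF grad_differentiable[OF p]]
    frechet_derivative_works[THEN iffD1, OF X_differentiable[OF p]]
    m1.G_has_derivative[OF in_S1[OF p]]
  show ?thesis
    unfolding \<Gamma>c_def differentiable_def
    by (rule exI) (rule has_derivative_add has_derivative_diff has_derivative_scaleR has_derivative_inner_left
        has_derivative_inner_right has_derivative_scaleR_left has_derivative_matrix_vector_mult d)+
qed

text \<open>The Ricci form of \<open>\<Gamma>c\<close> is computed in two ways: as that of a
  conformal change of the first connection, and as that of the pull-back of the second.\<close>

lemma ric_null:
  assumes p: "p \<in> S" and null: "v \<bullet> (G1 p *v v) = 0"
  shows "ric m2.\<Gamma> (f p) (fd f p v) = ric m1.\<Gamma> p v - (real CARD('n) - 2) *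
    (fd (half_log_grad s) p v \<bullet> v - half_log_grad s p \<bullet> m1.\<Gamma> p v v - (half_log_grad s p \<bullet> v)\<^sup>2)"
proof -
  have "ric \<Gamma>c p v = ric m1.\<Gamma> p v - (real CARD('n) - 2) *
    (fd (half_log_grad s) p v \<bullet> v - half_log_grad s p \<bullet> m1.\<Gamma> p v v - (half_log_grad s p \<bullet> v)\<^sup>2)"
    by (rule ric_conformal[OF S_open p m1.sym[OF in_S1[OF p]] m1.G_has_derivative[OF in_S1[OF p]]
        bilinear_christoffel_form m1.christoffel_form_sym[OF in_S1[OF p]] m1.christoffel_form_compat[OF in_S1[OF p]]
        m1.christoffel_form_differentiable[OF in_S1[OF p]]
        frechet_derivative_works[THEN iffD1, OF grad_differentiable[OF p]]
        frechet_derivative_works[THEN iffD1, OF X_differentiable[OF p]] G1_X null])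
      (simp_all add: \<Gamma>c_def[abs_def])
  moreover have "ric \<Gamma>c p v = ric m2.\<Gamma> (f p) (fd f p v)"
    by (rule ric_transform[OF S_open p f(1) m2.S f(2) fd_f_inj[OF p] \<Gamma>c_bilinear bilinear_christoffel_form
        \<Gamma>c_differentiable[OF p] m2.christoffel_form_differentiable[OF in_S2[OF p]] connection_transform])
  ultimately show ?thesis by simp
qed

end

section \<open>Light rays in Ricci flat regions\<close>

lemma ricci_zero_ric:
  assumes "smooth_atlas A" "lorentzian_metric A g" "ricci_zero_on A g W" "x \<in> W" "c \<in> A" "x \<in> cdom c"
  shows "ric (christoffel_form A g c) (cmap c x) v = 0"
proof -
  interpret mc: metric_chart A g c "metric_matrix A g c" "cimg c" by (rule metric_chartI[OF assms(1,2,5)])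
  have u: "cmap c x \<in> cimg c" using assms(6) by blast
  have "ricci A g c i j (cmap c x) = 0" for i j
    using assms(3-6) unfolding ricci_zero_on_def by blast
  then show ?thesis using mc.ricci_contract[OF u, of v] by simp
qed

text \<open>The left side is the Hessian of \<omega> on \<open>v\<close> minus the square of
  d\<omega>(\<open>v\<close>), in the chart \<open>c\<close>. Both Ricci forms vanish at the points
  concerned, so \<open>ric_null\<close> makes its product with n - 2 equal to 0, and n - 2 is not
  0.\<close>

lemma conformal_factor_null_equation:
  fixes M1 :: "('m1::{t2_space, second_countable_topology}, 'n::finite) lorentz"
    and M2 :: "('m2::{t2_space, second_countable_topology}, 'n) lorentz"
  assumes n: "CARD('n) \<ge> 3" and M: "lorentzian_manifold M1" "lorentzian_manifold M2"
    and V: "open V1" "smooth_map (atlas M1) (atlas M2) V1 \<Psi>"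
    and \<sigma>: "smooth_fun (atlas M1) V1 \<sigma>" "\<And>x. x \<in> V1 \<Longrightarrow> \<sigma> x > 0"
    and pb: "\<And>x v w. x \<in> V1 \<Longrightarrow> v \<in> tangent_space (atlas M1) x \<Longrightarrow> w \<in> tangent_space (atlas M1) x \<Longrightarrow>
      pullback_metric (atlas M1) (atlas M2) \<Psi> (metric M2) x v w = \<sigma> x * metric M1 x v w"
    and ric: "ricci_zero_on (atlas M1) (metric M1) W1" "ricci_zero_on (atlas M2) (metric M2) W2"
    and x: "x \<in> V1" "x \<in> W1" "\<Psi> x \<in> W2" and v: "v \<in> tangent_space (atlas M1) x" "metric M1 x v v = 0"
    and c: "c \<in> atlas M1" "x \<in> cdom c"
  shows "fd (half_log_grad (\<sigma> \<circ> cinv c)) (cmap c x) (v c) \<bullet> v c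
     - half_log_grad (\<sigma> \<circ> cinv c) (cmap c x) \<bullet> christoffel_form (atlas M1) (metric M1) c (cmap c x) (v c) (v c)
     - (half_log_grad (\<sigma> \<circ> cinv c) (cmap c x) \<bullet> v c)\<^sup>2 = 0"
proof -
  interpret L1: lorentz_mfd M1 by standard (fact M(1))
  interpret L2: lorentz_mfd M2 by standard (fact M(2))
  note A = L1.atlas L2.atlas V
  obtain d where d: "d \<in> atlas M2" "\<Psi> x \<in> cdom d" by (rule chart_exists[OF L2.atlas])
  let ?S = "cmap c ` (V1 \<inter> cdom c \<inter> \<Psi> -` cdom d)" and ?f = "cmap d \<circ> \<Psi> \<circ> cinv c"
  let ?G1 = "metric_matrix (atlas M1) (metric M1) c" and ?G2 = "metric_matrix (atlas M2) (metric M2) d"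
  interpret m1: metric_chart "atlas M1" "metric M1" c ?G1 "cimg c" by (rule metric_chartI[OF L1.atlas L1.lorentz c(1)])
  interpret m2: metric_chart "atlas M2" "metric M2" d ?G2 "cimg d" by (rule metric_chartI[OF L2.atlas L2.lorentz d(1)])
  note S = smooth_map_coords[OF A c(1) d(1)]
  have cinv: "cinv c (cmap c y) = y" if "y \<in> cdom c" for y by (rule cinv_cmap[OF L1.atlas c(1) that])
  interpret conformal_charts "atlas M1" "metric M1" c ?G1 "cimg c" "atlas M2" "metric M2" d ?G2 "cimg d" ?S ?f "\<sigma> \<circ> cinv c"
  proof
    show "open ?S" "smooth_on ?f ?S" by (rule S)+
    show "?S \<subseteq> cimg c" by blast
    show "?f ` ?S \<subseteq> cimg d" using cinv by auto
    have "smooth_on (\<sigma> \<circ> cinv c) (cmap c ` (V1 \<inter> cdom c))" using \<sigma>(1) c(1) unfolding smooth_fun_def by blast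
    then show "smooth_on (\<sigma> \<circ> cinv c) ?S"
      by (rule smooth_on_subset) blast
    show "0 < (\<sigma> \<circ> cinv c) p" if "p \<in> ?S" for p using that \<sigma>(2) cinv by auto
    fix p a b assume "p \<in> ?S"
    then obtain y where y: "p = cmap c y" "y \<in> V1" "y \<in> cdom c" "\<Psi> y \<in> cdom d" by blast
    let ?t = "tvec_of (atlas M1) c y" and ?d = "differential (atlas M1) (atlas M2) \<Psi> y"
    note t = tvec_of_tangent[OF L1.atlas c(1) y(3)]
    have dt: "?d (?t a) \<in> tangent_space (atlas M2) (\<Psi> y)" "?d (?t a) d = fd ?f p a" for a
      using differential_tangent[OF A y(2) t(1)] differential_chart[OF A y(2) c(1) y(3) d(1) y(4) t(1)] t(2) y(1) by simp_all
    have "fd ?f p a \<bullet> (?G2 (cmap d (\<Psi> y)) *v fd ?f p b) = metric M2 (\<Psi> y) (?d (?t a)) (?d (?t b))"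
      unfolding metric_chart_eq[OF L2.sym_tensor dt(1) dt(1) d(1) y(4)] dt(2) ..
    also have "\<dots> = \<sigma> y * metric M1 y (?t a) (?t b)"
      using pb[OF y(2) t(1) t(1)] unfolding pullback_metric_def .
    also have "\<dots> = \<sigma> y * (a \<bullet> (?G1 p *v b))"
      unfolding metric_chart_eq[OF L1.sym_tensor t(1) t(1) c(1) y(3)] t(2) y(1) ..
    finally show "fd ?f p a \<bullet> (?G2 (?f p) *v fd ?f p b) = (\<sigma> \<circ> cinv c) p * (a \<bullet> (?G1 p *v b))"
      using y cinv by simp
  qed
  have u: "cmap c x \<in> ?S" using x c d by blast
  have fu: "?f (cmap c x) = cmap d (\<Psi> x)" using cinv c by simp
  have null: "v c \<bullet> (?G1 (cmap c x) *v v c) = 0"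
    using metric_chart_eq[OF L1.sym_tensor v(1) v(1) c] v(2) by simp
  have "ric (christoffel_form (atlas M1) (metric M1) c) (cmap c x) (v c) = 0"
    by (rule ricci_zero_ric[OF L1.atlas L1.lorentz ric(1) x(2) c])
  moreover have "ric (christoffel_form (atlas M2) (metric M2) d) (?f (cmap c x)) (fd ?f (cmap c x) (v c)) = 0"
    unfolding fu by (rule ricci_zero_ric[OF L2.atlas L2.lorentz ric(2) x(3) d])
  ultimately show ?thesis using ric_null[OF u null] n by simp
qed

text \<open>With \<phi> = exp(-\<omega>) one has \<phi>' = -\<phi> d\<omega>(V), and the second
  derivative is -\<phi> times the left side of \<open>eq\<close>. So \<phi> is affine in the
  parameter, and two parameters with the value 1 determine it.\<close>

lemma conformal_factor_transport:
  fixes M :: "('m::{t2_space, second_countable_topology}, 'n::finite) lorentz"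
  assumes M: "lorentzian_manifold M" and V: "open V1"
    and \<sigma>: "smooth_fun (atlas M) V1 \<sigma>" "\<And>x. x \<in> V1 \<Longrightarrow> \<sigma> x > 0"
    and \<gamma>: "geodesic (atlas M) (metric M) {0..l} \<gamma> V" and l: "l > 0" and \<gamma>V: "\<gamma> ` {0..l} \<subseteq> V1"
    and eq: "\<And>t c. t \<in> {0..l} \<Longrightarrow> c \<in> atlas M \<Longrightarrow> \<gamma> t \<in> cdom c \<Longrightarrow>
      fd (half_log_grad (\<sigma> \<circ> cinv c)) (cmap c (\<gamma> t)) (V t c) \<bullet> V t c
       - half_log_grad (\<sigma> \<circ> cinv c) (cmap c (\<gamma> t)) \<bullet> christoffel_form (atlas M) (metric M) c (cmap c (\<gamma> t)) (V t c) (V t c)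
       - (half_log_grad (\<sigma> \<circ> cinv c) (cmap c (\<gamma> t)) \<bullet> V t c)\<^sup>2 = 0"
    and one: "\<forall>\<^sub>F t in at l within {0..l}. \<sigma> (\<gamma> t) = 1" "\<sigma> (\<gamma> l) = 1"
  shows "\<sigma> (\<gamma> 0) = 1"
proof -
  interpret L: lorentz_mfd M by standard (fact M)
  let ?A = "atlas M" and ?g = "metric M" and ?I = "{0..l}"
  note C = geodesic_C1_curve[OF \<gamma>]
  define \<phi> where "\<phi> = (\<lambda>t. 1 / sqrt (\<sigma> (\<gamma> t)))"
  \<comment> \<open>The derivative of \<phi> is named without reference to a chart;
    \<open>\<psi>_eq\<close> then expresses it in whichever chart contains the point, so that it can
    be differentiated locally.\<close>
  define \<psi> where "\<psi> = (\<lambda>t. vector_derivative \<phi> (at t within ?I))"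
  have pos: "\<sigma> (\<gamma> t) > 0" if "t \<in> ?I" for t using \<sigma>(2) \<gamma>V that by blast
  have d1: "(\<phi> has_vector_derivative - (\<phi> t * (half_log_grad (\<sigma> \<circ> cinv c) (cmap c (\<gamma> t)) \<bullet> V t c))) (at t within ?I)"
    if t: "t \<in> ?I" and c: "c \<in> ?A" "\<gamma> t \<in> cdom c" for t c
  proof -
    let ?s = "\<sigma> \<circ> cinv c" and ?u = "\<lambda>t. cmap c (\<gamma> t)"
    let ?S = "cmap c ` (V1 \<inter> cdom c)"
    have sm: "smooth_on ?s ?S" using \<sigma>(1) c(1) unfolding smooth_fun_def by blast
    have u: "?u t \<in> ?S" using \<gamma>V t c by blast
    have su: "?s (?u s) = \<sigma> (\<gamma> s)" if "\<gamma> s \<in> cdom c" for s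
      using cinv_cmap[OF L.atlas c(1) that] by simp
    have "(?s \<circ> ?u has_vector_derivative fd ?s (?u t) (V t c)) (at t within ?I)"
      by (rule vector_derivative_diff_chain_within[OF C1_curve_deriv[OF C t c]
        has_derivative_at_withinI[OF smooth_on_has_derivative[OF sm u]]])
    moreover have "\<forall>\<^sub>F s in at t within ?I. (?s \<circ> ?u) s = \<sigma> (\<gamma> s)"
      using eventually_curve_in[OF C1_curve_continuous[OF C] t smooth_atlasD(1)[OF L.atlas c(1)] c(2)]
      by eventually_elim (use su in simp)
    ultimately have "((\<lambda>s. \<sigma> (\<gamma> s)) has_vector_derivative fd ?s (?u t) (V t c)) (at t within ?I)"
      unfolding has_vector_derivative_def
      by (rule has_derivative_transform_eventually) (use c t su in auto)
    then have "((\<lambda>s. \<sigma> (\<gamma> s)) has_real_derivative fd ?s (?u t) (V t c)) (at t within ?I)"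
      by (simp add: has_real_derivative_iff_has_vector_derivative)
    then have "(\<phi> has_real_derivative - (\<phi> t * (fd ?s (?u t) (V t c) / (2 * ?s (?u t))))) (at t within ?I)"
      unfolding \<phi>_def using pos[OF t] su[OF c(2)]
      by (auto intro!: derivative_eq_intros simp: field_simps)
    then show ?thesis
      unfolding half_log_grad_inner[OF smooth_on_differentiable[OF sm u]]
      by (simp add: has_real_derivative_iff_has_vector_derivative)
  qed
  have \<psi>_eq: "\<psi> t = - (\<phi> t * (half_log_grad (\<sigma> \<circ> cinv c) (cmap c (\<gamma> t)) \<bullet> V t c))"
    if t: "t \<in> ?I" and c: "c \<in> ?A" "\<gamma> t \<in> cdom c" for t c
    unfolding \<psi>_def using vector_derivative_within_closed_interval[OF l t d1[OF that]] .
  have \<phi>': "(\<phi> has_vector_derivative \<psi> t) (at t within ?I)" if t: "t \<in> ?I" for t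
  proof -
    obtain c where c: "c \<in> ?A" "\<gamma> t \<in> cdom c" by (rule chart_exists[OF L.atlas])
    show ?thesis unfolding \<psi>_eq[OF t c] by (rule d1[OF t c])
  qed
  have "\<exists>k. \<forall>t\<in>?I. \<psi> t = k"
  proof (rule has_derivative_zero_constant[OF convex_closed_interval])
    fix t assume t: "t \<in> ?I"
    obtain c where c: "c \<in> ?A" "\<gamma> t \<in> cdom c" by (rule chart_exists[OF L.atlas])
    let ?s = "\<sigma> \<circ> cinv c" and ?u = "\<lambda>t. cmap c (\<gamma> t)" and ?v = "\<lambda>t. V t c"
    let ?w = "half_log_grad ?s"
    let ?v' = "- christoffel_form ?A ?g c (?u t) (?v t) (?v t)"
    let ?S = "cmap c ` (V1 \<inter> cdom c)"
    have sm: "smooth_on ?s ?S" using \<sigma>(1) c(1) unfolding smooth_fun_def by blast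
    have u: "?u t \<in> ?S" using \<gamma>V t c by blast
    have nz: "?s (?u t) \<noteq> 0" using pos[OF t] cinv_cmap[OF L.atlas c] by simp
    have dw: "(?w has_derivative fd ?w (?u t)) (at (?u t))"
      using half_log_grad_differentiable[OF sm u nz] frechet_derivative_works by blast
    have 1: "((\<lambda>s. ?w (?u s)) has_derivative (\<lambda>h. fd ?w (?u t) (h *\<^sub>R ?v t))) (at t within ?I)"
      by (rule has_derivative_compose[OF C1_curve_deriv[OF C t c, unfolded has_vector_derivative_def] dw])
    have 2: "(?v has_derivative (\<lambda>h. h *\<^sub>R ?v')) (at t within ?I)"
      using geodesic_velocity_deriv[OF \<gamma> t c] by (simp only: has_vector_derivative_def)
    have 3: "(\<phi> has_derivative (\<lambda>h. h *\<^sub>R - (\<phi> t * (?w (?u t) \<bullet> ?v t)))) (at t within ?I)"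
      using d1[OF t c] by (simp only: has_vector_derivative_def)
    have "((\<lambda>s. - (\<phi> s * (?w (?u s) \<bullet> ?v s))) has_derivative
      (\<lambda>h. - (\<phi> t * (?w (?u t) \<bullet> (h *\<^sub>R ?v') + fd ?w (?u t) (h *\<^sub>R ?v t) \<bullet> ?v t)
         + (h *\<^sub>R - (\<phi> t * (?w (?u t) \<bullet> ?v t))) * (?w (?u t) \<bullet> ?v t)))) (at t within ?I)"
      by (rule has_derivative_minus[OF has_derivative_mult[OF 3 has_derivative_inner[OF 1 2]]])
    also have "(\<lambda>h. - (\<phi> t * (?w (?u t) \<bullet> (h *\<^sub>R ?v') + fd ?w (?u t) (h *\<^sub>R ?v t) \<bullet> ?v t)
         + (h *\<^sub>R - (\<phi> t * (?w (?u t) \<bullet> ?v t))) * (?w (?u t) \<bullet> ?v t))) = (\<lambda>h. 0)"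
    proof
      fix h
      have "fd ?w (?u t) (h *\<^sub>R ?v t) = h *\<^sub>R fd ?w (?u t) (?v t)"
        using has_derivative_linear[OF dw] by (rule linear_scale)
      \<comment> \<open>The geodesic equation has put the Christoffel term in place of the
        acceleration, which completes the Hessian; the square comes from differentiating the factor
        \<phi>.\<close>
      then have "- (\<phi> t * (?w (?u t) \<bullet> (h *\<^sub>R ?v') + fd ?w (?u t) (h *\<^sub>R ?v t) \<bullet> ?v t)
         + (h *\<^sub>R - (\<phi> t * (?w (?u t) \<bullet> ?v t))) * (?w (?u t) \<bullet> ?v t))
         = - (h * \<phi> t) * (fd ?w (?u t) (?v t) \<bullet> ?v t
            - ?w (?u t) \<bullet> christoffel_form ?A ?g c (?u t) (?v t) (?v t) - (?w (?u t) \<bullet> ?v t)\<^sup>2)"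
        by (simp add: power2_eq_square algebra_simps)
      then show "- (\<phi> t * (?w (?u t) \<bullet> (h *\<^sub>R ?v') + fd ?w (?u t) (h *\<^sub>R ?v t) \<bullet> ?v t)
         + (h *\<^sub>R - (\<phi> t * (?w (?u t) \<bullet> ?v t))) * (?w (?u t) \<bullet> ?v t)) = 0"
        unfolding eq[OF t c] by simp
    qed
    finally have 4: "((\<lambda>s. - (\<phi> s * (?w (?u s) \<bullet> ?v s))) has_derivative (\<lambda>h. 0)) (at t within ?I)" .
    have "\<forall>\<^sub>F s in at t within ?I. - (\<phi> s * (?w (?u s) \<bullet> ?v s)) = \<psi> s"
      using eventually_curve_in[OF C1_curve_continuous[OF C] t smooth_atlasD(1)[OF L.atlas c(1)] c(2)]
      by eventually_elim (use \<psi>_eq[OF _ c(1)] in simp)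
    then show "(\<psi> has_derivative (\<lambda>h. 0)) (at t within ?I)"
      by (rule has_derivative_transform_eventually[OF 4]) (use t \<psi>_eq[OF t c] in auto)
  qed
  then obtain k where k: "\<And>t. t \<in> ?I \<Longrightarrow> \<psi> t = k" by blast
  have "\<exists>b. \<forall>t\<in>?I. \<phi> t - k * t = b"
  proof (rule has_derivative_zero_constant[OF convex_closed_interval])
    fix t assume t: "t \<in> ?I"
    have "(\<phi> has_real_derivative k) (at t within ?I)"
      using \<phi>'[OF t] k[OF t] by (simp add: has_real_derivative_iff_has_vector_derivative)
    then have "((\<lambda>t. \<phi> t - k * t) has_real_derivative 0) (at t within ?I)"
      by (auto intro!: derivative_eq_intros)
    then show "((\<lambda>t. \<phi> t - k * t) has_derivative (\<lambda>h. 0)) (at t within ?I)"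
      by (simp add: has_field_derivative_def lambda_zero)
  qed
  then obtain b where b: "\<And>t. t \<in> ?I \<Longrightarrow> \<phi> t - k * t = b" by blast
  obtain e where e: "e > 0" "\<And>t. t \<in> ?I \<Longrightarrow> t \<noteq> l \<Longrightarrow> dist t l < e \<Longrightarrow> \<sigma> (\<gamma> t) = 1"
    using one(1) unfolding eventually_at by blast
  \<comment> \<open>A second parameter besides \<open>l\<close> at which \<phi> equals 1; this makes
    the slope \<open>k\<close> vanish.\<close>
  define t where "t = max 0 (l - e / 2)"
  have t: "t \<in> ?I" "t < l" "dist t l < e" using l e(1) by (auto simp: t_def dist_real_def)
  have "\<phi> t = 1" "\<phi> l = 1" using e(2)[OF t(1) _ t(3)] t(2) one(2) by (auto simp: \<phi>_def)
  moreover have "\<phi> l - k * l = b" using b[of l] l by simp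
  ultimately have "k * t = k * l" using b[OF t(1)] by linarith
  then have "k = 0" using t(2) by simp
  then have "\<phi> 0 = 1" using b[of 0] \<open>\<phi> l - k * l = b\<close> \<open>\<phi> l = 1\<close> l by simp
  then show ?thesis using pos[of 0] l by (simp add: \<phi>_def)
qed

text \<open>Differentials are local. The maps \<Phi> and \<Psi> are known to coincide only on the
  open set \<open>U1 \<inter> V1\<close>.\<close>

lemma differential_cong_open:
  fixes A :: "('m::{t2_space, second_countable_topology}, 'n::finite) chart set" and B :: "('k, 'n) chart set"
  assumes A: "smooth_atlas A" and W: "open W" "x \<in> W" and eq: "\<And>y. y \<in> W \<Longrightarrow> f y = f' y"
  shows "differential A B f x v = differential A B f' x v"
proof
  fix d :: "('k, 'n) chart"
  let ?c = "chart_at A x"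
  note c = chart_at[OF A, of x]
  have "fd (cmap d \<circ> f \<circ> cinv ?c) (cmap ?c x) = fd (cmap d \<circ> f' \<circ> cinv ?c) (cmap ?c x)"
    by (rule fd_cong_open[OF open_chart_image[OF A c(1) W(1)]])
      (use W(2) c(2) eq in \<open>auto simp: cinv_cmap[OF A c(1)]\<close>)
  then show "differential A B f x v d = differential A B f' x v d"
    using eq[OF W(2)] by (simp add: differential_def Let_def)
qed

theorem corollary1p3:
  fixes M1 :: "('m1::{t2_space, second_countable_topology}, 'n::finite) lorentz"
    and M2 :: "('m2::{t2_space, second_countable_topology}, 'n) lorentz"
    and gp1 :: "('m1, 'n) metric" and gp2 :: "('m2, 'n) metric"
    and s :: "int \<Rightarrow> real" and h1 h2 :: real
    and \<mu>1 :: "real \<Rightarrow> 'm1" and \<mu>2 :: "real \<Rightarrow> 'm2"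
    and V\<mu>1 :: "real \<Rightarrow> ('m1, 'n) tvec" and V\<mu>2 :: "real \<Rightarrow> ('m2, 'n) tvec"
    and U1 V1 W1 :: "'m1 set" and U2 V2 W2 :: "'m2 set"
    and \<Phi> \<Psi> :: "'m1 \<Rightarrow> 'm2"
  assumes dim: "CARD('n) \<ge> 3"
    and open_manifold: "\<not> compact (UNIV :: 'm1 set)" "\<not> compact (UNIV :: 'm2 set)"
    and glob_hyp: "globally_hyperbolic M1" "globally_hyperbolic M2"
    and times: "observer_times s"
    and mu: "future_timelike_geodesic M1 \<mu>1 V\<mu>1" "future_timelike_geodesic M2 \<mu>2 V\<mu>2"
    and gplus: "associated_riemannian M1 gp1" "associated_riemannian M2 gp2"
    and radius: "admissible_radius M1 gp1 s \<mu>1 V\<mu>1 h1" "admissible_radius M2 gp2 s \<mu>2 V\<mu>2 h2"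
    and U1_def: "U1 = observation_region M1 gp1 s \<mu>1 V\<mu>1 h1"
    and U2_def: "U2 = observation_region M2 gp2 s \<mu>2 V\<mu>2 h2"
    and U1_nbhd: "open U1" "compact (closure U1)" "\<mu>1 ` {s (- 1)..s 1} \<subseteq> U1"
    and U2_nbhd: "open U2" "compact (closure U2)" "\<mu>2 ` {s (- 1)..s 1} \<subseteq> U2"
    and V1: "open V1" "compact (closure V1)"
      "V1 \<subseteq> I_past M1 (\<mu>1 (s 1)) - J_past M1 (\<mu>1 (s (- 1)))"
    and V2: "open V2" "compact (closure V2)"
      "V2 \<subseteq> I_past M2 (\<mu>2 (s 1)) - J_past M2 (\<mu>2 (s (- 1)))"
    and Phi_diffeo: "diffeomorphism (atlas M1) (atlas M2) U1 U2 \<Phi>"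
    and Phi_mu: "\<forall>t\<in>{s (- 1)..s 1}. \<Phi> (\<mu>1 t) = \<mu>2 t"
    and Phi_light: "bij_betw ((`) \<Phi>)
      (light_observation_points M1 U1 ` V1) (light_observation_points M2 U2 ` V2)"
    and Psi_diffeo: "diffeomorphism (atlas M1) (atlas M2) V1 V2 \<Psi>"
    and Psi_conformal:
      "conformal_on (atlas M1) V1 (pullback_metric (atlas M1) (atlas M2) \<Psi> (metric M2)) (metric M1)"
    and agree: "\<forall>x\<in>U1 \<inter> V1. \<Phi> x = \<Psi> x"
    and Phi_isometry: "isometry (atlas M1) U1 (metric M1) (atlas M2) U2 (metric M2) \<Phi>"
    and ricci: "ricci_zero_on (atlas M1) (metric M1) W1" "ricci_zero_on (atlas M2) (metric M2) W2"
    and cover: "V1 \<subseteq> W1 \<union> U1" "V2 \<subseteq> W2 \<union> U2"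
    and Phi_W: "\<Phi> ` (U1 - W1) = U2 - W2"
    and connect: "\<forall>x\<in>V1 \<inter> W1. \<exists>y\<in>U1 \<inter> W1. \<exists>l\<ge>0. \<exists>\<gamma> V.
      geodesic (atlas M1) (metric M1) {0..l} \<gamma> V \<and> \<gamma> 0 = x \<and> lightlike M1 x (V 0) \<and>
      \<gamma> l = y \<and> \<gamma> ` {0..l} \<subseteq> V1 \<inter> W1"
  shows "isometry (atlas M1) V1 (metric M1) (atlas M2) V2 (metric M2) \<Psi>"
proof -
  have M: "lorentzian_manifold M1" "lorentzian_manifold M2" using glob_hyp unfolding globally_hyperbolic_def by blast+
  interpret L1: lorentz_mfd M1 by standard (fact M(1))
  interpret L2: lorentz_mfd M2 by standard (fact M(2))
  let ?pb = "pullback_metric (atlas M1) (atlas M2)"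
  have inj\<Psi>: "inj_on \<Psi> V1" and \<Psi>V: "\<And>x. x \<in> V1 \<Longrightarrow> \<Psi> x \<in> V2" and sm\<Psi>: "smooth_map (atlas M1) (atlas M2) V1 \<Psi>"
    using Psi_diffeo unfolding diffeomorphism_def bij_betw_def by blast+
  obtain \<sigma> where \<sigma>: "smooth_fun (atlas M1) V1 \<sigma>" "\<And>x. x \<in> V1 \<Longrightarrow> \<sigma> x > 0"
    and pb: "\<And>x v w. x \<in> V1 \<Longrightarrow> v \<in> tangent_space (atlas M1) x \<Longrightarrow> w \<in> tangent_space (atlas M1) x \<Longrightarrow>
      ?pb \<Psi> (metric M2) x v w = \<sigma> x * metric M1 x v w"
    using Psi_conformal unfolding conformal_on_def by blast
  have \<sigma>U: "\<sigma> x = 1" if x: "x \<in> U1" "x \<in> V1" for x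
  proof -
    have W: "open (U1 \<inter> V1)" using U1_nbhd(1) V1(1) by (rule open_Int)
    \<comment> \<open>A vector of nonzero square, so that equality of the two pull-backs on it
      determines the factor.\<close>
    let ?T = "timefield M1 x"
    have "\<sigma> x * metric M1 x ?T ?T = ?pb \<Psi> (metric M2) x ?T ?T"
      by (rule pb[OF x(2) L1.timefield(1) L1.timefield(1), symmetric])
    also have "\<dots> = ?pb \<Phi> (metric M2) x ?T ?T"
      using differential_cong_open[OF L1.atlas W, of x \<Phi> \<Psi>] agree x unfolding pullback_metric_def by simp
    also have "\<dots> = metric M1 x ?T ?T"
      using Phi_isometry x(1) L1.timefield(1) unfolding isometry_def by blast
    finally show ?thesis using L1.timefield(2)[of x] by simp
  qed
  have s: "s (- 1) < s 1" "{s (- 1)..s 1} \<subseteq> {- 1..1}" using times unfolding observer_times_def by auto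
  have conn: "connected U1"
    unfolding U1_def
    by (rule L1.observation_region_connected[OF _ times radius(1)])
      (use gplus(1) mu(1) in \<open>auto simp: associated_riemannian_def future_timelike_geodesic_def\<close>)
  have \<mu>: "geodesic (atlas M1) (metric M1) {- 1..1} \<mu>1 V\<mu>1" "geodesic (atlas M2) (metric M2) {- 1..1} \<mu>2 V\<mu>2"
    "\<And>t. t \<in> {- 1..1} \<Longrightarrow> future_timelike M1 (\<mu>1 t) (V\<mu>1 t)" "\<And>t. t \<in> {- 1..1} \<Longrightarrow> future_timelike M2 (\<mu>2 t) (V\<mu>2 t)"
    using mu unfolding future_timelike_geodesic_def by blast+
  have causal: "future_causal M2 (\<Phi> x) (differential (atlas M1) (atlas M2) \<Phi> x v)"
    if "x \<in> U1" "future_causal M1 x v" for x v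
  proof (rule isometry_future_causal[OF M Phi_isometry U1_nbhd(1) conn s(1)
      C1_curve_subset[OF geodesic_C1_curve[OF \<mu>(1)] s(2)] C1_curve_subset[OF geodesic_C1_curve[OF \<mu>(2)] s(2)]
      _ _ U1_nbhd(3) _ that])
    fix t assume t: "t \<in> {s (- 1)..s 1}"
    show "future_timelike M1 (\<mu>1 t) (V\<mu>1 t)" "future_timelike M2 (\<mu>2 t) (V\<mu>2 t)" using \<mu>(3,4) s(2) t by blast+
    show "\<Phi> (\<mu>1 t) = \<mu>2 t" using Phi_mu t by blast
  qed
  have light: "light_observation_points M2 U2 ` V2 \<subseteq> (`) \<Phi> ` light_observation_points M1 U1 ` V1"
    using Phi_light unfolding bij_betw_def by simp
  have dim2: "CARD('n) \<ge> 2" using dim by simp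
  have \<Psi>W: "\<Psi> x \<in> W2" if x: "x \<in> V1" "x \<in> W1" for x
  proof (rule ccontr)
    assume nW: "\<Psi> x \<notin> W2"
    then have "\<Psi> x \<in> \<Phi> ` (U1 - W1)" unfolding Phi_W using \<Psi>V[OF x(1)] cover(2) by blast
    then obtain z where z: "z \<in> U1" "z \<notin> W1" "\<Psi> x = \<Phi> z" by blast
    have zV2: "\<Phi> z \<in> V2" using \<Psi>V[OF x(1)] z(3) by simp
    have "z \<in> V1"
      by (rule observed_region_preimage[OF dim2 glob_hyp U1_nbhd(1) Phi_diffeo causal light z(1) zV2])
    then have "\<Psi> x = \<Psi> z" using agree z by simp
    then have "x = z" using inj\<Psi> x(1) \<open>z \<in> V1\<close> unfolding inj_on_def by blast
    then show False using x(2) z(2) by simp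
  qed
  have \<sigma>1: "\<sigma> x = 1" if x: "x \<in> V1" for x
  proof (cases "x \<in> U1")
    case True
    then show ?thesis using \<sigma>U x by blast
  next
    case False
    then have "x \<in> V1 \<inter> W1" using x cover(1) by blast
    then obtain y l \<gamma> V where y: "y \<in> U1" "y \<in> W1" and l: "l \<ge> 0"
      and \<gamma>: "geodesic (atlas M1) (metric M1) {0..l} \<gamma> V" "\<gamma> 0 = x" "lightlike M1 x (V 0)" "\<gamma> l = y"
        "\<gamma> ` {0..l} \<subseteq> V1 \<inter> W1"
      using connect by blast
    \<comment> \<open>The start \<open>x\<close> is outside \<open>U1\<close> and the end
      \<open>y\<close> inside, so the connecting geodesic is not a single point.\<close>
    have "l \<noteq> 0" using \<gamma>(2,4) y(1) False by auto
    then have l0: "l > 0" using l by simp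
    have \<gamma>VW: "\<gamma> t \<in> V1" "\<gamma> t \<in> W1" if "t \<in> {0..l}" for t using \<gamma>(5) that by blast+
    \<comment> \<open>The connecting geodesic may run to the future or to the past. Only its null
      character matters here, and that is preserved from the initial vector.\<close>
    have null: "metric M1 (\<gamma> t) (V t) (V t) = 0" if t: "t \<in> {0..l}" for t
      using L1.geodesic_square_const[OF \<gamma>(1) _ t, of 0] \<gamma>(2,3) l unfolding lightlike_def by simp
    have "\<sigma> (\<gamma> 0) = 1"
    proof (rule conformal_factor_transport[OF M(1) V1(1) \<sigma> \<gamma>(1) l0])
      show "\<gamma> ` {0..l} \<subseteq> V1" using \<gamma>(5) by blast
      show "\<sigma> (\<gamma> l) = 1" using \<sigma>U y(1) \<gamma>(4) \<gamma>VW(1)[of l] l by simp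
      \<comment> \<open>Openness of \<open>U1\<close> yields a whole end piece of the geodesic on
        which \<sigma> is 1; the end point alone would not determine an affine function.\<close>
      have "\<forall>\<^sub>F t in at l within {0..l}. t \<in> {0..l} \<and> \<gamma> t \<in> U1"
        by (rule eventually_curve_in[OF C1_curve_continuous[OF geodesic_C1_curve[OF \<gamma>(1)]] _ U1_nbhd(1)])
          (use l y \<gamma>(4) in auto)
      then show "\<forall>\<^sub>F t in at l within {0..l}. \<sigma> (\<gamma> t) = 1"
        by eventually_elim (use \<sigma>U \<gamma>VW(1) in blast)
      fix t c assume t: "t \<in> {0..l}" and c: "c \<in> atlas M1" "\<gamma> t \<in> cdom c"
      show "fd (half_log_grad (\<sigma> \<circ> cinv c)) (cmap c (\<gamma> t)) (V t c) \<bullet> V t c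
         - half_log_grad (\<sigma> \<circ> cinv c) (cmap c (\<gamma> t)) \<bullet>
             christoffel_form (atlas M1) (metric M1) c (cmap c (\<gamma> t)) (V t c) (V t c)
         - (half_log_grad (\<sigma> \<circ> cinv c) (cmap c (\<gamma> t)) \<bullet> V t c)\<^sup>2 = 0"
        by (rule conformal_factor_null_equation[OF dim M V1(1) sm\<Psi> \<sigma> pb ricci \<gamma>VW[OF t] \<Psi>W[OF \<gamma>VW[OF t]]
            C1_curve_tangent[OF geodesic_C1_curve[OF \<gamma>(1)] t] null[OF t] c])
    qed auto
    then show ?thesis using \<gamma>(2) by simp
  qed
  show ?thesis
    unfolding isometry_def using Psi_diffeo pb \<sigma>1 by simp
qed

end
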